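(* Let $G$ be a $2$-edge-connected graph of order $n\ge 4$. Then $rx_3(G)\le n-2$, with equality if and only if one of the following holds: (i) $G$ is $2$-connected and is isomorphic to the cycle $C_n$, or to a spanning subgraph of the $3$-sun, or to a spanning subgraph of $K_5-e$, or to a spanning subgraph of $K_4$; (ii) $G$ is isomorphic to one of the five graphs $F_1,F_2,F_3,F_4,F_5$ defined in the context.
   Context: All graphs are finite, simple and undirected. Edge-colorings are arbitrary maps from $E(G)$ to a finite set of colors (adjacent edges may receive the same color). A tree $T$ that is a subgraph of an edge-colored graph $G$ is a rainbow tree if no two edges of $T$ have the same color. For $S\subseteq V(G)$, a rainbow $S$-tree is a rainbow tree in $G$ whose vertex set contains $S$ (it may contain other vertices). For a connected graph $G$ of order at least $3$, $rx_3(G)$ (the $3$-rainbow index) is the minimum number of colors in an edge-coloring of $G$ such that for every $3$-element subset $S$ of $V(G)$ there is a rainbow $S$-tree. The $3$-sun is the graph on $6$ vertices obtained from the cycle $C_6=v_1v_2v_3v_4v_5v_6v_1$ by adding the three edges $v_2v_4$, $v_2v_6$, $v_4v_6$. $K_5-e$ is the complete graph $K_5$ with one edge deleted. A spanning subgraph of $H$ is a subgraph with the same vertex set as $H$. The graphs $F_1,\dots,F_5$ are: $F_1$ (order $5$): two triangles sharing exactly one common vertex. $F_2$ (order $6$): the union of the $4$-cycle $v_1v_2v_3v_4v_1$ and the triangle $v_4v_5v_6v_4$ (sharing exactly the vertex $v_4$). $F_3$ (order $6$): $F_2$ together with the edge $v_1v_3$. $F_4$ (order $6$): $F_2$ together with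 the edge $v_2v_4$. $F_5$ (order $7$): the union of the three triangles $v_1v_2v_3v_1$, $v_3v_4v_5v_3$, $v_5v_6v_7v_5$ on vertices $v_1,\dots,v_7$. *)

theory Defs
  imports Main
begin

type_synonym 'a ugraph = "'a set \<times> 'a set set"

abbreviation vertices :: "'a ugraph \<Rightarrow> 'a set" where
  "vertices G \<equiv> fst G"

abbreviation edges :: "'a ugraph \<Rightarrow> 'a set set" where
  "edges G \<equiv> snd G"

definition finite_simple_graph :: "'a ugraph \<Rightarrow> bool" where
  "finite_simple_graph G \<longleftrightarrow>
     finite (vertices G) \<and> (\<forall>e\<in>edges G. e \<subseteq> vertices G \<and> card e = 2)"

definition subgraph_of :: "'a ugraph \<Rightarrow> 'a ugraph \<Rightarrow> bool" where
  "subgraph_of H G \<longleftrightarrow>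
     finite_simple_graph H \<and> vertices H \<subseteq> vertices G \<and> edges H \<subseteq> edges G"

definition spanning_subgraph_of :: "'a ugraph \<Rightarrow> 'a ugraph \<Rightarrow> bool" where
  "spanning_subgraph_of H G \<longleftrightarrow> subgraph_of H G \<and> vertices H = vertices G"

definition graph_isomorphic :: "'a ugraph \<Rightarrow> 'b ugraph \<Rightarrow> bool" where
  "graph_isomorphic G H \<longleftrightarrow>
     (\<exists>f. bij_betw f (vertices G) (vertices H) \<and>
        (\<forall>u\<in>vertices G. \<forall>v\<in>vertices G. {u, v} \<in> edges G \<longleftrightarrow> {f u, f v} \<in> edges H))"

definition connected_graph :: "'a ugraph \<Rightarrow> bool" where
  "connected_graph G \<longleftrightarrow>
     vertices G \<noteq> {} \<and>
     (\<forall>u\<in>vertices G. \<forall>v\<in>vertices G. (u, v) \<in> {(x, y). {x, y} \<in> edges G}\<^sup>*)"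

text \<open>Cycles are given by the cyclic list of their vertices.\<close>

definition graph_cycle :: "'a ugraph \<Rightarrow> 'a list \<Rightarrow> bool" where
  "graph_cycle G xs \<longleftrightarrow>
     3 \<le> length xs \<and> distinct xs \<and>
     (\<forall>i<length xs. {xs ! i, xs ! (Suc i mod length xs)} \<in> edges G)"

definition tree_graph :: "'a ugraph \<Rightarrow> bool" where
  "tree_graph T \<longleftrightarrow> finite_simple_graph T \<and> connected_graph T \<and> (\<nexists>xs. graph_cycle T xs)"

definition remove_edges :: "'a ugraph \<Rightarrow> 'a set set \<Rightarrow> 'a ugraph" where
  "remove_edges G F = (vertices G, edges G - F)"

definition remove_vertices :: "'a ugraph \<Rightarrow> 'a set \<Rightarrow> 'a ugraph" where
  "remove_vertices G X = (vertices G - X, {e \<in> edges G. e \<inter> X = {}})"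

definition edge_conn :: "nat \<Rightarrow> 'a ugraph \<Rightarrow> bool" where
  "edge_conn k G \<longleftrightarrow>
     1 < card (vertices G) \<and>
     (\<forall>F\<subseteq>edges G. card F < k \<longrightarrow> connected_graph (remove_edges G F))"

definition vertex_conn :: "nat \<Rightarrow> 'a ugraph \<Rightarrow> bool" where
  "vertex_conn k G \<longleftrightarrow>
     k < card (vertices G) \<and>
     (\<forall>X\<subseteq>vertices G. card X < k \<longrightarrow> connected_graph (remove_vertices G X))"

text \<open>An edge-colouring of \<open>G\<close> is any function on sets of vertices; only its values on
  \<open>edges G\<close> matter.\<close>

definition rainbow_tree :: "'a ugraph \<Rightarrow> ('a set \<Rightarrow> 'c) \<Rightarrow> 'a ugraph \<Rightarrow> bool" where
  "rainbow_tree G c T \<longleftrightarrow> subgraph_of T G \<and> tree_graph T \<and> inj_on c (edges T)"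

definition rainbow_S_tree :: "'a ugraph \<Rightarrow> ('a set \<Rightarrow> 'c) \<Rightarrow> 'a set \<Rightarrow> 'a ugraph \<Rightarrow> bool" where
  "rainbow_S_tree G c S T \<longleftrightarrow> rainbow_tree G c T \<and> S \<subseteq> vertices T"

definition three_rainbow_colouring :: "'a ugraph \<Rightarrow> ('a set \<Rightarrow> 'c) \<Rightarrow> bool" where
  "three_rainbow_colouring G c \<longleftrightarrow>
     (\<forall>S\<subseteq>vertices G. card S = 3 \<longrightarrow> (\<exists>T. rainbow_S_tree G c S T))"

text \<open>Intended for connected \<open>G\<close> of order at least 3; the minimum then exists, since a
  colouring with pairwise distinct edge colours qualifies. Colours are natural numbers, which
  is no restriction as \<open>edges G\<close> is finite.\<close>

definition rx3 :: "'a ugraph \<Rightarrow> nat" where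
  "rx3 G = (LEAST k. \<exists>c :: 'a set \<Rightarrow> nat. card (c ` edges G) = k \<and> three_rainbow_colouring G c)"

definition cycle_graph :: "nat \<Rightarrow> nat ugraph" where
  "cycle_graph n = ({..<n}, {{i, Suc i mod n} | i. i < n})"

definition complete_graph :: "nat \<Rightarrow> nat ugraph" where
  "complete_graph n = ({..<n}, {{i, j} | i j. i < n \<and> j < n \<and> i \<noteq> j})"

definition K5_minus_edge :: "nat ugraph" where
  "K5_minus_edge = remove_edges (complete_graph 5) {{0, 1}}"

definition three_sun :: "nat ugraph" where
  "three_sun =
     ({1..6}, {{1, 2}, {2, 3}, {3, 4}, {4, 5}, {5, 6}, {6, 1}, {2, 4}, {2, 6}, {4, 6}})"

text \<open>The triangles of \<open>F1\<close> share vertex 3.\<close>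

definition F1 :: "nat ugraph" where
  "F1 = ({1..5}, {{1, 2}, {2, 3}, {3, 1}, {3, 4}, {4, 5}, {5, 3}})"

definition F2 :: "nat ugraph" where
  "F2 = ({1..6}, {{1, 2}, {2, 3}, {3, 4}, {4, 1}, {4, 5}, {5, 6}, {6, 4}})"

definition F3 :: "nat ugraph" where
  "F3 = (vertices F2, insert {1, 3} (edges F2))"

definition F4 :: "nat ugraph" where
  "F4 = (vertices F2, insert {2, 4} (edges F2))"

definition F5 :: "nat ugraph" where
  "F5 = ({1..7},
     {{1, 2}, {2, 3}, {3, 1}, {3, 4}, {4, 5}, {5, 3}, {5, 6}, {6, 7}, {7, 5}})"

end

theory Submission
  imports Defs
begin

text \<open>
  Why the theorem holds. Write \<open>n\<close> for the order of \<open>G\<close> and call \<open>n - rx3 G\<close> the saving of \<open>G\<close>.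

  The saving of a connected graph is at least the saving of each of its connected minors
  (\<open>rx3_minor\<close>): colour the minor optimally, and give private colours to the edges of spanning trees
  of the branch sets. Hence the bound \<open>rx3 G \<le> n - 2\<close> only needs the minors \<open>C4\<close> and two triangles
  with a common vertex, and \<open>G\<close> is not extremal as soon as it contains one of a short list of small
  minors that save 3. For each of these, an explicit colouring together with rainbow trees covering
  all triples of vertices is checked by evaluation.

  The structure of \<open>G\<close> enters only through a longest cycle. A 2-edge-connected graph has an ear on
  each nonempty proper set of vertices (\<open>ear_exists\<close>). If a longest cycle has at least 5 vertices and
  misses a vertex, an ear on it gives a minor saving 3 (\<open>longest_cycle_ear\<close>). If it is Hamiltonian
  and \<open>n \<ge> 7\<close>, so does a chord (\<open>good_chord\<close>), and only \<open>C_n\<close> remains; for \<open>n = 6\<close> the chords that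
  are left lie in a 3-sun (\<open>hexagon\<close>). If it has 3 or 4 vertices, adding ears one at a time either
  produces a longer cycle, or a minor saving 3, or one of \<open>F1\<close> to \<open>F5\<close> (\<open>K23_good\<close>, \<open>F2_good\<close>,
  \<open>F1_extends\<close>, \<open>F5_good\<close>). Orders 4 and 5 are small enough for a direct treatment.

  Conversely, \<open>n - 3\<close> colours do not suffice for the listed graphs. A rainbow tree has at most as many
  edges as there are colours. For some of the graphs this alone rules out a tree for a suitable triple;
  for the others it leaves so few trees that the colours of single edges are forced, up to a
  contradiction. For \<open>C_n\<close>, six edges carry at most three colours; they are cut into three pairs, and
  every path through the three cutting points contains two of the pairs, hence a colour twice.
\<close>

section \<open>Connected edge sets\<close>

definition linked :: "'a set set \<Rightarrow> 'a \<Rightarrow> 'a \<Rightarrow> bool" where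
  "linked F x y \<longleftrightarrow> (x, y) \<in> {(x, y). {x, y} \<in> F}\<^sup>*"

definition joins :: "'a set set \<Rightarrow> 'a set \<Rightarrow> bool" where
  "joins F S \<longleftrightarrow> (\<forall>x\<in>S. \<forall>y\<in>S. linked F x y)"

lemma linked_refl [simp]: "linked F x x"
  unfolding linked_def by simp

lemma linked_step: "linked F x y \<Longrightarrow> {y, z} \<in> F \<Longrightarrow> linked F x z"
  unfolding linked_def by (rule rtrancl_into_rtrancl) auto

lemma linked_edge: "{x, y} \<in> F \<Longrightarrow> linked F x y"
  by (rule linked_step[OF linked_refl])

lemma linked_trans: "linked F x y \<Longrightarrow> linked F y z \<Longrightarrow> linked F x z"
  unfolding linked_def by (rule rtrancl_trans)

lemma linked_induct [consumes 1, case_names base step]: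
  assumes "linked F x y" "P x"
    and "\<And>y z. linked F x y \<Longrightarrow> {y, z} \<in> F \<Longrightarrow> P y \<Longrightarrow> P z"
  shows "P y"
  using assms(1) unfolding linked_def
  by (induction rule: rtrancl_induct) (use assms(2,3) in \<open>auto simp: linked_def\<close>)

lemma linked_sym: "linked F x y \<Longrightarrow> linked F y x"
proof (induction rule: linked_induct)
  case (step y z)
  then have "linked F z y" by (simp add: linked_edge insert_commute)
  with step show ?case using linked_trans by metis
qed simp

lemma linked_mono:
  assumes "linked F x y" "F \<subseteq> F'"
  shows "linked F' x y"
  using assms(1) by (induction rule: linked_induct) (use assms(2) in \<open>auto intro: linked_step\<close>)

lemma joins_mono: "joins F S \<Longrightarrow> F \<subseteq> F' \<Longrightarrow> S' \<subseteq> S \<Longrightarrow> joins F' S'"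
  unfolding joins_def using linked_mono subsetD by metis

lemma joins_from: "(\<And>y. y \<in> S \<Longrightarrow> linked F x y) \<Longrightarrow> joins F S"
  unfolding joins_def using linked_sym linked_trans by metis

lemma linked_crosses:
  assumes "linked F x y" "x \<in> X" "y \<notin> X"
  obtains a b where "{a, b} \<in> F" "a \<in> X" "b \<notin> X"
proof -
  have "y \<in> X \<or> (\<exists>a b. {a, b} \<in> F \<and> a \<in> X \<and> b \<notin> X)"
    using assms(1) by (induction rule: linked_induct) (use assms(2) in auto)
  with assms(3) that show ?thesis by blast
qed

lemma connected_graph_iff: "connected_graph G \<longleftrightarrow> vertices G \<noteq> {} \<and> joins (edges G) (vertices G)"
  unfolding connected_graph_def joins_def linked_def by simp

lemma joins_crosses:
  assumes "joins F S" "x \<in> S \<inter> X" "y \<in> S - X"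
  obtains a b where "{a, b} \<in> F" "a \<in> X" "b \<notin> X"
  using assms linked_crosses[of F x y X] unfolding joins_def by blast

lemma fsg_edgeD:
  assumes "finite_simple_graph G" "{x, y} \<in> edges G"
  shows "x \<in> vertices G" "y \<in> vertices G" "x \<noteq> y"
  using assms unfolding finite_simple_graph_def by fastforce+

lemma fsg_edge_cases:
  assumes "finite_simple_graph G" "e \<in> edges G"
  obtains x y where "e = {x, y}" "x \<noteq> y" "x \<in> vertices G" "y \<in> vertices G"
  using assms unfolding finite_simple_graph_def by (metis card_2_iff insert_subset)

lemma fsg_finite:
  assumes "finite_simple_graph G"
  shows "finite (vertices G)" "finite (edges G)"
proof -
  show "finite (vertices G)"
    using assms unfolding finite_simple_graph_def by blast
  moreover have "edges G \<subseteq> Pow (vertices G)"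
    using assms unfolding finite_simple_graph_def by blast
  ultimately show "finite (edges G)"
    by (meson finite_Pow_iff finite_subset)
qed

lemma component_subset:
  assumes G: "finite_simple_graph G" and F: "F \<subseteq> edges G" and s: "s \<in> vertices G"
  shows "{x. linked F s x} \<subseteq> vertices G"
proof
  fix x assume "x \<in> {x. linked F s x}"
  then have "linked F s x" by simp
  then show "x \<in> vertices G"
  proof (induction rule: linked_induct)
    case (step y z)
    then show ?case using fsg_edgeD(2)[OF G, of y z] F by blast
  qed (rule s)
qed

lemma linked_in_component:
  assumes "linked F s x"
  shows "linked {e \<in> F. e \<subseteq> {x. linked F s x}} s x"
  using assms
proof (induction rule: linked_induct)
  case (step y z)
  have "linked F s z" using step.hyps by (rule linked_step)
  with step.hyps have "{y, z} \<in> {e \<in> F. e \<subseteq> {x. linked F s x}}" by simp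
  with step.IH show ?case by (rule linked_step)
qed simp

lemma cycle_edge_redundant:
  assumes "graph_cycle T xs"
  shows "linked (edges T - {{xs ! 0, xs ! 1}}) (xs ! 1) (xs ! 0)"
proof -
  let ?F = "edges T - {{xs ! 0, xs ! 1}}"
  have len: "3 \<le> length xs" and dist: "distinct xs"
    and edge: "\<And>i. i < length xs \<Longrightarrow> {xs ! i, xs ! (Suc i mod length xs)} \<in> edges T"
    using assms unfolding graph_cycle_def by auto
  have neq: "xs ! i \<noteq> xs ! j" if "i < length xs" "j < length xs" "i \<noteq> j" for i j
    using dist that nth_eq_iff_index_eq by blast
  have reach: "linked ?F (xs ! 1) (xs ! Suc i)" if "Suc i < length xs" for i
    using that
  proof (induction i)
    case (Suc i)
    have "{xs ! Suc i, xs ! Suc (Suc i)} \<in> edges T"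
      using edge[of "Suc i"] Suc.prems by simp
    moreover have "xs ! Suc (Suc i) \<noteq> xs ! 0" "xs ! Suc (Suc i) \<noteq> xs ! 1"
      by (rule neq; use Suc.prems in linarith)+
    then have "{xs ! Suc i, xs ! Suc (Suc i)} \<noteq> {xs ! 0, xs ! 1}"
      by (metis doubleton_eq_iff)
    ultimately have "{xs ! Suc i, xs ! Suc (Suc i)} \<in> ?F" by blast
    with Suc show ?case by (meson Suc_lessD linked_step)
  qed simp
  let ?m = "length xs - 1"
  have "linked ?F (xs ! 1) (xs ! ?m)"
    using reach[of "?m - 1"] len by (simp add: numeral_eq_Suc Suc_diff_Suc)
  moreover have "{xs ! ?m, xs ! 0} \<in> ?F"
  proof -
    have "Suc ?m mod length xs = 0" using len by (cases xs) auto
    moreover have "?m < length xs" using len by linarith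
    ultimately have "{xs ! ?m, xs ! 0} \<in> edges T" using edge[of ?m] by metis
    moreover have "xs ! ?m \<noteq> xs ! 0" "xs ! ?m \<noteq> xs ! 1"
      by (rule neq; use len in linarith)+
    then have "{xs ! ?m, xs ! 0} \<noteq> {xs ! 0, xs ! 1}"
      by (metis doubleton_eq_iff)
    ultimately show ?thesis by blast
  qed
  ultimately show ?thesis by (rule linked_step)
qed

text \<open>A rainbow edge set that connects \<open>S\<close> is as good as a rainbow \<open>S\<close>-tree: restricted to the
  component of \<open>S\<close>, an inclusion-minimal connected edge set has no cycle, because every edge of a
  cycle can be bypassed.\<close>

lemma rainbow_tree_from_joins:
  assumes G: "finite_simple_graph G" and F: "F \<subseteq> edges G" "inj_on c F"
    and S: "joins F S" "S \<subseteq> vertices G" "S \<noteq> {}"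
  shows "\<exists>T. rainbow_S_tree G c S T"
proof -
  obtain s where s: "s \<in> S" using S by blast
  define W where "W = {x. linked F s x}"
  have SW: "S \<subseteq> W" using S(1) s unfolding joins_def W_def by blast
  have WV: "W \<subseteq> vertices G"
    unfolding W_def using component_subset[OF G F(1)] s S(2) by blast
  define A where "A = {F'. F' \<subseteq> F \<and> (\<forall>e\<in>F'. e \<subseteq> W) \<and> joins F' W}"
  have "{e \<in> F. e \<subseteq> W} \<in> A"
  proof -
    have "joins {e \<in> F. e \<subseteq> W} W"
      unfolding W_def by (rule joins_from[of _ _ s]) (use linked_in_component[of F s] in simp)
    then show ?thesis unfolding A_def by auto
  qed
  then obtain F' where F': "F' \<in> A" and min: "\<And>F''. F'' \<in> A \<Longrightarrow> card F' \<le> card F''"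
    using ex_has_least_nat[of "\<lambda>F'. F' \<in> A" _ card] by blast
  have F'F: "F' \<subseteq> F" and F'W: "\<And>e. e \<in> F' \<Longrightarrow> e \<subseteq> W" and joinF': "joins F' W"
    using F' unfolding A_def by auto
  have finF': "finite F'"
    using F'F F(1) fsg_finite(2)[OF G] by (meson finite_subset)
  let ?T = "(W, F')"
  have fsgT: "finite_simple_graph ?T"
    using G F'F F'W F(1) WV unfolding finite_simple_graph_def
    by (auto intro: finite_subset)
  have connT: "connected_graph ?T"
    using joinF' s SW unfolding connected_graph_iff by auto
  have "\<not> graph_cycle ?T xs" for xs
  proof
    assume cyc: "graph_cycle ?T xs"
    let ?e = "{xs ! 0, xs ! 1}"
    have bypass: "linked (F' - {?e}) (xs ! 1) (xs ! 0)"
      using cycle_edge_redundant[OF cyc] by simp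
    have "?e \<in> F'"
    proof -
      have "3 \<le> length xs" "\<forall>i<length xs. {xs ! i, xs ! (Suc i mod length xs)} \<in> F'"
        using cyc unfolding graph_cycle_def by auto
      moreover from this have "0 < length xs" "Suc 0 mod length xs = 1" by auto
      ultimately show ?thesis by fastforce
    qed
    have "linked (F' - {?e}) x y" if "linked F' x y" for x y
      using that
    proof (induction rule: linked_induct)
      case (step y z)
      have "linked (F' - {?e}) y z"
      proof (cases "{y, z} = ?e")
        case True
        then have "y = xs ! 0 \<and> z = xs ! 1 \<or> y = xs ! 1 \<and> z = xs ! 0"
          by (metis doubleton_eq_iff)
        with bypass show ?thesis using linked_sym by metis
      next
        case False
        with step show ?thesis by (auto intro: linked_edge)
      qed
      with step.IH show ?case by (rule linked_trans)
    qed simp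
    then have "joins (F' - {?e}) W"
      using joinF' unfolding joins_def by blast
    then have "F' - {?e} \<in> A"
      using F'F F'W unfolding A_def by auto
    from min[OF this] \<open>?e \<in> F'\<close> finF' show False
      by (metis card_Diff1_less not_less)
  qed
  with fsgT connT have "tree_graph ?T" unfolding tree_graph_def by blast
  moreover have "subgraph_of ?T G"
    using fsgT WV F'F F(1) unfolding subgraph_of_def by auto
  moreover have "inj_on c F'"
    using F(2) F'F by (rule inj_on_subset)
  ultimately have "rainbow_S_tree G c S ?T"
    using SW unfolding rainbow_S_tree_def rainbow_tree_def by simp
  then show ?thesis by blast
qed

text \<open>The condition \<open>rx3 G \<le> k\<close> without trees. Colours range over \<open>{..<k}\<close> and need not all occur, so
  that the property is monotone in \<open>k\<close>.\<close>

definition colourable :: "'a ugraph \<Rightarrow> nat \<Rightarrow> bool" where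
  "colourable G k \<longleftrightarrow> (\<exists>c :: 'a set \<Rightarrow> nat. c ` edges G \<subseteq> {..<k} \<and>
     (\<forall>S\<subseteq>vertices G. card S = 3 \<longrightarrow> (\<exists>F\<subseteq>edges G. inj_on c F \<and> joins F S)))"

lemma colourable_mono: "colourable G k \<Longrightarrow> k \<le> l \<Longrightarrow> colourable G l"
  unfolding colourable_def by (meson lessThan_subset_iff order_trans)

text \<open>The names of the colours are irrelevant, so any colour type may be used.\<close>

lemma colourableI:
  fixes c :: "'a set \<Rightarrow> 'c"
  assumes fin: "finite (edges G)" and k: "card (c ` edges G) \<le> k"
    and S: "\<And>S. S \<subseteq> vertices G \<Longrightarrow> card S = 3 \<Longrightarrow> \<exists>F\<subseteq>edges G. inj_on c F \<and> joins F S"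
  shows "colourable G k"
proof -
  have "finite (c ` edges G)" using fin by simp
  then obtain h :: "'c \<Rightarrow> nat" where h: "bij_betw h (c ` edges G) {0..<card (c ` edges G)}"
    using ex_bij_betw_finite_nat by blast
  let ?d = "h \<circ> c"
  have "?d ` edges G = {0..<card (c ` edges G)}"
    using h unfolding bij_betw_def by (simp add: image_comp)
  then have "?d ` edges G \<subseteq> {..<k}" using k by auto
  moreover have "\<exists>F\<subseteq>edges G. inj_on ?d F \<and> joins F S"
    if "S \<subseteq> vertices G" "card S = 3" for S
  proof -
    from S[OF that] obtain F where F: "F \<subseteq> edges G" "inj_on c F" "joins F S"
      by (elim exE conjE)
    have "inj_on h (c ` F)"
      using inj_on_subset[OF bij_betw_imp_inj_on[OF h] image_mono[OF F(1)]] .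
    from comp_inj_on[OF F(2) this] F(1,3) show ?thesis by (intro exI[of _ F] conjI)
  qed
  ultimately show ?thesis unfolding colourable_def by blast
qed

lemma rx3_le:
  assumes G: "finite_simple_graph G" and "colourable G k"
  shows "rx3 G \<le> k"
proof -
  obtain c :: "'a set \<Rightarrow> nat" where c: "c ` edges G \<subseteq> {..<k}"
    and S: "\<And>S. S \<subseteq> vertices G \<Longrightarrow> card S = 3 \<Longrightarrow> \<exists>F\<subseteq>edges G. inj_on c F \<and> joins F S"
    using assms(2) unfolding colourable_def by blast
  have "three_rainbow_colouring G c"
    unfolding three_rainbow_colouring_def
  proof (intro allI impI)
    fix S assume "S \<subseteq> vertices G" "card S = 3"
    moreover from this have "S \<noteq> {}" by auto
    ultimately show "\<exists>T. rainbow_S_tree G c S T"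
      using S rainbow_tree_from_joins[OF G] by meson
  qed
  then have "rx3 G \<le> card (c ` edges G)"
    unfolding rx3_def by (intro Least_le exI[of _ c]) simp
  also have "\<dots> \<le> k" using c card_mono[of "{..<k}"] by fastforce
  finally show ?thesis .
qed

lemma colourable_rx3:
  assumes G: "finite_simple_graph G" and conn: "connected_graph G"
  shows "colourable G (rx3 G)"
proof -
  have join: "joins (edges G) (vertices G)"
    using conn unfolding connected_graph_iff by blast
  obtain c0 :: "'a set \<Rightarrow> nat" where "inj_on c0 (edges G)"
    using fsg_finite(2)[OF G] finite_imp_inj_to_nat_seg by blast
  then have "three_rainbow_colouring G c0"
    unfolding three_rainbow_colouring_def
  proof (intro allI impI)
    fix S assume S: "S \<subseteq> vertices G" "card S = 3"
    then have "S \<noteq> {}" by auto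
    moreover have "joins (edges G) S" using joins_mono[OF join order_refl S(1)] .
    ultimately show "\<exists>T. rainbow_S_tree G c0 S T"
      using rainbow_tree_from_joins[OF G order_refl \<open>inj_on c0 (edges G)\<close>] S(1) by blast
  qed
  then have "\<exists>k. \<exists>c :: 'a set \<Rightarrow> nat. card (c ` edges G) = k \<and> three_rainbow_colouring G c"
    by blast
  from LeastI_ex[OF this] obtain c :: "'a set \<Rightarrow> nat"
    where c: "card (c ` edges G) = rx3 G" and rc: "three_rainbow_colouring G c"
    unfolding rx3_def by blast
  show ?thesis
  proof (rule colourableI)
    show "finite (edges G)" using fsg_finite(2)[OF G] .
    show "card (c ` edges G) \<le> rx3 G" using c by simp
    fix S assume "S \<subseteq> vertices G" "card S = 3"
    then obtain T where "rainbow_S_tree G c S T"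
      using rc unfolding three_rainbow_colouring_def by blast
    then have T: "edges T \<subseteq> edges G" "inj_on c (edges T)" "joins (edges T) (vertices T)"
      "S \<subseteq> vertices T"
      unfolding rainbow_S_tree_def rainbow_tree_def subgraph_of_def tree_graph_def
        connected_graph_iff by blast+
    from T(1,2) joins_mono[OF T(3) order_refl T(4)]
    show "\<exists>F\<subseteq>edges G. inj_on c F \<and> joins F S" by blast
  qed
qed

section \<open>Connected vertex sets\<close>

text \<open>Vertex sets that induce a connected subgraph. Growing them vertex by vertex yields a spanning tree
  with one edge less than vertices.\<close>

inductive conn_set :: "'a set set \<Rightarrow> 'a set \<Rightarrow> bool" for E where
  single: "conn_set E {x}"
| grow: "conn_set E A \<Longrightarrow> x \<in> A \<Longrightarrow> y \<notin> A \<Longrightarrow> {x, y} \<in> E \<Longrightarrow> conn_set E (insert y A)"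

lemma conn_set_finite: "conn_set E A \<Longrightarrow> finite A"
  by (induction rule: conn_set.induct) auto

lemma conn_set_nonempty: "conn_set E A \<Longrightarrow> A \<noteq> {}"
  by (induction rule: conn_set.induct) auto

lemma conn_set_spanning_tree:
  "conn_set E A \<Longrightarrow> \<exists>T\<subseteq>E. (\<forall>e\<in>T. e \<subseteq> A) \<and> finite T \<and> card T < card A \<and> joins T A"
proof (induction rule: conn_set.induct)
  case (single x)
  show ?case by (intro exI[of _ "{}"]) (simp add: joins_def)
next
  case (grow A x y)
  then obtain T where T: "T \<subseteq> E" "\<forall>e\<in>T. e \<subseteq> A" "finite T" "card T < card A" "joins T A"
    by blast
  have "joins (insert {x, y} T) (insert y A)"
  proof (rule joins_from[of _ _ x])
    fix z assume "z \<in> insert y A"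
    then show "linked (insert {x, y} T) x z"
      using T(5) grow.hyps(2) unfolding joins_def
      by (elim insertE) (auto intro: linked_edge linked_mono)
  qed
  moreover have "card (insert {x, y} T) < card (insert y A)"
    using T(3,4) grow.hyps(3) conn_set_finite[OF grow.hyps(1)]
    by (simp add: card_insert_if)
  ultimately show ?case
    using T(1-3) grow.hyps(2,4) by (intro exI[of _ "insert {x, y} T"]) auto
qed

lemma conn_set_joins:
  assumes "conn_set E A"
  shows "joins {e \<in> E. e \<subseteq> A} A"
proof -
  obtain T where T: "T \<subseteq> E" "\<forall>e\<in>T. e \<subseteq> A" "joins T A"
    using conn_set_spanning_tree[OF assms] by auto
  then have "T \<subseteq> {e \<in> E. e \<subseteq> A}" by blast
  from joins_mono[OF T(3) this order_refl] show ?thesis .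
qed

lemma conn_setI:
  assumes A: "finite A" "x \<in> A" and J: "\<And>y. y \<in> A \<Longrightarrow> linked {e \<in> E. e \<subseteq> A} x y"
  shows "conn_set E A"
proof -
  have "conn_set E A" if "conn_set E B" "B \<subseteq> A" "x \<in> B" for B
    using that
  proof (induction "card (A - B)" arbitrary: B rule: less_induct)
    case less
    show ?case
    proof (cases "B = A")
      case False
      then obtain y where y: "y \<in> A" "y \<notin> B" using less.prems by blast
      then obtain a b where ab: "{a, b} \<in> {e \<in> E. e \<subseteq> A}" "a \<in> B" "b \<notin> B"
        using linked_crosses[OF J[OF y(1)] less.prems(3)] by metis
      then have "conn_set E (insert b B)"
        using conn_set.grow[OF less.prems(1) ab(2,3)] by simp
      moreover have "card (A - insert b B) < card (A - B)"
        using ab A(1) by (intro psubset_card_mono) auto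
      ultimately show ?thesis
        using less.hyps[of "insert b B"] ab(1) less.prems(2,3) by simp
    qed (use less in simp)
  qed
  from this[OF conn_set.single] A(2) show ?thesis by simp
qed

section \<open>Minors\<close>

text \<open>The map \<open>p\<close> contracts \<open>G\<close> onto a graph that contains \<open>K\<close>: its fibres are the branch sets of a
  minor model. A colouring of \<open>K\<close> lifts to \<open>G\<close>: spanning trees of the fibres have
  \<open>card (vertices G) - card (vertices K)\<close> edges altogether, which receive private colours and can
  be added to every rainbow edge set.\<close>

lemma colourable_lift:
  assumes G: "finite_simple_graph G" and K: "finite_simple_graph K"
    and p: "p ` vertices G = vertices K"
    and fibre: "\<And>i. i \<in> vertices K \<Longrightarrow> conn_set (edges G) {x \<in> vertices G. p x = i}"
    and lift: "\<And>e. e \<in> edges K \<Longrightarrow> \<exists>e'\<in>edges G. p ` e' = e"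
    and K3: "3 \<le> card (vertices K)" and ne: "edges K \<noteq> {}"
    and col: "colourable K k"
  shows "colourable G (k + (card (vertices G) - card (vertices K)))"
proof -
  let ?V = "vertices G" and ?E = "edges G" and ?I = "vertices K"
  let ?B = "\<lambda>i. {x \<in> ?V. p x = i}"
  obtain c :: "'b set \<Rightarrow> nat" where c: "c ` edges K \<subseteq> {..<k}"
    and cS: "\<And>S. S \<subseteq> ?I \<Longrightarrow> card S = 3 \<Longrightarrow> \<exists>F\<subseteq>edges K. inj_on c F \<and> joins F S"
    using col unfolding colourable_def by blast
  obtain e0 where e0: "e0 \<in> edges K" using ne by blast
  have finV: "finite ?V" and finE: "finite ?E" and finI: "finite ?I"
    using fsg_finite[OF G] fsg_finite[OF K] by auto
  have "\<forall>i\<in>?I. \<exists>T. T \<subseteq> ?E \<and> (\<forall>e\<in>T. e \<subseteq> ?B i) \<and> finite T \<and> card T < card (?B i) \<and> joins T (?B i)"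
    using conn_set_spanning_tree[OF fibre] by auto
  from bchoice[OF this] obtain T where T0: "\<forall>i\<in>?I. T i \<subseteq> ?E \<and> (\<forall>e\<in>T i. e \<subseteq> ?B i) \<and>
    finite (T i) \<and> card (T i) < card (?B i) \<and> joins (T i) (?B i)" by (elim exE)
  have T: "\<And>i. i \<in> ?I \<Longrightarrow> T i \<subseteq> ?E" "\<And>i e. i \<in> ?I \<Longrightarrow> e \<in> T i \<Longrightarrow> e \<subseteq> ?B i"
    "\<And>i. i \<in> ?I \<Longrightarrow> finite (T i)" "\<And>i. i \<in> ?I \<Longrightarrow> card (T i) < card (?B i)"
    "\<And>i. i \<in> ?I \<Longrightarrow> joins (T i) (?B i)"
    using T0 by blast+
  define U where "U = (\<Union>i\<in>?I. T i)"
  have "card ?V = (\<Sum>i\<in>?I. card (?B i))"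
  proof -
    have "?V = (\<Union>i\<in>?I. ?B i)" using p by auto
    then have "card ?V = card (\<Union>i\<in>?I. ?B i)" by simp
    also have "\<dots> = (\<Sum>i\<in>?I. card (?B i))"
      using finV finI by (intro card_UN_disjoint) auto
    finally show ?thesis .
  qed
  moreover have "(\<Sum>i\<in>?I. card (T i) + 1) \<le> (\<Sum>i\<in>?I. card (?B i))"
    using T(4) by (intro sum_mono) (simp add: Suc_leI)
  moreover have "card U \<le> (\<Sum>i\<in>?I. card (T i))"
    unfolding U_def using finI by (intro card_UN_le)
  moreover have "(\<Sum>i\<in>?I. card (T i) + 1) = (\<Sum>i\<in>?I. card (T i)) + card ?I"
    unfolding sum.distrib by simp
  ultimately have cardU: "card U \<le> card ?V - card ?I" by linarith
  have UE: "U \<subseteq> ?E" using T(1) unfolding U_def by blast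
  have collapse: "card (p ` e) = 1" if e: "e \<in> U" for e
  proof -
    obtain i where i: "i \<in> ?I" "e \<in> T i" using e unfolding U_def by blast
    have "e \<noteq> {}" using e UE G unfolding finite_simple_graph_def by fastforce
    with T(2)[OF i] have "p ` e = {i}" by auto
    then show ?thesis by simp
  qed
  obtain l where l: "\<And>e. e \<in> edges K \<Longrightarrow> l e \<in> ?E" "\<And>e. e \<in> edges K \<Longrightarrow> p ` (l e) = e"
    using bchoice[of "edges K" "\<lambda>e e'. e' \<in> ?E \<and> p ` e' = e"] lift by (metis (no_types))
  have lU: "l e \<notin> U" if "e \<in> edges K" for e
    using collapse[of "l e"] l(2)[OF that] that K unfolding finite_simple_graph_def by auto
  \<comment> \<open>Private colours are tagged with \<open>Inr\<close>. All other edges take an old colour, so that the number of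
    colours grows by \<open>card U\<close> only.\<close>
  define d :: "'a set \<Rightarrow> nat + 'a set" where
    "d e = (if e \<in> U then Inr e else if p ` e \<in> edges K then Inl (c (p ` e)) else Inl (c e0))" for e
  show ?thesis
  proof (rule colourableI[OF finE])
    have "d ` ?E \<subseteq> Inl ` {..<k} \<union> Inr ` U"
      using c e0 unfolding d_def by auto
    moreover have "finite U" using UE finE by (rule finite_subset)
    ultimately have "card (d ` ?E) \<le> card (Inl ` {..<k} \<union> Inr ` U :: (nat + 'a set) set)"
      by (intro card_mono) auto
    also have "\<dots> \<le> card (Inl ` {..<k} :: (nat + 'a set) set) + card (Inr ` U :: (nat + 'a set) set)"
      by (rule card_Un_le)
    also have "\<dots> = k + card U" by (simp add: card_image)
    finally show "card (d ` ?E) \<le> k + (card ?V - card ?I)" using cardU by simp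
  next
    fix S assume S: "S \<subseteq> ?V" "card S = 3"
    have finS: "finite S" using S(1) finV by (rule finite_subset)
    have "p ` S \<subseteq> ?I" "card (p ` S) \<le> 3" using S p card_image_le[OF finS] by auto
    then obtain S' where S': "p ` S \<subseteq> S'" "S' \<subseteq> ?I" "card S' = 3"
      using exists_subset_between[of "p ` S" 3 ?I] K3 finI by auto
    obtain F where F: "F \<subseteq> edges K" "inj_on c F" "joins F S'"
      using cS[OF S'(2,3)] by blast
    define F' where "F' = l ` F \<union> U"
    have in_fibre: "linked F' x y" if "x \<in> ?V" "y \<in> ?V" "p x = p y" for x y
    proof -
      have "p x \<in> ?I" using p that by blast
      then have "linked (T (p x)) x y"
        using T(5)[of "p x"] that unfolding joins_def by simp
      moreover have "T (p x) \<subseteq> F'"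
        using \<open>p x \<in> ?I\<close> unfolding F'_def U_def by blast
      ultimately show ?thesis by (rule linked_mono)
    qed
    have reach: "\<forall>y\<in>?V. p y = j \<longrightarrow> linked F' x y" if "linked F (p x) j" "x \<in> ?V" for x j
      using that(1)
    proof (induction rule: linked_induct)
      case base
      show ?case using in_fibre that(2) by simp
    next
      case (step i j)
      have le: "l {i, j} \<in> ?E" "p ` l {i, j} = {i, j}" "l {i, j} \<in> F'"
        using l[of "{i, j}"] step.hyps(2) F(1) unfolding F'_def by blast+
      then obtain a b where ab: "l {i, j} = {a, b}" "a \<in> ?V" "b \<in> ?V" "p a = i" "p b = j"
        using fsg_edge_cases[OF G le(1)]
      proof -
        obtain a b where ab: "l {i, j} = {a, b}" "a \<in> ?V" "b \<in> ?V"
          using fsg_edge_cases[OF G le(1)] by metis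
        with le(2) have "p a = i \<and> p b = j \<or> p a = j \<and> p b = i"
          by (simp add: doubleton_eq_iff)
        with ab that[of a b] that[of b a] show ?thesis by (metis insert_commute)
      qed
      have "linked F' x a" using step.IH ab by blast
      with le(3) ab(1) have "linked F' x b" by (metis linked_step)
      with in_fibre[OF ab(3)] ab(5) show ?case by (metis linked_trans)
    qed
    have "joins F' S"
      unfolding joins_def
    proof (intro ballI)
      fix x y assume xy: "x \<in> S" "y \<in> S"
      then have "linked F (p x) (p y)" using F(3) S'(1) unfolding joins_def by blast
      with reach xy S(1) show "linked F' x y" by blast
    qed
    moreover have "inj_on d F'"
    proof -
      have cases: "(\<exists>e\<in>F. x = l e \<and> d x = Inl (c e)) \<or> d x = Inr x" if "x \<in> F'" for x
      proof (cases "x \<in> U")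
        case True
        then show ?thesis unfolding d_def by simp
      next
        case False
        with that obtain e where e: "e \<in> F" "x = l e" unfolding F'_def by blast
        then have "d x = Inl (c e)"
          using False F(1) l(2)[of e] unfolding d_def by (simp add: subsetD)
        with e show ?thesis by blast
      qed
      show ?thesis
      proof (rule inj_onI)
        fix x y assume "x \<in> F'" "y \<in> F'" and eq: "d x = d y"
        from cases[OF this(1)] cases[OF this(2)] show "x = y"
          using eq inj_onD[OF F(2)] by (metis sum.inject sum.distinct(1))
      qed
    qed
    moreover have "F' \<subseteq> ?E" using l(1) F(1) UE unfolding F'_def by auto
    ultimately show "\<exists>F\<subseteq>?E. inj_on d F \<and> joins F S" by (intro exI[of _ F'] conjI)
  qed
qed

text \<open>Branch sets need not cover the host: in a connected graph an uncovered vertex can always be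
  added to a neighbouring branch set.\<close>

lemma extend_fibres:
  assumes G: "finite_simple_graph G" "connected_graph G"
    and U: "U \<subseteq> vertices G" "U \<noteq> {}"
    and fibre: "\<And>i. i \<in> I \<Longrightarrow> conn_set (edges G) {x \<in> U. p x = i}"
    and pI: "p ` U \<subseteq> I"
  shows "\<exists>q. (\<forall>x\<in>U. q x = p x) \<and> q ` vertices G \<subseteq> I \<and>
    (\<forall>i\<in>I. conn_set (edges G) {x \<in> vertices G. q x = i})"
  using U fibre pI
proof (induction "card (vertices G - U)" arbitrary: U p rule: less_induct)
  case less
  show ?case
  proof (cases "U = vertices G")
    case True
    with less.prems show ?thesis by (intro exI[of _ p]) auto
  next
    case False
    obtain u v where "u \<in> U" "v \<in> vertices G - U" using False less.prems(1,2) by blast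
    moreover have "joins (edges G) (vertices G)" using G(2) unfolding connected_graph_iff by simp
    ultimately obtain a b where ab: "{a, b} \<in> edges G" "a \<in> U" "b \<notin> U"
      using joins_crosses[of "edges G" "vertices G" u U v] less.prems(1) by blast
    have b: "b \<in> vertices G" using fsg_edgeD(2)[OF G(1) ab(1)] .
    let ?p = "p(b := p a)" and ?U = "insert b U"
    have smaller: "card (vertices G - ?U) < card (vertices G - U)"
      using ab(3) b fsg_finite(1)[OF G(1)] by (intro psubset_card_mono) auto
    have fib: "conn_set (edges G) {x \<in> ?U. ?p x = i}" if "i \<in> I" for i
    proof (cases "i = p a")
      case True
      have "{x \<in> ?U. ?p x = i} = insert b {x \<in> U. p x = i}" using True ab(3) by auto
      moreover have "conn_set (edges G) (insert b {x \<in> U. p x = i})"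
        using conn_set.grow[OF less.prems(3)[OF that], of a b] True ab by simp
      ultimately show ?thesis by simp
    next
      case False
      then have "{x \<in> ?U. ?p x = i} = {x \<in> U. p x = i}" using ab(3) by auto
      with less.prems(3)[OF that] show ?thesis by simp
    qed
    have "?p ` ?U \<subseteq> I" using less.prems(4) ab(2,3) by auto
    from less.hyps[OF smaller _ _ fib this] b less.prems(1)
    obtain q where "\<forall>x\<in>?U. q x = ?p x" "q ` vertices G \<subseteq> I"
      "\<forall>i\<in>I. conn_set (edges G) {x \<in> vertices G. q x = i}" by auto
    moreover from this(1) ab(3) have "\<forall>x\<in>U. q x = p x" by auto
    ultimately show ?thesis by blast
  qed
qed


text \<open>The saving \<open>card (vertices G) - rx3 G\<close> never drops when passing from a minor to a connected
  host. The map \<open>B\<close> assigns to each vertex of the minor its branch set.\<close>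

lemma rx3_minor:
  assumes G: "finite_simple_graph G" "connected_graph G" and K: "finite_simple_graph K"
    and K3: "3 \<le> card (vertices K)" and ne: "edges K \<noteq> {}" and col: "colourable K k"
    and B: "\<And>i. i \<in> vertices K \<Longrightarrow> conn_set (edges G) (B i)" "\<And>i. i \<in> vertices K \<Longrightarrow> B i \<subseteq> vertices G"
    and disj: "\<And>i j. i \<in> vertices K \<Longrightarrow> j \<in> vertices K \<Longrightarrow> i \<noteq> j \<Longrightarrow> B i \<inter> B j = {}"
    and link: "\<And>i j. {i, j} \<in> edges K \<Longrightarrow> \<exists>x\<in>B i. \<exists>y\<in>B j. {x, y} \<in> edges G"
  shows "rx3 G \<le> k + (card (vertices G) - card (vertices K))"
proof -
  let ?I = "vertices K"
  define U where "U = (\<Union>i\<in>?I. B i)"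
  define p where "p x = (THE i. i \<in> ?I \<and> x \<in> B i)" for x
  have p: "p x = i" if "i \<in> ?I" "x \<in> B i" for x i
    unfolding p_def using that disj by (intro the_equality) auto
  have fibU: "{x \<in> U. p x = i} = B i" if "i \<in> ?I" for i
    using p that unfolding U_def by auto
  have "?I \<noteq> {}" using K3 by auto
  then have "U \<noteq> {}" using conn_set_nonempty[OF B(1)] unfolding U_def by blast
  moreover have "U \<subseteq> vertices G" using B(2) unfolding U_def by blast
  moreover have "p ` U \<subseteq> ?I" using p unfolding U_def by auto
  ultimately obtain q where q: "\<forall>x\<in>U. q x = p x" "q ` vertices G \<subseteq> ?I"
    "\<forall>i\<in>?I. conn_set (edges G) {x \<in> vertices G. q x = i}"
    using extend_fibres[OF G, of U ?I p] B(1) fibU by auto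
  have qB: "q x = i" if "i \<in> ?I" "x \<in> B i" for x i
    using q(1) p[OF that] that unfolding U_def by blast
  have onto: "q ` vertices G = ?I"
  proof
    show "?I \<subseteq> q ` vertices G"
      using conn_set_nonempty q(3) by blast
  qed (rule q(2))
  have lift: "\<exists>e'\<in>edges G. q ` e' = e" if e: "e \<in> edges K" for e
  proof -
    obtain i j where ij: "e = {i, j}" "i \<in> ?I" "j \<in> ?I"
      using fsg_edge_cases[OF K e] by metis
    then obtain x y where "x \<in> B i" "y \<in> B j" "{x, y} \<in> edges G" using link e by blast
    with ij qB show ?thesis by (intro bexI[of _ "{x, y}"]) auto
  qed
  have "colourable G (k + (card (vertices G) - card ?I))"
    using colourable_lift[OF G(1) K onto _ lift K3 ne col] q(3) by blast
  then show ?thesis by (rule rx3_le[OF G(1)])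
qed

text \<open>More edges do not make colouring harder: this transfers lower bounds to all spanning subgraphs.\<close>

lemma colourable_embed:
  assumes G: "finite_simple_graph G" and K: "finite_simple_graph K"
    and f: "bij_betw f (vertices G) (vertices K)"
    and edge: "\<And>x y. x \<in> vertices G \<Longrightarrow> y \<in> vertices G \<Longrightarrow> {x, y} \<in> edges G \<Longrightarrow> {f x, f y} \<in> edges K"
    and G3: "3 \<le> card (vertices G)" and ne: "edges G \<noteq> {}" and col: "colourable G k"
  shows "colourable K k"
proof -
  define p where "p = inv_into (vertices G) f"
  have pf: "p (f x) = x" if "x \<in> vertices G" for x
    unfolding p_def using f that by (meson bij_betw_imp_inj_on inv_into_f_f)
  have img: "vertices K = f ` vertices G" using f by (simp add: bij_betw_def)
  have onto: "p ` vertices K = vertices G" using pf img by force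
  have fib: "conn_set (edges K) {x \<in> vertices K. p x = i}" if "i \<in> vertices G" for i
  proof -
    have "{x \<in> vertices K. p x = i} = {f i}" using pf img that by auto
    then show ?thesis by (simp add: conn_set.single)
  qed
  have lift: "\<exists>e'\<in>edges K. p ` e' = e" if e: "e \<in> edges G" for e
  proof -
    obtain x y where "e = {x, y}" "x \<in> vertices G" "y \<in> vertices G"
      using fsg_edge_cases[OF G e] by metis
    with edge e pf show ?thesis by (intro bexI[of _ "{f x, f y}"]) auto
  qed
  have "card (vertices K) - card (vertices G) = 0"
    using bij_betw_same_card[OF f] by simp
  with colourable_lift[OF K G onto fib lift G3 ne col] show ?thesis by simp
qed

section \<open>Walks and minor models by lists\<close>

abbreviation walk :: "'a set set \<Rightarrow> 'a list \<Rightarrow> bool" where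
  "walk E \<equiv> successively (\<lambda>x y. {x, y} \<in> E)"

lemma walk_rev [simp]: "walk E (rev xs) \<longleftrightarrow> walk E xs"
  by (simp add: insert_commute)

lemma walk_conn_set: "walk E xs \<Longrightarrow> xs \<noteq> [] \<Longrightarrow> conn_set E (set xs)"
proof (induction xs rule: induct_list012)
  case (3 x y ys)
  then have IH: "conn_set E (set (y # ys))" and edge: "{y, x} \<in> E"
    by (simp_all add: insert_commute)
  show ?case
  proof (cases "x \<in> set (y # ys)")
    case True
    with IH show ?thesis by (simp add: insert_absorb)
  next
    case False
    from conn_set.grow[OF IH _ False edge] show ?thesis by simp
  qed
qed (simp_all add: conn_set.single)

lemma linked_path:
  assumes "linked F x y"
  obtains p where "p \<noteq> []" "hd p = x" "last p = y" "distinct p" "walk F p"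
    "\<forall>v\<in>set p. linked F x v"
proof -
  have "\<exists>p. p \<noteq> [] \<and> hd p = x \<and> last p = y \<and> distinct p \<and> walk F p \<and> (\<forall>v\<in>set p. linked F x v)"
    using assms
  proof (induction rule: linked_induct)
    case base
    show ?case by (intro exI[of _ "[x]"]) simp
  next
    case (step y z)
    then obtain p where p: "p \<noteq> []" "hd p = x" "last p = y" "distinct p" "walk F p"
      "\<forall>v\<in>set p. linked F x v" by blast
    show ?case
    proof (cases "z \<in> set p")
      case True
      then obtain A B where AB: "p = A @ z # B" by (meson split_list)
      have "hd (A @ [z]) = x" using p(2) AB by (cases A) auto
      with AB p show ?thesis
        by (intro exI[of _ "A @ [z]"]) (auto simp: successively_append_iff successively_Cons)
    next
      case False
      have "linked F x z" using step.hyps by (rule linked_step)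
      with False p step.hyps(2) show ?thesis
        by (intro exI[of _ "p @ [z]"]) (auto simp: successively_append_iff)
    qed
  qed
  with that show ?thesis by blast
qed

type_synonym cedge = "nat \<times> nat \<times> nat"

abbreviation ends :: "cedge \<Rightarrow> nat set" where "ends t \<equiv> {fst t, fst (snd t)}"
abbreviation hue :: "cedge \<Rightarrow> nat" where "hue t \<equiv> snd (snd t)"

definition graph_of :: "nat \<Rightarrow> cedge list \<Rightarrow> nat ugraph" where
  "graph_of k ces = ({..<k}, ends ` set ces)"

text \<open>The vertices of a tree whose edges are listed so that each one is attached to the later ones.\<close>

fun tree_verts :: "cedge list \<Rightarrow> nat list" where
  "tree_verts [] = []"
| "tree_verts [t] = [fst t, fst (snd t)]"
| "tree_verts (t # t' # ts) = (let vs = tree_verts (t' # ts) in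
     if fst t \<in> set vs then fst (snd t) # vs
     else if fst (snd t) \<in> set vs then fst t # vs else vs)"

lemma tree_verts_joins: "joins (ends ` set ts) (set (tree_verts ts))"
proof (induction ts rule: tree_verts.induct)
  case 1
  show ?case by (simp add: joins_def)
next
  case (2 t)
  show ?case by (rule joins_from[of _ _ "fst t"]) (auto intro: linked_edge)
next
  case (3 t t' ts)
  let ?vs = "set (tree_verts (t' # ts))" and ?F = "ends ` set (t # t' # ts)"
  have J: "joins ?F ?vs" using 3 by (rule joins_mono) auto
  have attach: "joins ?F (insert y ?vs)" if "x \<in> ?vs" "{x, y} = ends t" for x y
  proof (rule joins_from[of _ _ x])
    fix z assume z: "z \<in> insert y ?vs"
    have "linked ?F x y" by (rule linked_edge) (use that(2) in auto)
    moreover have "linked ?F x z" if "z \<in> ?vs" using J \<open>x \<in> ?vs\<close> that unfolding joins_def by simp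
    ultimately show "linked ?F x z" using z by blast
  qed
  consider "fst t \<in> ?vs" | "fst t \<notin> ?vs" "fst (snd t) \<in> ?vs" | "fst t \<notin> ?vs" "fst (snd t) \<notin> ?vs"
    by blast
  then show ?case
  proof cases
    case 1
    from attach[OF this refl] 1 show ?thesis by (simp add: Let_def)
  next
    case 2
    from attach[OF 2(2), of "fst t"] 2 show ?thesis by (simp add: Let_def insert_commute)
  next
    case 3
    with J show ?thesis by (simp add: Let_def)
  qed
qed

text \<open>A certificate that the listed colouring with colours below \<open>m\<close> is a 3-rainbow colouring: the
  trees in \<open>ts\<close>, given by positions in \<open>ces\<close>, are rainbow and cover all triples of vertices.\<close>

definition rainbow_cover :: "nat \<Rightarrow> nat \<Rightarrow> cedge list \<Rightarrow> nat list list \<Rightarrow> bool" where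
  "rainbow_cover k m ces ts \<longleftrightarrow>
     3 \<le> k \<and> ces \<noteq> [] \<and> (\<forall>t\<in>set ces. fst t < fst (snd t) \<and> fst (snd t) < k \<and> hue t < m) \<and>
     distinct (map (\<lambda>t. (fst t, fst (snd t))) ces) \<and>
     (\<forall>t\<in>set ts. (\<forall>i\<in>set t. i < length ces) \<and> distinct (map (\<lambda>i. hue (ces ! i)) t)) \<and>
     (let Ws = map (\<lambda>t. tree_verts (map ((!) ces) t)) ts in
       \<forall>x<k. \<forall>y<x. \<forall>z<y. \<exists>W\<in>set Ws. x \<in> set W \<and> y \<in> set W \<and> z \<in> set W)"

lemma rainbow_cover_colourable:
  assumes "rainbow_cover k m ces ts"
  shows "colourable (graph_of k ces) m"
proof -
  define c where "c e = hue (SOME t. t \<in> set ces \<and> ends t = e)" for e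
  have less: "fst t < fst (snd t)" "hue t < m" if "t \<in> set ces" for t
    using assms that unfolding rainbow_cover_def by auto
  have "inj_on (\<lambda>t. (fst t, fst (snd t))) (set ces)"
    using assms unfolding rainbow_cover_def by (simp add: distinct_map)
  then have uniq: "t = t'" if "t \<in> set ces" "t' \<in> set ces" "ends t = ends t'" for t t'
    using that less(1)[OF that(1)] less(1)[OF that(2)]
    by (auto simp: doubleton_eq_iff dest!: inj_onD)
  have c: "c (ends t) = hue t" if "t \<in> set ces" for t
  proof -
    have "(SOME t'. t' \<in> set ces \<and> ends t' = ends t) = t"
      by (rule some_equality) (use that uniq in blast)+
    then show ?thesis unfolding c_def by simp
  qed
  have "c ` edges (graph_of k ces) \<subseteq> {..<m}"
    using c less(2) unfolding graph_of_def by auto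
  moreover have "\<exists>F\<subseteq>edges (graph_of k ces). inj_on c F \<and> joins F S"
    if S: "S \<subseteq> vertices (graph_of k ces)" "card S = 3" for S
  proof -
    obtain x y z where xyz: "S = {x, y, z}" "y < x" "z < y"
    proof -
      obtain u v w where uvw: "S = {u, v, w}" "u \<noteq> v" "u \<noteq> w" "v \<noteq> w"
        using S(2) by (auto simp: card_3_iff)
      consider "u < v \<and> v < w" | "u < w \<and> w < v" | "v < u \<and> u < w" | "v < w \<and> w < u"
        | "w < u \<and> u < v" | "w < v \<and> v < u"
        using uvw by linarith
      then show ?thesis
        by cases (use uvw that[of w v u] that[of v w u] that[of w u v] that[of u w v]
          that[of v u w] that[of u v w] in auto)
    qed
    then have "x < k" using S(1) unfolding graph_of_def by auto
    then have "\<exists>t\<in>set ts. S \<subseteq> set (tree_verts (map ((!) ces) t))"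
      using xyz assms by (simp add: rainbow_cover_def Let_def)
    then obtain t where t: "t \<in> set ts" "S \<subseteq> set (tree_verts (map ((!) ces) t))" by blast
    let ?t = "map ((!) ces) t"
    have sub: "set ?t \<subseteq> set ces" and "distinct (map hue ?t)"
      using assms t(1) unfolding rainbow_cover_def by (auto simp: o_def)
    then have inj: "inj_on hue (set ?t)" by (metis distinct_map)
    have "inj_on c (ends ` set ?t)"
    proof (rule inj_onI)
      fix e e' assume "e \<in> ends ` set ?t" "e' \<in> ends ` set ?t" and eq: "c e = c e'"
      then obtain s s' where s: "s \<in> set ?t" "e = ends s" "s' \<in> set ?t" "e' = ends s'"
        by (elim imageE)
      have "s \<in> set ces" "s' \<in> set ces" using s(1,3) sub by (simp_all only: subsetD)
      then have "hue s = hue s'" using eq c[of s] c[of s'] s(2,4) by simp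
      then have "s = s'" using inj s(1,3) by (meson inj_onD)
      with s show "e = e'" by simp
    qed
    moreover have "joins (ends ` set ?t) S"
      by (rule joins_mono[OF tree_verts_joins order_refl t(2)])
    moreover have "ends ` set ?t \<subseteq> edges (graph_of k ces)"
      unfolding graph_of_def using image_mono[OF sub] by simp
    ultimately show ?thesis by (intro exI[of _ "ends ` set ?t"] conjI)
  qed
  ultimately show ?thesis unfolding colourable_def by (intro exI[of _ c]) simp
qed

text \<open>In all applications the branch sets are vertex sets of walks, and are given as lists.\<close>

lemma rx3_model:
  assumes G: "finite_simple_graph G" "connected_graph G" and cover: "rainbow_cover k m ces ts"
    and bags: "length bags = k" "distinct (concat bags)" "set (concat bags) \<subseteq> vertices G"
      "\<forall>p\<in>set bags. p \<noteq> [] \<and> walk (edges G) p"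
    and link: "\<forall>(i, j, a)\<in>set ces. \<exists>x\<in>set (bags ! i). \<exists>y\<in>set (bags ! j). {x, y} \<in> edges G"
  shows "rx3 G + k \<le> m + card (vertices G)"
proof -
  let ?K = "graph_of k ces"
  have ces: "ces \<noteq> []" "3 \<le> k"
    "\<And>t. t \<in> set ces \<Longrightarrow> fst t < fst (snd t) \<and> fst (snd t) < k"
    using cover unfolding rainbow_cover_def by auto
  have K: "finite_simple_graph ?K"
    unfolding finite_simple_graph_def graph_of_def
    using ces(3) by (fastforce simp: card_2_iff)
  have "removeAll [] bags = bags" using bags(4) by (auto simp: removeAll_id)
  then have "distinct bags" and disj: "\<And>p q. p \<in> set bags \<Longrightarrow> q \<in> set bags \<Longrightarrow> p \<noteq> q \<Longrightarrow> set p \<inter> set q = {}"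
    using bags(2) unfolding distinct_concat_iff by auto
  have "rx3 G \<le> m + (card (vertices G) - card (vertices ?K))"
  proof (rule rx3_minor[OF G K _ _ rainbow_cover_colourable[OF cover], of "\<lambda>i. set (bags ! i)"])
    show "3 \<le> card (vertices ?K)" "edges ?K \<noteq> {}" using ces unfolding graph_of_def by auto
    fix i assume "i \<in> vertices ?K"
    then have i: "bags ! i \<in> set bags" using bags(1) unfolding graph_of_def by simp
    then show "conn_set (edges G) (set (bags ! i))" using bags(4) by (intro walk_conn_set) auto
    show "set (bags ! i) \<subseteq> vertices G" using bags(3) i by auto
  next
    fix i j assume "i \<in> vertices ?K" "j \<in> vertices ?K" "i \<noteq> j"
    then show "set (bags ! i) \<inter> set (bags ! j) = {}"
      using bags(1) \<open>distinct bags\<close> unfolding graph_of_def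
      by (intro disj) (auto simp: nth_eq_iff_index_eq)
  next
    fix i j assume "{i, j} \<in> edges ?K"
    then obtain t where t: "t \<in> set ces" "{i, j} = {fst t, fst (snd t)}" unfolding graph_of_def by auto
    from bspec[OF link t(1)]
    have "\<exists>x\<in>set (bags ! fst t). \<exists>y\<in>set (bags ! fst (snd t)). {x, y} \<in> edges G"
      by (simp add: case_prod_beta)
    with t(2) show "\<exists>x\<in>set (bags ! i). \<exists>y\<in>set (bags ! j). {x, y} \<in> edges G"
      by (metis doubleton_eq_iff insert_commute)
  qed
  moreover have "k \<le> card (vertices G)"
  proof -
    have "inj_on hd (set bags)"
      using disj bags(4) by (metis (no_types, lifting) disjoint_iff hd_in_set inj_onI)
    then have "card (hd ` set bags) = k"
      using bags(1) \<open>distinct bags\<close> by (simp add: card_image distinct_card)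
    moreover have "hd ` set bags \<subseteq> vertices G" using bags(3,4) by fastforce
    ultimately show ?thesis using card_mono[OF fsg_finite(1)[OF G(1)]] by metis
  qed
  ultimately show ?thesis unfolding graph_of_def by simp
qed

section \<open>Small graphs with large savings\<close>

text \<open>An entry \<open>(u, v, a)\<close> is an edge \<open>{u, v}\<close> of colour \<open>a\<close>. In \<open>theta\<close> graphs two vertices are joined by
  three paths of the given lengths; in \<open>cycles35\<close>, \<open>cycles44\<close> and \<open>triangle_pair\<close> two cycles share a
  vertex. The colourings save 3, that is, \<open>k\<close> vertices are served by \<open>k - 3\<close> colours, except for those of
  \<open>C4\<close> and \<open>triangle_pair\<close>, which save 2.\<close>

definition theta223 :: "cedge list" where
  "theta223 =
     [(0, 1, 2), (1, 2, 1), (0, 5, 1), (2, 5, 0), (2, 3, 2), (3, 4, 1), (0, 4, 0)]"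

lemma theta223_cover: "rainbow_cover 6 3 theta223
  [[6, 2, 0], [4, 3, 2], [4, 3, 1], [5, 6, 0], [6, 1, 0], [5, 4, 3]]"
  by code_simp

definition theta133 :: "cedge list" where
  "theta133 =
     [(0, 1, 0), (1, 2, 1), (2, 3, 0), (3, 4, 2), (4, 5, 1), (0, 5, 2), (0, 3, 1)]"

lemma theta133_cover: "rainbow_cover 6 3 theta133
  [[4, 3, 2], [3, 6, 0], [5, 1, 0], [6, 3, 2], [3, 2, 1], [6, 5, 0], [4, 5, 0]]"
  by code_simp

definition theta125 :: "cedge list" where
  "theta125 =
     [(0, 1, 0), (1, 2, 3), (2, 3, 1), (3, 4, 0), (4, 5, 2), (5, 6, 1), (0, 6, 3), (0, 2, 2)]"

lemma theta125_cover: "rainbow_cover 7 4 theta125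
  [[4, 5, 6, 0], [6, 7, 3, 2], [4, 3, 2, 1], [7, 5, 6, 0], [6, 5, 4, 3], [2, 7, 6, 0]]"
  by code_simp

definition cycles35 :: "cedge list" where
  "cycles35 =
     [(0, 1, 2), (1, 2, 1), (2, 3, 0), (3, 4, 2), (0, 4, 1), (0, 5, 3), (5, 6, 0), (0, 6, 3)]"

lemma cycles35_cover: "rainbow_cover 7 4 cycles35
  [[5, 2, 1, 0], [6, 5, 4, 0], [7, 4, 3, 2], [6, 7, 4, 3], [6, 5, 1, 0], [3, 2, 1], [5, 4, 3,
  2], [7, 2, 1, 0]]"
  by code_simp

definition cycles44 :: "cedge list" where
  "cycles44 =
     [(0, 1, 2), (1, 2, 1), (2, 3, 2), (0, 3, 1), (0, 4, 3), (4, 5, 0), (5, 6, 3), (0, 6, 0)]"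

lemma cycles44_cover: "rainbow_cover 7 4 cycles44
  [[6, 7, 3, 2], [5, 4, 1, 0], [7, 4, 3, 0], [6, 7, 3, 0], [7, 4, 1, 0], [5, 4, 3, 2], [2, 1],
  [6, 5]]"
  by code_simp

definition K24 :: "cedge list" where
  "K24 =
     [(0, 2, 0), (0, 3, 1), (0, 4, 2), (0, 5, 2), (1, 2, 2), (1, 3, 2), (1, 4, 0), (1, 5, 1)]"

lemma K24_cover: "rainbow_cover 6 3 K24
  [[2, 1, 0], [7, 6, 5], [7, 4, 0], [6, 2, 1], [7, 6, 4], [3, 1, 0], [4, 1, 0], [6, 7, 3]]"
  by code_simp

definition K23_triangle_at_pole :: "cedge list" where
  "K23_triangle_at_pole =
     [(0, 2, 3), (0, 3, 2), (0, 4, 1), (1, 2, 2), (1, 3, 0), (1, 4, 0), (0, 5, 1), (5, 6, 0),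
     (0, 6, 3)]"

lemma K23_triangle_at_pole_cover: "rainbow_cover 7 4 K23_triangle_at_pole
  [[6, 4, 3, 0], [5, 2, 1, 8], [3, 5, 2, 8], [7, 2, 1, 8], [6, 5, 3, 0], [7, 6, 1, 0], [4, 3,
  2, 0], [6, 4, 1, 8]]"
  by code_simp

definition K23_triangle_at_middle :: "cedge list" where
  "K23_triangle_at_middle =
     [(0, 2, 2), (0, 3, 1), (0, 4, 0), (1, 2, 1), (1, 3, 2), (1, 4, 3), (2, 5, 3), (5, 6, 1),
     (2, 6, 0)]"

lemma K23_triangle_at_middle_cover: "rainbow_cover 7 4 K23_triangle_at_middle
  [[6, 4, 3, 8], [5, 3, 8, 0], [6, 2, 1, 0], [4, 3, 5, 2], [8, 6, 1, 0], [6, 3, 2, 0], [5, 4,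
  3, 8], [7, 6, 2, 0]]"
  by code_simp

definition triangle_star :: "cedge list" where
  "triangle_star =
     [(0, 1, 3), (1, 2, 0), (0, 2, 2), (0, 3, 0), (3, 4, 1), (0, 4, 0), (0, 5, 2), (5, 6, 3),
     (0, 6, 1)]"

lemma triangle_star_cover: "rainbow_cover 7 4 triangle_star
  [[7, 1, 2, 8], [7, 6, 4, 3], [4, 5, 2, 0], [5, 2, 8, 0], [3, 2, 0, 8], [6, 4, 5, 0], [7, 5,
  2, 8], [7, 3, 2, 8]]"
  by code_simp

definition triangle_path :: "cedge list" where
  "triangle_path =
     [(0, 1, 3), (1, 2, 1), (0, 2, 2), (2, 3, 1), (3, 4, 2), (2, 4, 5), (4, 5, 1), (5, 6, 3),
     (4, 6, 0), (6, 7, 3), (7, 8, 2), (6, 8, 4)]"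

lemma triangle_path_cover: "rainbow_cover 9 6 triangle_path
  [[11, 8, 5, 3, 2, 0], [10, 11, 7, 8, 5, 1], [10, 11, 7, 8, 5, 3], [11, 9, 8, 6, 5, 2], [11,
  8, 6, 5, 2, 0], [10, 11, 8, 5, 1, 0], [11, 9, 8, 5, 3, 2], [11, 9, 8, 4, 5, 1], [11, 7, 8, 5,
  3, 2], [11, 7, 8, 4, 5, 1]]"
  by code_simp

definition square_two_triangles :: "cedge list" where
  "square_two_triangles =
     [(0, 1, 2), (1, 2, 0), (2, 3, 1), (0, 3, 2), (0, 4, 4), (4, 5, 1), (0, 5, 3), (2, 6, 4),
     (6, 7, 0), (2, 7, 3)]"

lemma square_two_triangles_cover: "rainbow_cover 8 5 square_two_triangles
  [[9, 5, 4, 1, 0], [7, 6, 3, 2, 1], [8, 9, 4, 3, 2], [6, 4, 3, 2, 1], [9, 7, 2, 1, 0], [8, 7,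
  6, 3, 2], [7, 5, 6, 1, 0]]"
  by code_simp

definition square_triangle_chain :: "cedge list" where
  "square_triangle_chain =
     [(0, 1, 1), (1, 2, 2), (2, 3, 1), (0, 3, 0), (0, 4, 3), (4, 5, 4), (0, 5, 2), (4, 6, 2),
     (6, 7, 0), (4, 7, 4)]"

lemma square_triangle_chain_cover: "rainbow_cover 8 5 square_triangle_chain
  [[7, 5, 4, 3, 2], [8, 9, 4, 1, 0], [9, 6, 4, 3, 0], [9, 4, 3, 1, 0], [9, 7, 4, 3, 0], [8, 7,
  5, 4, 0], [9, 6, 4, 3, 2], [5, 4, 3, 1, 0]]"
  by code_simp

definition C6_crossing_chords :: "cedge list" where
  "C6_crossing_chords =
     [(0, 1, 0), (1, 2, 0), (2, 3, 0), (3, 4, 1), (4, 5, 0), (0, 5, 1), (0, 2, 2), (1, 3, 2)]"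

lemma C6_crossing_chords_cover: "rainbow_cover 6 3 C6_crossing_chords
  [[6, 5, 4], [7, 5, 0], [3, 7, 1], [6, 3, 2], [6, 5, 0], [7, 4, 3], [3, 7, 0], [5, 6, 2]]"
  by code_simp

definition C6_parallel_chords :: "cedge list" where
  "C6_parallel_chords =
     [(0, 1, 2), (1, 2, 1), (2, 3, 2), (3, 4, 0), (4, 5, 1), (0, 5, 0), (0, 2, 1), (3, 5, 1)]"

lemma C6_parallel_chords_cover: "rainbow_cover 6 3 C6_parallel_chords
  [[7, 3, 2], [7, 5, 0], [6, 3, 2], [3, 2, 1], [6, 5, 0], [4, 5, 0]]"
  by code_simp

definition K4_triangle :: "cedge list" where
  "K4_triangle =
     [(0, 1, 1), (0, 2, 0), (1, 2, 2), (0, 3, 2), (1, 3, 0), (2, 3, 1), (0, 4, 2), (4, 5, 0),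
     (0, 5, 1)]"

lemma K4_triangle_cover: "rainbow_cover 6 3 K4_triangle
  [[3, 1, 0], [7, 3, 8], [2, 1, 8], [6, 1, 0], [4, 3, 8], [6, 5, 1], [6, 1, 8], [7, 6, 0], [3,
  1, 8], [6, 4, 0]]"
  by code_simp

definition K5 :: "cedge list" where
  "K5 =
     [(0, 1, 1), (0, 2, 0), (1, 2, 0), (0, 3, 1), (1, 3, 0), (2, 3, 1), (0, 4, 0), (1, 4, 1),
     (2, 4, 1), (3, 4, 0)]"

lemma K5_cover: "rainbow_cover 5 2 K5
  [[3, 1], [7, 9], [6, 3], [6, 0], [5, 9], [7, 2], [6, 8], [2, 0], [4, 0], [5, 4]]"
  by code_simp

definition C4 :: "cedge list" where
  "C4 =
     [(0, 1, 0), (1, 2, 1), (2, 3, 0), (0, 3, 1)]"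

lemma C4_cover: "rainbow_cover 4 2 C4
  [[3, 0], [3, 2], [1, 0], [2, 1]]"
  by code_simp

definition triangle_pair :: "cedge list" where
  "triangle_pair =
     [(0, 1, 1), (1, 2, 0), (0, 2, 2), (0, 3, 2), (3, 4, 0), (0, 4, 1)]"

lemma triangle_pair_cover: "rainbow_cover 5 3 triangle_pair
  [[3, 1, 0], [5, 2, 1], [4, 5, 2], [4, 3, 0]]"
  by code_simp

section \<open>Cycles and ears\<close>

locale bridgeless =
  fixes V :: "'a set" and E :: "'a set set"
  assumes fsg: "finite_simple_graph (V, E)" and two_edge_conn: "edge_conn 2 (V, E)"
begin

definition touch :: "'a list \<Rightarrow> 'a list \<Rightarrow> bool" where
  "touch p q \<longleftrightarrow> (\<exists>x\<in>set p. \<exists>y\<in>set q. {x, y} \<in> E)"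

lemma touchI: "x \<in> set p \<Longrightarrow> y \<in> set q \<Longrightarrow> {x, y} \<in> E \<Longrightarrow> touch p q"
  unfolding touch_def by blast

lemma touch_hd_hd: "p \<noteq> [] \<Longrightarrow> q \<noteq> [] \<Longrightarrow> {hd p, hd q} \<in> E \<Longrightarrow> touch p q"
  and touch_hd_last: "p \<noteq> [] \<Longrightarrow> q \<noteq> [] \<Longrightarrow> {hd p, last q} \<in> E \<Longrightarrow> touch p q"
  and touch_last_hd: "p \<noteq> [] \<Longrightarrow> q \<noteq> [] \<Longrightarrow> {last p, hd q} \<in> E \<Longrightarrow> touch p q"
  and touch_last_last: "p \<noteq> [] \<Longrightarrow> q \<noteq> [] \<Longrightarrow> {last p, last q} \<in> E \<Longrightarrow> touch p q"
  using touchI hd_in_set last_in_set by metis+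

lemmas touch_ends = touch_hd_hd touch_hd_last touch_last_hd touch_last_last

lemma finite_V: "finite V" and finite_E: "finite E"
  using fsg_finite[OF fsg] by auto

lemma edge_in_V: "{x, y} \<in> E \<Longrightarrow> x \<in> V" "{x, y} \<in> E \<Longrightarrow> y \<in> V"
  using fsg_edgeD[OF fsg] by auto

lemma edge_neq: "{x, y} \<in> E \<Longrightarrow> x \<noteq> y"
  using fsg_edgeD[OF fsg] by auto

lemma no_loop [simp]: "{x} \<notin> E"
  using edge_neq[of x x] by auto

lemma edge_cut:
  assumes X: "X \<subseteq> V" "X \<noteq> {}" "X \<noteq> V"
  obtains a b where "{a, b} \<in> E" "{a, b} \<noteq> e" "a \<in> X" "b \<notin> X"
proof -
  have "connected_graph (remove_edges (V, E) ({e} \<inter> E))"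
  proof -
    have "card ({e} \<inter> E) < 2" by (cases "e \<in> E") auto
    then show ?thesis using two_edge_conn unfolding edge_conn_def by auto
  qed
  then have "joins (E - {e} \<inter> E) V" unfolding connected_graph_iff remove_edges_def by simp
  moreover obtain x y where "x \<in> V \<inter> X" "y \<in> V - X" using X by blast
  ultimately obtain a b where "{a, b} \<in> E - {e} \<inter> E" "a \<in> X" "b \<notin> X"
    by (rule joins_crosses)
  with that show ?thesis by auto
qed

lemma connected: "connected_graph (V, E)"
proof -
  have "connected_graph (remove_edges (V, E) {})"
    using two_edge_conn unfolding edge_conn_def by auto
  then show ?thesis unfolding remove_edges_def by simp
qed

lemma model:
  assumes "rainbow_cover k m ces ts" "length bags = k" "distinct (concat bags)"
    "set (concat bags) \<subseteq> V" "\<forall>p\<in>set bags. p \<noteq> [] \<and> walk E p"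
    "\<forall>(i, j, a)\<in>set ces. touch (bags ! i) (bags ! j)"
  shows "rx3 (V, E) + k \<le> m + card V"
  using rx3_model[OF fsg connected assms(1,2,3)] assms(4-6) unfolding touch_def by simp

lemma walk_in_V: "walk E xs \<Longrightarrow> 2 \<le> length xs \<Longrightarrow> set xs \<subseteq> V"
proof (induction xs rule: induct_list012)
  case (3 x y ys)
  then show ?case using edge_in_V[of x y] by (cases ys) auto
qed auto

definition cycle :: "'a list \<Rightarrow> bool" where
  "cycle xs \<longleftrightarrow> 3 \<le> length xs \<and> distinct xs \<and> walk E xs \<and> {last xs, hd xs} \<in> E"

lemma cycle_in_V: "cycle xs \<Longrightarrow> set xs \<subseteq> V"
  unfolding cycle_def using walk_in_V by simp

lemma cycle_append_swap: "cycle (A @ B) \<Longrightarrow> cycle (B @ A)"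
  unfolding cycle_def
  by (cases "A = []"; cases "B = []") (auto simp: successively_append_iff)

lemma cycle_rev: "cycle xs \<Longrightarrow> cycle (rev xs)"
  unfolding cycle_def by (auto simp: hd_rev last_rev insert_commute)

lemma cycle_rotate:
  assumes "cycle xs" "x \<in> set xs"
  obtains ys where "cycle (x # ys)" "set (x # ys) = set xs" "length (x # ys) = length xs"
proof -
  obtain A B where "xs = A @ x # B" using assms(2) by (meson split_list)
  with assms(1) cycle_append_swap[of A "x # B"] that[of "B @ A"] show ?thesis by auto
qed

text \<open>The list \<open>ys\<close> holds the inner vertices of the ear. A closed ear has at least two of them, since
  otherwise it would use the same edge twice.\<close>

definition ear :: "'a set \<Rightarrow> 'a \<Rightarrow> 'a list \<Rightarrow> 'a \<Rightarrow> bool" where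
  "ear W x ys z \<longleftrightarrow> x \<in> W \<and> z \<in> W \<and> ys \<noteq> [] \<and> distinct ys \<and> set ys \<subseteq> V \<and> set ys \<inter> W = {} \<and>
     walk E ys \<and> {x, hd ys} \<in> E \<and> {last ys, z} \<in> E \<and> (x = z \<longrightarrow> 2 \<le> length ys)"

lemma ear_rev: "ear W x ys z \<Longrightarrow> ear W z (rev ys) x"
  unfolding ear_def by (auto simp: hd_rev last_rev insert_commute)

text \<open>Leave \<open>W\<close> along an edge, and consider what can be reached without touching \<open>W\<close> again. Since a
  single edge is no cut, a second edge leads from there back to \<open>W\<close>.\<close>

lemma ear_exists:
  assumes W: "W \<subseteq> V" "W \<noteq> {}" "W \<noteq> V"
  obtains x ys z where "ear W x ys z"
proof -
  obtain x y where xy: "{x, y} \<in> E" "x \<in> W" "y \<notin> W"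
    using edge_cut[OF W, of "{}"] by metis
  let ?F = "{e \<in> E. e \<inter> W = {}}"
  define R where "R = {v. linked ?F y v}"
  have RW: "v \<in> V - W" if "v \<in> R" for v
    using that unfolding R_def mem_Collect_eq
  proof (induction rule: linked_induct)
    case base
    show ?case using xy edge_in_V by simp
  next
    case (step u v)
    then show ?case using edge_in_V(2)[of u v] by auto
  qed
  have "y \<in> R" unfolding R_def by simp
  moreover have "R \<subseteq> V" "R \<noteq> V" using RW W by auto
  ultimately obtain r z where rz: "{r, z} \<in> E" "{r, z} \<noteq> {x, y}" "r \<in> R" "z \<notin> R"
    using edge_cut[of R "{x, y}"] by (metis empty_iff)
  have yr: "linked ?F y r" using rz(3) unfolding R_def by simp
  have zW: "z \<in> W"
  proof (rule ccontr)
    assume "z \<notin> W"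
    then have "{r, z} \<in> ?F" using rz(1) RW[OF rz(3)] by simp
    with yr have "linked ?F y z" by (rule linked_step)
    with rz(4) show False unfolding R_def by simp
  qed
  obtain p where p: "p \<noteq> []" "hd p = y" "last p = r" "distinct p" "walk ?F p"
    "\<forall>v\<in>set p. linked ?F y v"
    by (rule linked_path[OF yr])
  have "walk E p" using p(5) by (rule successively_mono) simp
  moreover have "2 \<le> length p" if "x = z"
  proof -
    have "r \<noteq> y" using rz(2) that by (auto simp: insert_commute)
    with p(1-3) show ?thesis by (cases p rule: remdups_adj.cases) auto
  qed
  moreover have "set p \<subseteq> V" "set p \<inter> W = {}" using RW p(6) unfolding R_def by auto
  ultimately have "ear W x p z"
    unfolding ear_def using xy(1,2) zW rz(1) p(1-4) by simp
  with that show ?thesis .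
qed

definition path_in :: "'a set \<Rightarrow> 'a \<Rightarrow> 'a list \<Rightarrow> 'a \<Rightarrow> bool" where
  "path_in W x p z \<longleftrightarrow> p \<noteq> [] \<and> hd p = x \<and> last p = z \<and> distinct p \<and> walk E p \<and> set p \<subseteq> W"

lemma ear_closes_path:
  assumes "ear W x ys z" "path_in W x p z" "x \<noteq> z"
  shows "cycle (p @ rev ys)"
proof -
  have "2 \<le> length p"
    using assms(2,3) unfolding path_in_def by (cases p rule: remdups_adj.cases) auto
  moreover have "1 \<le> length ys" using assms(1) unfolding ear_def by (cases ys) auto
  ultimately show ?thesis
    using assms unfolding ear_def path_in_def cycle_def
    by (auto simp: successively_append_iff hd_rev last_rev insert_commute)
qed

lemma edge_closes_path:
  assumes "{x, z} \<in> E" "path_in W x p z" "3 \<le> length p"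
  shows "cycle p"
  using assms unfolding path_in_def cycle_def by (auto simp: insert_commute)

lemma closed_ear_cycle: "ear W x ys x \<Longrightarrow> cycle (x # ys)"
  unfolding ear_def cycle_def by (auto simp: successively_Cons)

definition circumference_le :: "nat \<Rightarrow> bool" where
  "circumference_le l \<longleftrightarrow> (\<forall>xs. cycle xs \<longrightarrow> length xs \<le> l)"

lemma cycle_exists: "\<exists>xs. cycle xs"
proof -
  obtain v where v: "v \<in> V" using connected unfolding connected_graph_iff by auto
  have "1 < card V" using two_edge_conn unfolding edge_conn_def by simp
  then have "{v} \<noteq> V" by auto
  obtain x ys z where "ear {v} x ys z"
    by (rule ear_exists[of "{v}"]) (use v \<open>{v} \<noteq> V\<close> in simp_all)
  moreover from this have "x = v" "z = v" unfolding ear_def by auto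
  ultimately show ?thesis using closed_ear_cycle by blast
qed

lemma longest_cycle:
  obtains xs where "cycle xs" "circumference_le (length xs)"
proof -
  have bound: "length xs < Suc (card V)" if "cycle xs" for xs
    using that cycle_in_V[OF that] card_mono[OF finite_V] distinct_card
    unfolding cycle_def by (metis le_imp_less_Suc)
  obtain xs where "cycle xs" "\<forall>ys. cycle ys \<longrightarrow> length ys \<le> length xs"
    using ex_has_greatest_nat[of cycle _ length "Suc (card V)"] cycle_exists bound
    by (metis less_imp_le_nat)
  with that show ?thesis unfolding circumference_le_def by blast
qed

end

section \<open>Labelled subgraphs\<close>

fun simple_paths :: "(nat \<times> nat) list \<Rightarrow> nat \<Rightarrow> nat \<Rightarrow> nat list list" where
  "simple_paths es k 0 = []"
| "simple_paths es k (Suc 0) = map (\<lambda>i. [i]) [0..<k]"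
| "simple_paths es k (Suc (Suc m)) =
     [x # p. p \<leftarrow> simple_paths es k (Suc m), x \<leftarrow> [0..<k],
       x \<notin> set p \<and> ((x, hd p) \<in> set es \<or> (hd p, x) \<in> set es)]"

text \<open>All pairs of distinct vertices, except those in \<open>exc\<close>, are joined by a path with at least \<open>m\<close>
  vertices.\<close>

definition path_table :: "(nat \<times> nat) list \<Rightarrow> nat \<Rightarrow> nat \<Rightarrow> (nat \<times> nat) list \<Rightarrow> bool" where
  "path_table es k m exc \<longleftrightarrow>
     (let ps = map (\<lambda>p. (hd p, last p)) (concat (map (simple_paths es k) [m..<Suc k])) in
      \<forall>i<k. \<forall>j<k. i = j \<or> (i, j) \<in> set exc \<or> (j, i) \<in> set exc \<or> (i, j) \<in> set ps)"

context bridgeless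
begin

text \<open>The vertex \<open>vs ! i\<close> plays the role of the number \<open>i\<close>; further edges between these vertices are
  allowed.\<close>

definition copy :: "(nat \<times> nat) list \<Rightarrow> 'a list \<Rightarrow> bool" where
  "copy es vs \<longleftrightarrow> distinct vs \<and> set vs \<subseteq> V \<and>
     (\<forall>(i, j)\<in>set es. i < length vs \<and> j < length vs \<and> {vs ! i, vs ! j} \<in> E)"

lemma copy_edge: "copy es vs \<Longrightarrow> (i, j) \<in> set es \<Longrightarrow> {vs ! i, vs ! j} \<in> E"
  unfolding copy_def by auto

lemma simple_paths_copy:
  assumes es: "copy es vs"
  shows "p \<in> set (simple_paths es (length vs) m) \<Longrightarrow> length p = m \<and> set p \<subseteq> {..<length vs} \<and>
    path_in (set vs) (vs ! hd p) (map ((!) vs) p) (vs ! last p)"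
proof (induction m arbitrary: p)
  case (Suc m)
  show ?case
  proof (cases m)
    case 0
    with Suc.prems show ?thesis by (auto simp: path_in_def)
  next
    case (Suc m')
    with Suc.prems obtain q x where q: "q \<in> set (simple_paths es (length vs) m)" "p = x # q"
      "x < length vs" "x \<notin> set q" "(x, hd q) \<in> set es \<or> (hd q, x) \<in> set es"
      by auto
    from Suc.IH[OF q(1)] have IH: "length q = m" "set q \<subseteq> {..<length vs}"
      "path_in (set vs) (vs ! hd q) (map ((!) vs) q) (vs ! last q)" by auto
    have "q \<noteq> []" using IH(1) Suc by auto
    have "{vs ! x, vs ! hd q} \<in> E"
      using q(5) copy_edge[OF es, of x "hd q"] copy_edge[OF es, of "hd q" x]
      by (auto simp: insert_commute)
    moreover have "vs ! x \<notin> set (map ((!) vs) q)"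
      using es q(3,4) IH(2) unfolding copy_def by (auto simp: nth_eq_iff_index_eq subset_iff)
    ultimately show ?thesis
      using q(2,3) IH \<open>q \<noteq> []\<close> unfolding path_in_def
      by (auto simp: successively_Cons hd_map)
  qed
qed simp

lemma path_table_copy:
  assumes "copy es vs" "path_table es (length vs) m exc"
    and "i < length vs" "j < length vs" "i \<noteq> j" "(i, j) \<notin> set exc" "(j, i) \<notin> set exc"
  obtains p where "path_in (set vs) (vs ! i) p (vs ! j)" "m \<le> length p"
proof -
  have "(i, j) \<in> (\<lambda>p. (hd p, last p)) ` set (concat (map (simple_paths es (length vs)) [m..<Suc (length vs)]))"
    using assms(2-7) unfolding path_table_def Let_def by auto
  then obtain p r where "p \<in> set (simple_paths es (length vs) r)" "m \<le> r" "i = hd p" "j = last p"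
    by auto
  with simple_paths_copy[OF assms(1), of p r] that[of "map ((!) vs) p"] show ?thesis by auto
qed

text \<open>In a copy of a graph in which all other pairs are joined by long paths, an open ear can only
  be attached at an exceptional pair, and the same goes for an additional edge.\<close>

lemma open_ear_exceptional:
  assumes es: "copy es vs" "path_table es k m exc" "length vs = k"
    and l: "circumference_le l" "l \<le> m"
    and "ear (set vs) (vs ! i) ys (vs ! j)" "i < k" "j < k" "i \<noteq> j"
  shows "(i, j) \<in> set exc \<or> (j, i) \<in> set exc"
proof (rule ccontr)
  assume "\<not> ?thesis"
  then obtain p where p: "path_in (set vs) (vs ! i) p (vs ! j)" "m \<le> length p"
    using path_table_copy[OF es(1), of m exc i j] es(2,3) assms(7-9) by auto
  have "vs ! i \<noteq> vs ! j"
    using es(1,3) assms(7-9) unfolding copy_def by (simp add: nth_eq_iff_index_eq)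
  with ear_closes_path[OF assms(6) p(1)] have "cycle (p @ rev ys)" by simp
  then have "length p + length ys \<le> l" using l(1) unfolding circumference_le_def by force
  moreover have "0 < length ys" using assms(6) unfolding ear_def by simp
  ultimately show False using p(2) l(2) by linarith
qed

lemma extra_edge_exceptional:
  assumes es: "copy es vs" "path_table es k m exc" "length vs = k"
    and l: "circumference_le l" "l < m" "3 \<le> m"
    and "{vs ! i, vs ! j} \<in> E" "i < k" "j < k" "i \<noteq> j"
  shows "(i, j) \<in> set exc \<or> (j, i) \<in> set exc"
proof (rule ccontr)
  assume "\<not> ?thesis"
  then obtain p where p: "path_in (set vs) (vs ! i) p (vs ! j)" "m \<le> length p"
    using path_table_copy[OF es(1), of m exc i j] es(2,3) assms(8-10) by auto
  then have "cycle p" using edge_closes_path[OF assms(7)] l(3) by simp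
  then show False using l p(2) unfolding circumference_le_def by fastforce
qed

section \<open>Long cycles\<close>

text \<open>Graphs with this property are not extremal. By \<open>rx3_minor\<close> it suffices to find a minor that saves 3.\<close>

abbreviation good :: bool where "good \<equiv> rx3 (V, E) + 3 \<le> card V"

lemma good_model:
  assumes "rainbow_cover k m ces ts" "k = m + 3" "length bags = k" "distinct (concat bags)"
    "set (concat bags) \<subseteq> V" "\<forall>p\<in>set bags. p \<noteq> [] \<and> walk E p"
    "\<forall>(i, j, a)\<in>set ces. touch (bags ! i) (bags ! j)"
  shows good
  using model[OF assms(1,3-7)] assms(2) by simp

lemma cycle_bags:
  assumes "cycle (x # A @ z # D)"
  shows "distinct (x # A @ z # D)" "set (x # A @ z # D) \<subseteq> V" "walk E A" "walk E D"
    "A \<noteq> [] \<Longrightarrow> {x, hd A} \<in> E" "A \<noteq> [] \<Longrightarrow> {last A, z} \<in> E" "A = [] \<Longrightarrow> {x, z} \<in> E"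
    "D \<noteq> [] \<Longrightarrow> {z, hd D} \<in> E" "D \<noteq> [] \<Longrightarrow> {last D, x} \<in> E" "D = [] \<Longrightarrow> {z, x} \<in> E"
  using assms cycle_in_V[OF assms] unfolding cycle_def
  by (auto simp: successively_append_iff successively_Cons split: if_splits)

lemma good_theta223:
  assumes cyc: "cycle (x # A @ z # d # D)" and ne: "A \<noteq> []" "D \<noteq> []"
    and e: "ear (set (x # A @ z # d # D)) x ys z"
  shows good
proof -
  note c = cycle_bags[OF cyc]
  have d: "walk E D" "{d, hd D} \<in> E" "{z, d} \<in> E" "{last D, x} \<in> E"
    using c(4,8,9) ne(2) by (auto simp: successively_Cons)
  have ys: "ys \<noteq> []" "distinct ys" "set ys \<subseteq> V" "walk E ys" "{x, hd ys} \<in> E" "{last ys, z} \<in> E"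
    "set ys \<inter> set (x # A @ z # d # D) = {}"
    using e unfolding ear_def by auto
  show ?thesis
    by (rule good_model[OF theta223_cover, of "[[x], A, [z], [d], D, ys]"])
      (use c(1-3,5,6) d ys ne in \<open>auto simp: theta223_def insert_commute intro: touch_ends\<close>)
qed

lemma good_cycles35:
  assumes cyc: "cycle (x # a # b # c # D)" and ne: "D \<noteq> []"
    and e: "ear (set (x # a # b # c # D)) x ys x"
  shows good
proof -
  have c: "distinct (x # a # b # c # D)" "walk E D" "{x, a} \<in> E" "{a, b} \<in> E" "{b, c} \<in> E"
    "{c, hd D} \<in> E" "{last D, x} \<in> E"
    using cyc ne unfolding cycle_def by (auto simp: successively_Cons)
  obtain y Y where ys: "ys = y # Y" "Y \<noteq> []" using e unfolding ear_def by (cases ys rule: remdups_adj.cases) auto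
  with e have y: "distinct (y # Y)" "set (y # Y) \<subseteq> V" "walk E Y" "{x, y} \<in> E" "{y, hd Y} \<in> E"
    "{last Y, x} \<in> E" "set (y # Y) \<inter> set (x # a # b # c # D) = {}"
    unfolding ear_def by (auto simp: successively_Cons)
  show ?thesis
    by (rule good_model[OF cycles35_cover, of "[[x], [a], [b], [c], D, [y], Y]"])
      (use c y ys(2) ne cycle_in_V[OF cyc] in \<open>auto simp: cycles35_def insert_commute intro: touch_ends\<close>)
qed


lemma circumference_leD: "circumference_le l \<Longrightarrow> cycle xs \<Longrightarrow> length xs \<le> l"
  unfolding circumference_le_def by blast

text \<open>An ear on a longest cycle is no longer than either of the two arcs between its ends. Together
  with the cycle it contains a subdivision of a theta graph with 6 vertices or of a triangle and a
  5-cycle with a common vertex.\<close>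

lemma longest_cycle_ear:
  assumes xs: "cycle xs" "circumference_le (length xs)" "5 \<le> length xs" "set xs \<noteq> V"
  shows good
proof -
  have "set xs \<noteq> {}" using xs(3) by auto
  then obtain x ys z where "ear (set xs) x ys z"
    using ear_exists[OF cycle_in_V[OF xs(1)] _ xs(4)] by blast
  moreover from this have "x \<in> set xs" unfolding ear_def by blast
  ultimately obtain C where C: "cycle (x # C)" "length (x # C) = length xs"
    and e: "ear (set (x # C)) x ys z"
    using cycle_rotate[OF xs(1)] by metis
  show ?thesis
  proof (cases "x = z")
    case True
    have "length C = Suc (Suc (Suc (Suc (length C - 4))))" using C(2) xs(3) by simp
    then obtain a b c D where "C = a # b # c # D" "D \<noteq> []"
      unfolding length_Suc_conv by auto
    with C(1) e True show ?thesis using good_cycles35 by metis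
  next
    case False
    then have "z \<in> set C" using e unfolding ear_def by auto
    then obtain A D where AD: "C = A @ z # D" by (meson split_list)
    note cyc = C(1)[unfolded AD] and e = e[unfolded AD]
    note c = cycle_bags[OF cyc]
    have "path_in (set (x # A @ z # D)) x (x # A @ [z]) z"
      using c(1,3,5,6,7) unfolding path_in_def
      by (cases "A = []") (auto simp: successively_Cons successively_append_iff)
    from ear_closes_path[OF e this False] have "length A + 2 + length ys \<le> length xs"
      using circumference_leD[OF xs(2)] by force
    moreover have "path_in (set (x # A @ z # D)) x (x # rev D @ [z]) z"
      using c(1,4,8,9,10) unfolding path_in_def
      by (cases "D = []") (auto simp: successively_Cons successively_append_iff hd_rev last_rev insert_commute)
    from ear_closes_path[OF e this False] have "length D + 2 + length ys \<le> length xs"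
      using circumference_leD[OF xs(2)] by force
    moreover have "length xs = length A + length D + 2" using C(2) AD by simp
    moreover have "0 < length ys" using e unfolding ear_def by simp
    ultimately have len: "0 < length A" "0 < length D" "3 \<le> length A + length D"
      using xs(3) by linarith+
    show ?thesis
    proof (cases "2 \<le> length D")
      case True
      then obtain d D' where "D = d # D'" "D' \<noteq> []" by (cases D rule: remdups_adj.cases) auto
      with good_theta223[of x A z d D' ys] cyc e len(1) show ?thesis by simp
    next
      case False
      then have "2 \<le> length (rev A)" using len by simp
      then obtain a A' where A: "rev A = a # A'" "A' \<noteq> []" by (cases "rev A" rule: remdups_adj.cases) auto
      have "cycle (x # rev D @ z # rev A)"
        using cycle_append_swap[of "[x]" "A @ z # D"] cyc cycle_rev by fastforce
      moreover have "set (x # A @ z # D) = set (x # rev D @ z # a # A')"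
        using A(1) by (metis (no_types, opaque_lifting) Un_commute Un_insert_right list.simps(15) set_append set_rev)
      ultimately show ?thesis
        using good_theta223[of x "rev D" z a A' ys] e A len(2) by simp
    qed
  qed
qed

lemma good_long_chord:
  assumes cyc: "cycle (x # A @ z # D)" and chord: "{x, z} \<in> E" and len: "2 \<le> length A" "2 \<le> length D"
  shows good
proof -
  obtain a A' where A: "A = a # A'" "A' \<noteq> []" using len by (cases A rule: remdups_adj.cases) auto
  obtain d D' where D: "D = d # D'" "D' \<noteq> []" using len by (cases D rule: remdups_adj.cases) auto
  note c = cycle_bags[OF cyc]
  have e: "walk E A'" "walk E D'" "{x, a} \<in> E" "{a, hd A'} \<in> E" "{last A', z} \<in> E" "{z, d} \<in> E"
    "{d, hd D'} \<in> E" "{last D', x} \<in> E"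
    using c(3-6,8,9) A D by (auto simp: successively_Cons)
  show ?thesis
    by (rule good_model[OF theta133_cover, of "[[x], [a], A', [z], [d], D']"])
      (use c(1,2) e chord A D in \<open>auto simp: theta133_def insert_commute intro: touch_ends\<close>)
qed

lemma good_short_chord:
  assumes cyc: "cycle (x # a # z # D)" and chord: "{x, z} \<in> E" and len: "4 \<le> length D"
  shows good
proof -
  have "length D = Suc (Suc (Suc (Suc (length D - 4))))" using len by simp
  then obtain d1 d2 d3 D' where D: "D = d1 # d2 # d3 # D'" "D' \<noteq> []"
    unfolding length_Suc_conv by auto
  have e: "distinct (x # a # z # D)" "walk E D'" "{x, a} \<in> E" "{a, z} \<in> E" "{z, d1} \<in> E" "{d1, d2} \<in> E"
    "{d2, d3} \<in> E" "{d3, hd D'} \<in> E" "{last D', x} \<in> E"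
    using cyc D unfolding cycle_def by (auto simp: successively_Cons)
  show ?thesis
    by (rule good_model[OF theta125_cover, of "[[x], [a], [z], [d1], [d2], [d3], D']"])
      (use e cycle_in_V[OF cyc] chord D in \<open>auto simp: theta125_def insert_commute intro: touch_ends\<close>)
qed

text \<open>A cycle with a chord is a theta graph. From order 7 on it contracts to one whose other two paths
  have lengths 3 and 3 or lengths 2 and 5.\<close>

lemma good_chord:
  assumes cyc: "cycle (x # A @ z # D)" and chord: "{x, z} \<in> E"
    and ne: "A \<noteq> []" "D \<noteq> []" and len: "5 \<le> length A + length D"
  shows good
proof -
  consider "2 \<le> length A" "2 \<le> length D" | "length A = 1" "4 \<le> length D" | "length D = 1" "4 \<le> length A"
    using ne[folded length_greater_0_conv] len by linarith
  then show ?thesis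
  proof cases
    case 1
    with good_long_chord[OF cyc chord] show ?thesis .
  next
    case 2
    then obtain a where "A = [a]" by (auto simp: length_Suc_conv)
    with good_short_chord[of x a z D] cyc chord 2 show ?thesis by simp
  next
    case 3
    then obtain d where "D = [d]" by (auto simp: length_Suc_conv)
    moreover have "cycle (z # D @ x # A)" using cycle_append_swap[of "x # A" "z # D"] cyc by simp
    ultimately show ?thesis
      using good_short_chord[of z d x A] chord 3 by (simp add: insert_commute)
  qed
qed

end

section \<open>Circumference three and four\<close>

text \<open>Edge lists on vertices numbered from 0. The tables certify which pairs of vertices can carry an
  open ear, or an additional edge, without creating a cycle that is too long.\<close>

definition es_K23 :: "(nat \<times> nat) list" where
  "es_K23 = [(0, 2), (0, 3), (0, 4), (1, 2), (1, 3), (1, 4)]"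

definition es_F1 :: "(nat \<times> nat) list" where
  "es_F1 = [(0, 1), (1, 2), (0, 2), (2, 3), (3, 4), (2, 4)]"

definition es_F2 :: "(nat \<times> nat) list" where
  "es_F2 = [(0, 1), (1, 2), (2, 3), (0, 3), (3, 4), (4, 5), (3, 5)]"

definition es_F5 :: "(nat \<times> nat) list" where
  "es_F5 = [(0, 1), (1, 2), (0, 2), (2, 3), (3, 4), (2, 4), (4, 5), (5, 6), (4, 6)]"

lemma ear_table_K23: "path_table es_K23 5 4 [(0, 1)]"
  by code_simp

lemma ear_table_F1: "path_table es_F1 5 3 []"
  by code_simp

lemma edge_table_F1: "path_table es_F1 5 4 es_F1"
  by code_simp

lemma ear_table_F2: "path_table es_F2 6 4 [(0, 2), (1, 3), (3, 4), (3, 5), (4, 5)]"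
  by code_simp

lemma edge_table_F2: "path_table es_F2 6 5 (es_F2 @ [(0, 2), (1, 3)])"
  by code_simp

lemma ear_table_F5: "path_table es_F5 7 3 []"
  by code_simp

lemma edge_table_F5: "path_table es_F5 7 4 es_F5"
  by code_simp

context bridgeless
begin

lemma closed_earE:
  assumes "ear W x ys x"
  obtains y Y where "ys = y # Y" "Y \<noteq> []" "distinct (y # Y)" "set (y # Y) \<subseteq> V"
    "set (y # Y) \<inter> W = {}" "walk E Y" "{x, y} \<in> E" "{y, hd Y} \<in> E" "{last Y, x} \<in> E" "x \<in> W"
proof -
  obtain y Y where ys: "ys = y # Y" "Y \<noteq> []"
    using assms unfolding ear_def by (cases ys rule: remdups_adj.cases) auto
  show ?thesis
    by (rule that[OF ys]) (use assms ys in \<open>auto simp: ear_def successively_Cons\<close>)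
qed

lemma ear_facts:
  assumes "ear W x ys z"
  shows "ys \<noteq> []" "distinct ys" "set ys \<subseteq> V" "set ys \<inter> W = {}" "walk E ys" "{x, hd ys} \<in> E"
    "{last ys, z} \<in> E"
  using assms unfolding ear_def by auto

lemma proper_subset: "length vs < card V \<Longrightarrow> set vs \<noteq> V"
  using card_length[of vs] by auto

lemma copy_ear:
  assumes "copy es vs" "length vs < card V" "vs \<noteq> []"
  obtains i ys j where "ear (set vs) (vs ! i) ys (vs ! j)" "i < length vs" "j < length vs"
proof -
  obtain x ys z where e: "ear (set vs) x ys z"
    by (rule ear_exists[of "set vs"]) (use assms proper_subset in \<open>auto simp: copy_def\<close>)
  then have "x \<in> set vs" "z \<in> set vs" unfolding ear_def by auto
  with e that show ?thesis by (metis in_set_conv_nth)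
qed

lemma copy_K23_iff: "copy es_K23 [p, q, x, y, z] \<longleftrightarrow> distinct [p, q, x, y, z] \<and> {p, q, x, y, z} \<subseteq> V \<and>
    {p, x} \<in> E \<and> {p, y} \<in> E \<and> {p, z} \<in> E \<and> {q, x} \<in> E \<and> {q, y} \<in> E \<and> {q, z} \<in> E"
  unfolding copy_def es_K23_def by auto

lemma copy_F1_iff: "copy es_F1 [a, b, c, d, e] \<longleftrightarrow> distinct [a, b, c, d, e] \<and> {a, b, c, d, e} \<subseteq> V \<and>
    {a, b} \<in> E \<and> {b, c} \<in> E \<and> {a, c} \<in> E \<and> {c, d} \<in> E \<and> {d, e} \<in> E \<and> {c, e} \<in> E"
  unfolding copy_def es_F1_def by auto

lemma copy_F2_iff: "copy es_F2 [a, b, c, d, e, f] \<longleftrightarrow> distinct [a, b, c, d, e, f] \<and>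
    {a, b, c, d, e, f} \<subseteq> V \<and> {a, b} \<in> E \<and> {b, c} \<in> E \<and> {c, d} \<in> E \<and> {a, d} \<in> E \<and> {d, e} \<in> E \<and>
    {e, f} \<in> E \<and> {d, f} \<in> E"
  unfolding copy_def es_F2_def by auto

lemma copy_F5_iff: "copy es_F5 [a, b, c, d, e, f, g] \<longleftrightarrow> distinct [a, b, c, d, e, f, g] \<and>
    {a, b, c, d, e, f, g} \<subseteq> V \<and> {a, b} \<in> E \<and> {b, c} \<in> E \<and> {a, c} \<in> E \<and> {c, d} \<in> E \<and> {d, e} \<in> E \<and>
    {c, e} \<in> E \<and> {e, f} \<in> E \<and> {f, g} \<in> E \<and> {e, g} \<in> E"
  unfolding copy_def es_F5_def by auto

lemma K23_pole_ear:
  assumes K: "copy es_K23 [p, q, x, y, z]" and e: "ear (set [p, q, x, y, z]) p ys p"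
  shows good
proof -
  obtain u U where u: "ys = u # U" "U \<noteq> []" "distinct (u # U)" "set (u # U) \<subseteq> V"
    "set (u # U) \<inter> set [p, q, x, y, z] = {}" "walk E U" "{p, u} \<in> E" "{u, hd U} \<in> E" "{last U, p} \<in> E"
    by (rule closed_earE[OF e])
  show ?thesis
    by (rule good_model[OF K23_triangle_at_pole_cover, of "[[p], [q], [x], [y], [z], [u], U]"])
      (use K[unfolded copy_K23_iff] u
        in \<open>auto simp: K23_triangle_at_pole_def insert_commute intro: touch_ends\<close>)
qed

lemma K23_middle_ear:
  assumes K: "copy es_K23 [p, q, x, y, z]" and e: "ear (set [p, q, x, y, z]) x ys x"
  shows good
proof -
  obtain u U where u: "ys = u # U" "U \<noteq> []" "distinct (u # U)" "set (u # U) \<subseteq> V"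
    "set (u # U) \<inter> set [p, q, x, y, z] = {}" "walk E U" "{x, u} \<in> E" "{u, hd U} \<in> E" "{last U, x} \<in> E"
    by (rule closed_earE[OF e])
  show ?thesis
    by (rule good_model[OF K23_triangle_at_middle_cover, of "[[p], [q], [x], [y], [z], [u], U]"])
      (use K[unfolded copy_K23_iff] u
        in \<open>auto simp: K23_triangle_at_middle_def insert_commute intro: touch_ends\<close>)
qed

lemma K23_pole_pole_ear:
  assumes K: "copy es_K23 [p, q, x, y, z]" and e: "ear (set [p, q, x, y, z]) p ys q"
  shows good
proof -
  show ?thesis
    by (rule good_model[OF K24_cover, of "[[p], [q], [x], [y], [z], ys]"])
      (use K[unfolded copy_K23_iff] ear_facts[OF e]
        in \<open>auto simp: K24_def insert_commute intro: touch_ends\<close>)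
qed

text \<open>A further ear on \<open>K_{2,3}\<close> is attached to both poles, which gives \<open>K_{2,4}\<close>, or it is closed, since
  every other open ear creates a cycle of length at least 5.\<close>

lemma K23_good:
  assumes K: "copy es_K23 [p, q, x, y, z]" and l: "circumference_le 4" and n: "6 \<le> card V"
  shows good
proof -
  let ?vs = "[p, q, x, y, z]"
  obtain i ys j where e: "ear (set ?vs) (?vs ! i) ys (?vs ! j)" and ij: "i < 5" "j < 5"
    by (rule copy_ear[OF K]) (use n in simp_all)
  have sym: "copy es_K23 [q, p, x, y, z]" "copy es_K23 [p, q, y, x, z]" "copy es_K23 [p, q, z, y, x]"
    using K unfolding copy_K23_iff by auto
  show ?thesis
  proof (cases "i = j")
    case True
    from ij(2) consider "j = 0" | "j = 1" | "j = 2" | "j = 3" | "j = 4" by linarith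
    then show ?thesis
    proof cases
      case 1
      with True e K23_pole_ear[OF K] show ?thesis by simp
    next
      case 2
      with True e K23_pole_ear[OF sym(1)] show ?thesis by (simp add: insert_commute)
    next
      case 3
      with True e K23_middle_ear[OF K] show ?thesis by simp
    next
      case 4
      with True e K23_middle_ear[OF sym(2)] show ?thesis by (simp add: insert_commute)
    next
      case 5
      with True e K23_middle_ear[OF sym(3)] show ?thesis by (simp add: insert_commute)
    qed
  next
    case False
    then have "(i, j) = (0, 1) \<or> (j, i) = (0, 1)"
      using open_ear_exceptional[OF K ear_table_K23 _ l _ e ij] by simp
    then show ?thesis
      using e ear_rev[OF e] K23_pole_pole_ear[OF K] by auto
  qed
qed

text \<open>Here \<open>a b c d\<close> is the square and \<open>d e f\<close> the triangle. An open ear either joins opposite vertices of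
  the square and completes a \<open>K_{2,3}\<close>, or it turns the triangle into a second square. A closed ear at
  \<open>a\<close>, \<open>c\<close> or \<open>d\<close> gives three triangles with a common vertex after one edge of the square has been
  contracted; contraction is no option for the ears at \<open>b\<close>, \<open>e\<close> and \<open>f\<close>, which have colourings of
  their own.\<close>

lemma F2_good:
  assumes K: "copy es_F2 [a, b, c, d, e, f]" and l: "circumference_le 4" and n: "7 \<le> card V"
  shows good
proof -
  let ?vs = "[a, b, c, d, e, f]"
  obtain i ys j where er: "ear (set ?vs) (?vs ! i) ys (?vs ! j)" and ij: "i < 6" "j < 6"
    by (rule copy_ear[OF K]) (use n in simp_all)
  note K' = K[unfolded copy_F2_iff]
  show ?thesis
  proof (cases "i = j")
    case True
    obtain u U where u: "ys = u # U" "U \<noteq> []" "distinct (u # U)" "set (u # U) \<subseteq> V"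
      "set (u # U) \<inter> set ?vs = {}" "walk E U" "{?vs ! j, u} \<in> E" "{u, hd U} \<in> E" "{last U, ?vs ! j} \<in> E"
      by (rule closed_earE[OF er[unfolded True]])
    from ij(2) consider "j = 0" | "j = 1" | "j = 2" | "j = 3" | "j = 4" | "j = 5" by linarith
    then show ?thesis
    proof cases
      case 1
      show ?thesis
        by (rule good_model[OF triangle_star_cover, of "[[d, a], [b], [c], [e], [f], [u], U]"])
          (use K' u 1 in \<open>auto simp: triangle_star_def insert_commute intro: touch_ends\<close>)
    next
      case 2
      show ?thesis
        by (rule good_model[OF square_two_triangles_cover, of "[[d], [a], [b], [c], [e], [f], [u], U]"])
          (use K' u 2 in \<open>auto simp: square_two_triangles_def insert_commute intro: touch_ends\<close>)
    next
      case 3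
      show ?thesis
        by (rule good_model[OF triangle_star_cover, of "[[d, c], [b], [a], [e], [f], [u], U]"])
          (use K' u 3 in \<open>auto simp: triangle_star_def insert_commute intro: touch_ends\<close>)
    next
      case 4
      show ?thesis
        by (rule good_model[OF triangle_star_cover, of "[[d], [a, b], [c], [e], [f], [u], U]"])
          (use K' u 4 in \<open>auto simp: triangle_star_def insert_commute intro: touch_ends\<close>)
    next
      case 5
      show ?thesis
        by (rule good_model[OF square_triangle_chain_cover, of "[[d], [a], [b], [c], [e], [f], [u], U]"])
          (use K' u 5 in \<open>auto simp: square_triangle_chain_def insert_commute intro: touch_ends\<close>)
    next
      case 6
      show ?thesis
        by (rule good_model[OF square_triangle_chain_cover, of "[[d], [a], [b], [c], [f], [e], [u], U]"])
          (use K' u 6 in \<open>auto simp: square_triangle_chain_def insert_commute intro: touch_ends\<close>)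
    qed
  next
    case False
    then have "(i, j) \<in> set [(0, 2), (1, 3), (3, 4), (3, 5), (4, 5)] \<or>
      (j, i) \<in> set [(0, 2), (1, 3), (3, 4), (3, 5), (4, 5)]"
      using open_ear_exceptional[OF K ear_table_F2 _ l _ er ij] by simp
    then obtain i j ys where er: "ear (set ?vs) (?vs ! i) ys (?vs ! j)"
      and "(i, j) \<in> set [(0, 2), (1, 3), (3, 4), (3, 5), (4, 5)]"
      using er ear_rev[OF er] by blast
    from this(2) consider "i = 0 \<and> j = 2" | "i = 1 \<and> j = 3" | "i = 3 \<and> j = 4" | "i = 3 \<and> j = 5" | "i = 4 \<and> j = 5"
      by auto
    then show ?thesis
    proof cases
      case 1
      then have er: "ear (set ?vs) a ys c" using er by simp
      have "path_in (set ?vs) a [a, b, c] c" using K' unfolding path_in_def by auto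
      from ear_closes_path[OF er this] have "length ys \<le> 1" using K' circumference_leD[OF l] by fastforce
      with ear_facts[OF er] obtain y where "ys = [y]" by (cases ys) auto
      with ear_facts[OF er] K' have "copy es_K23 [a, c, b, d, y]"
        unfolding copy_K23_iff by (auto simp: insert_commute)
      with K23_good l n show ?thesis by simp
    next
      case 2
      then have er: "ear (set ?vs) b ys d" using er by simp
      have "path_in (set ?vs) b [b, c, d] d" using K' unfolding path_in_def by auto
      from ear_closes_path[OF er this] have "length ys \<le> 1" using K' circumference_leD[OF l] by fastforce
      with ear_facts[OF er] obtain y where "ys = [y]" by (cases ys) auto
      with ear_facts[OF er] K' have "copy es_K23 [b, d, a, c, y]"
        unfolding copy_K23_iff by (auto simp: insert_commute)
      with K23_good l n show ?thesis by simp
    next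
      case 3
      then have er: "ear (set ?vs) d ys e" using er by simp
      show ?thesis
        by (rule good_model[OF cycles44_cover, of "[[d], [a], [b], [c], ys, [e], [f]]"])
          (use K' ear_facts[OF er] in \<open>auto simp: cycles44_def insert_commute intro: touch_ends\<close>)
    next
      case 4
      then have er: "ear (set ?vs) d ys f" using er by simp
      show ?thesis
        by (rule good_model[OF cycles44_cover, of "[[d], [a], [b], [c], ys, [f], [e]]"])
          (use K' ear_facts[OF er] in \<open>auto simp: cycles44_def insert_commute intro: touch_ends\<close>)
    next
      case 5
      then have er: "ear (set ?vs) e ys f" using er by simp
      show ?thesis
        by (rule good_model[OF cycles44_cover, of "[[d], [a], [b], [c], [e], ys, [f]]"])
          (use K' ear_facts[OF er] in \<open>auto simp: cycles44_def insert_commute intro: touch_ends\<close>)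
    qed
  qed
qed

text \<open>The ear and its end form a cycle, which must be a triangle.\<close>

lemma triangle_ear:
  assumes "circumference_le 3" "ear W x ys x"
  obtains y y' where "ys = [y, y']" "distinct [y, y']" "{y, y'} \<subseteq> V" "{y, y'} \<inter> W = {}"
    "{x, y} \<in> E" "{y, y'} \<in> E" "{y', x} \<in> E"
proof -
  have "length ys \<le> 2"
    using circumference_leD[OF assms(1) closed_ear_cycle[OF assms(2)]] by simp
  moreover obtain y Y where "ys = y # Y" "Y \<noteq> []" "distinct (y # Y)" "set (y # Y) \<subseteq> V"
    "set (y # Y) \<inter> W = {}" "walk E Y" "{x, y} \<in> E" "{y, hd Y} \<in> E" "{last Y, x} \<in> E"
    by (rule closed_earE[OF assms(2)])
  ultimately show ?thesis using that by (cases Y) auto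
qed

text \<open>A third triangle is attached to the vertex \<open>c\<close> common to the first two, or elsewhere; in the latter
  case the three triangles form a chain.\<close>

lemma F1_extends:
  assumes K: "copy es_F1 [a, b, c, d, e]" and l: "circumference_le 3" and n: "6 \<le> card V"
  shows "good \<or> (\<exists>a b c d e f g. copy es_F5 [a, b, c, d, e, f, g])"
proof -
  let ?vs = "[a, b, c, d, e]"
  obtain i ys j where er: "ear (set ?vs) (?vs ! i) ys (?vs ! j)" and ij: "i < 5" "j < 5"
    by (rule copy_ear[OF K]) (use n in simp_all)
  note K' = K[unfolded copy_F1_iff]
  have "i = j"
    using open_ear_exceptional[OF K ear_table_F1 _ l _ er ij] by auto
  then obtain y y' where y: "distinct [y, y']" "{y, y'} \<subseteq> V" "{y, y'} \<inter> set ?vs = {}"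
    "{?vs ! j, y} \<in> E" "{y, y'} \<in> E" "{y', ?vs ! j} \<in> E"
    using triangle_ear[OF l] er by metis
  from ij(2) consider "j = 0" | "j = 1" | "j = 2" | "j = 3" | "j = 4" by linarith
  then show ?thesis
  proof cases
    case 1
    with K' y have "copy es_F5 [d, e, c, b, a, y, y']"
      unfolding copy_F5_iff by (auto simp: insert_commute)
    then show ?thesis by blast
  next
    case 2
    with K' y have "copy es_F5 [d, e, c, a, b, y, y']"
      unfolding copy_F5_iff by (auto simp: insert_commute)
    then show ?thesis by blast
  next
    case 3
    have good
      by (rule good_model[OF triangle_star_cover, of "[[c], [a], [b], [d], [e], [y], [y']]"])
        (use K' y 3 in \<open>auto simp: triangle_star_def insert_commute intro: touch_ends\<close>)
    then show ?thesis by simp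
  next
    case 4
    with K' y have "copy es_F5 [a, b, c, e, d, y, y']"
      unfolding copy_F5_iff by (auto simp: insert_commute)
    then show ?thesis by blast
  next
    case 5
    with K' y have "copy es_F5 [a, b, c, d, e, y, y']"
      unfolding copy_F5_iff by (auto simp: insert_commute)
    then show ?thesis by blast
  qed
qed

text \<open>A fourth triangle either makes the chain longer, or leads to three triangles with a common vertex,
  possibly after the middle triangle has been contracted.\<close>

lemma F5_good:
  assumes K: "copy es_F5 [a, b, c, d, e, f, g]" and l: "circumference_le 3" and n: "8 \<le> card V"
  shows good
proof -
  let ?vs = "[a, b, c, d, e, f, g]"
  obtain i ys j where er: "ear (set ?vs) (?vs ! i) ys (?vs ! j)" and ij: "i < 7" "j < 7"
    by (rule copy_ear[OF K]) (use n in simp_all)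
  note K' = K[unfolded copy_F5_iff]
  have "i = j"
    using open_ear_exceptional[OF K ear_table_F5 _ l _ er ij] by auto
  then obtain y y' where y: "distinct [y, y']" "{y, y'} \<subseteq> V" "{y, y'} \<inter> set ?vs = {}"
    "{?vs ! j, y} \<in> E" "{y, y'} \<in> E" "{y', ?vs ! j} \<in> E"
    using triangle_ear[OF l] er by metis
  have star: ?thesis
    if "distinct (concat [C, [p], [q], [r], [s], [y], [y']])" "set (concat [C, [p], [q], [r], [s], [y], [y']]) \<subseteq> V"
      "C \<noteq> []" "walk E C" "touch C [p]" "touch C [q]" "touch C [r]" "touch C [s]" "touch C [y]" "touch C [y']"
      "{p, q} \<in> E" "{r, s} \<in> E" for C p q r s
  proof -
    show ?thesis
      by (rule good_model[OF triangle_star_cover, of "[C, [p], [q], [r], [s], [y], [y']]"])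
        (use that y in \<open>auto simp: triangle_star_def intro: touch_ends\<close>)
  qed
  have path: ?thesis
    if "distinct [p, q, r, s, t, u, v, y, y']" "{p, q, r, s, t, u, v, y, y'} \<subseteq> V"
      "{p, q} \<in> E" "{q, r} \<in> E" "{p, r} \<in> E" "{r, s} \<in> E" "{s, t} \<in> E" "{r, t} \<in> E" "{t, u} \<in> E" "{u, v} \<in> E"
      "{t, v} \<in> E" "{v, y} \<in> E" "{v, y'} \<in> E" for p q r s t u v
  proof -
    show ?thesis
      by (rule good_model[OF triangle_path_cover, of "[[p], [q], [r], [s], [t], [u], [v], [y], [y']]"])
        (use that y in \<open>auto simp: triangle_path_def insert_commute intro: touch_ends\<close>)
  qed
  from ij(2) consider "j = 0" | "j = 1" | "j = 2" | "j = 3" | "j = 4" | "j = 5" | "j = 6" by linarith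
  then show ?thesis
  proof cases
    case 1
    with K' y show ?thesis by (intro path[of f g e d c b a]) (auto simp: insert_commute)
  next
    case 2
    with K' y show ?thesis by (intro path[of f g e d c a b]) (auto simp: insert_commute)
  next
    case 3
    with K' y show ?thesis
      by (intro star[of "[c]" a b d e]) (auto simp: insert_commute intro: touch_ends)
  next
    case 4
    with K' y show ?thesis
      by (intro star[of "[c, d, e]" a b f g]) (auto simp: insert_commute touch_def)
  next
    case 5
    with K' y show ?thesis
      by (intro star[of "[e]" c d f g]) (auto simp: insert_commute intro: touch_ends)
  next
    case 6
    with K' y show ?thesis by (intro path[of a b c d e g f]) (auto simp: insert_commute)
  next
    case 7
    with K' y show ?thesis by (intro path[of a b c d e f g]) (auto simp: insert_commute)
  qed
qed

text \<open>An open ear joins opposite vertices of the square and has one inner vertex, because the cycle is a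
  longest one. A closed ear is a triangle, or a longer cycle that contracts to a second square.\<close>

lemma square_ear:
  assumes xs: "cycle xs" "length xs = 4" and l: "circumference_le 4" and V: "set xs \<noteq> V"
  shows "good \<or> (\<exists>p q x y z. copy es_K23 [p, q, x, y, z]) \<or> (\<exists>a b c d e f. copy es_F2 [a, b, c, d, e, f])"
proof -
  obtain x ys z where e0: "ear (set xs) x ys z"
    by (rule ear_exists[OF cycle_in_V[OF xs(1)] _ V]) (use xs(2) in auto)
  then have "x \<in> set xs" unfolding ear_def by simp
  then obtain C where C: "cycle (x # C)" "set (x # C) = set xs" "length (x # C) = length xs"
    by (rule cycle_rotate[OF xs(1)])
  then obtain a b c where abc: "C = [a, b, c]"
    using xs(2) by (auto simp: numeral_eq_Suc length_Suc_conv)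
  have e: "ear (set [x, a, b, c]) x ys z" using e0 C(2) abc by simp
  have c: "distinct [x, a, b, c]" "{x, a, b, c} \<subseteq> V" "{x, a} \<in> E" "{a, b} \<in> E" "{b, c} \<in> E" "{c, x} \<in> E"
    using C(1) cycle_in_V[OF C(1)] abc unfolding cycle_def by auto
  have short: "length p + length ys \<le> 4" if "path_in (set [x, a, b, c]) x p z" "x \<noteq> z" for p
    using circumference_leD[OF l ear_closes_path[OF e that]] by simp
  have ne: "0 < length ys" using ear_facts(1)[OF e] by simp
  have "z \<in> set [x, a, b, c]" using e unfolding ear_def by simp
  then consider "z = x" | "z = a" | "z = b" | "z = c" by auto
  then show ?thesis
  proof cases
    case 1
    obtain y Y where y: "ys = y # Y" "Y \<noteq> []" "distinct (y # Y)" "set (y # Y) \<subseteq> V"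
      "set (y # Y) \<inter> set [x, a, b, c] = {}" "walk E Y" "{x, y} \<in> E" "{y, hd Y} \<in> E" "{last Y, x} \<in> E"
      by (rule closed_earE[OF e[unfolded 1]])
    show ?thesis
    proof (cases "tl Y")
      case Nil
      then have "Y = [hd Y]" using y(2) by (cases Y) auto
      with y c have "copy es_F2 [a, b, c, x, y, hd Y]"
        unfolding copy_F2_iff by (cases Y) (auto simp: insert_commute)
      then show ?thesis by blast
    next
      case (Cons y2 Y')
      then obtain y1 where Y: "Y = y1 # y2 # Y'" using y(2) by (cases Y) auto
      have good
        by (rule good_model[OF cycles44_cover, of "[[x], [a], [b], [c], [y], [y1], y2 # Y']"])
          (use c y Y in \<open>auto simp: cycles44_def insert_commute intro: touch_ends\<close>)
      then show ?thesis by simp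
    qed
  next
    case 2
    have "path_in (set [x, a, b, c]) x [x, c, b, a] z"
      using c 2 unfolding path_in_def by (auto simp: insert_commute)
    from short[OF this] 2 c(1) ne show ?thesis by simp
  next
    case 3
    have "path_in (set [x, a, b, c]) x [x, a, b] z"
      using c 3 unfolding path_in_def by (auto simp: insert_commute)
    from short[OF this] 3 c(1) ne obtain y where "ys = [y]" by (cases ys) auto
    with ear_facts[OF e] c 3 have "copy es_K23 [x, b, a, c, y]"
      unfolding copy_K23_iff by (auto simp: insert_commute)
    then show ?thesis by blast
  next
    case 4
    have "path_in (set [x, a, b, c]) x [x, a, b, c] z"
      using c 4 unfolding path_in_def by (auto simp: insert_commute)
    from short[OF this] 4 c(1) ne show ?thesis by simp
  qed
qed

lemma triangle_extends:
  assumes xs: "cycle xs" "length xs = 3" and l: "circumference_le 3" and V: "set xs \<noteq> V"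
  shows "\<exists>a b c d e. copy es_F1 [a, b, c, d, e]"
proof -
  obtain x ys z where e0: "ear (set xs) x ys z"
    by (rule ear_exists[OF cycle_in_V[OF xs(1)] _ V]) (use xs(2) in auto)
  then have "x \<in> set xs" unfolding ear_def by simp
  then obtain C where C: "cycle (x # C)" "set (x # C) = set xs" "length (x # C) = length xs"
    by (rule cycle_rotate[OF xs(1)])
  then obtain a b where ab: "C = [a, b]"
    using xs(2) by (auto simp: numeral_eq_Suc length_Suc_conv)
  have e: "ear (set [x, a, b]) x ys z" using e0 C(2) ab by simp
  have c: "distinct [x, a, b]" "{x, a, b} \<subseteq> V" "{x, a} \<in> E" "{a, b} \<in> E" "{b, x} \<in> E"
    using C(1) cycle_in_V[OF C(1)] ab unfolding cycle_def by auto
  have "x = z"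
  proof (rule ccontr)
    assume "x \<noteq> z"
    then have "z = a \<or> z = b" using e unfolding ear_def by auto
    then have "\<exists>p. path_in (set [x, a, b]) x p z \<and> length p = 3"
      using c by (intro exI[of _ "[x, if z = a then b else a, z]"]) (auto simp: path_in_def insert_commute)
    then obtain p where "path_in (set [x, a, b]) x p z" "length p = 3" by blast
    from circumference_leD[OF l ear_closes_path[OF e this(1) \<open>x \<noteq> z\<close>]] this(2) ear_facts(1)[OF e]
    show False by simp
  qed
  then obtain y y' where y: "distinct [y, y']" "{y, y'} \<subseteq> V" "{y, y'} \<inter> set [x, a, b] = {}"
    "{x, y} \<in> E" "{y, y'} \<in> E" "{y', x} \<in> E"
    using triangle_ear[OF l] e by metis
  with c have "copy es_F1 [a, b, x, y, y']" unfolding copy_F1_iff by (auto simp: insert_commute)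
  then show ?thesis by blast
qed

end

section \<open>Recognising the exceptional graphs\<close>

context bridgeless
begin

lemma labelling:
  assumes "distinct vs" "set vs = V" "length vs = k"
  obtains f where "bij_betw f V {s..<s + k}" "\<forall>i<k. f (vs ! i) = s + i"
proof -
  have "bij_betw ((!) vs) {0..<k} V"
    using bij_betw_nth[OF assms(1)] assms(2,3) by (simp add: lessThan_atLeast0)
  then have inv: "bij_betw (inv_into {0..<k} ((!) vs)) V {0..<k}"
    by (rule bij_betw_inv_into)
  have "bij_betw ((+) s) {0..<k} {s..<s + k}"
    by (intro bij_betw_imageI) (auto simp: image_add_atLeastLessThan)
  with inv have "bij_betw ((+) s \<circ> inv_into {0..<k} ((!) vs)) V {s..<s + k}"
    by (rule bij_betw_trans)
  moreover have "inv_into {0..<k} ((!) vs) (vs ! i) = i" if "i < k" for i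
    using assms(1,3) that by (intro inv_into_f_f) (auto simp: inj_on_def nth_eq_iff_index_eq)
  ultimately show ?thesis using that by force
qed

text \<open>The offset \<open>s\<close> is the smallest vertex of \<open>K\<close>: the concrete graphs are numbered from 0 or from 1.\<close>

lemma iso_by_label:
  fixes K :: "nat ugraph"
  assumes vs: "distinct vs" "set vs = V" "length vs = k" and K: "vertices K = {s..<s + k}"
    and loop: "\<And>i. {i} \<notin> edges K"
    and edge: "\<And>i j. i < j \<Longrightarrow> j < k \<Longrightarrow> {vs ! i, vs ! j} \<in> E \<longleftrightarrow> {s + i, s + j} \<in> edges K"
  shows "graph_isomorphic (V, E) K"
proof -
  obtain f where f: "bij_betw f V {s..<s + k}" "\<forall>i<k. f (vs ! i) = s + i"
    by (rule labelling[OF vs, where s = s])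
  have "{u, v} \<in> E \<longleftrightarrow> {f u, f v} \<in> edges K" if "u \<in> V" "v \<in> V" for u v
  proof -
    obtain i j where ij: "u = vs ! i" "v = vs ! j" "i < k" "j < k"
      using \<open>u \<in> V\<close> \<open>v \<in> V\<close> vs by (metis in_set_conv_nth)
    consider "i < j" | "j < i" | "i = j" by linarith
    then show ?thesis
      by cases (use ij f(2) edge[of i j] edge[of j i] loop in \<open>auto simp: insert_commute\<close>)
  qed
  with f(1) K show ?thesis unfolding graph_isomorphic_def by auto
qed

lemma spanning_by_label:
  fixes K :: "nat ugraph"
  assumes vs: "distinct vs" "set vs = V" "length vs = k" and K: "vertices K = {s..<s + k}"
    and edge: "\<And>i j. i < j \<Longrightarrow> j < k \<Longrightarrow> {vs ! i, vs ! j} \<in> E \<Longrightarrow> {s + i, s + j} \<in> edges K"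
  shows "\<exists>H. spanning_subgraph_of H K \<and> graph_isomorphic (V, E) H"
proof -
  let ?H = "(vertices K, {{s + i, s + j} | i j. i < j \<and> j < k \<and> {vs ! i, vs ! j} \<in> E})"
  have "graph_isomorphic (V, E) ?H"
  proof (rule iso_by_label[OF vs])
    show "vertices ?H = {s..<s + k}" using K by simp
    show "{i} \<notin> edges ?H" for i by (auto simp: singleton_iff doubleton_eq_iff)
    fix i j assume "i < j" "j < k"
    then show "{vs ! i, vs ! j} \<in> E \<longleftrightarrow> {s + i, s + j} \<in> edges ?H"
      by (auto simp: doubleton_eq_iff)
  qed
  moreover have "spanning_subgraph_of ?H K"
    unfolding spanning_subgraph_of_def subgraph_of_def finite_simple_graph_def
    using K edge by auto
  ultimately show ?thesis by blast
qed

lemma iso_copy: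
  assumes es: "copy es vs" "set vs = V" "length vs = k" "\<And>i j. (i, j) \<in> set es \<Longrightarrow> i < j"
    and edge: "\<And>i j. i < j \<Longrightarrow> j < k \<Longrightarrow> {vs ! i, vs ! j} \<in> E \<Longrightarrow> (i, j) \<in> set es"
    and K: "K = ({s..<s + k}, (\<lambda>(i, j). {s + i, s + j}) ` set es)"
  shows "graph_isomorphic (V, E) K"
proof (rule iso_by_label[OF _ es(2,3)])
  show "distinct vs" using es(1) unfolding copy_def by simp
  show "vertices K = {s..<s + k}" unfolding K by simp
  show "{i} \<notin> edges K" for i unfolding K using es(4) by (fastforce simp: singleton_insert_inj_eq)
  fix i j assume ij: "i < j" "j < k"
  have "{s + i, s + j} \<in> edges K \<longleftrightarrow> (i, j) \<in> set es"
    unfolding K using es(4) ij(1) by (force simp: doubleton_eq_iff)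
  with edge[OF ij] copy_edge[OF es(1)] show "{vs ! i, vs ! j} \<in> E \<longleftrightarrow> {s + i, s + j} \<in> edges K"
    by blast
qed

text \<open>Connectedness after deleting a vertex is witnessed by a walk, possibly with repetitions, through all
  other vertices.\<close>

lemma vertex_conn_2_by_walks:
  assumes n: "3 \<le> card V" and all: "walk E w" "set w = V"
    and del: "\<And>x. x \<in> V \<Longrightarrow> \<exists>w. walk E w \<and> set w = V - {x}"
  shows "vertex_conn 2 (V, E)"
proof -
  have conn: "connected_graph (remove_vertices (V, E) X)"
    if w: "walk E w" "set w = V - X" and X: "V - X \<noteq> {}" for w X
  proof -
    have "walk {e \<in> E. e \<inter> X = {}} w"
      using w(1) by (rule successively_mono) (use w(2) in auto)
    then have "conn_set {e \<in> E. e \<inter> X = {}} (set w)"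
      by (rule walk_conn_set) (use w(2) X in auto)
    then have "joins {e \<in> E. e \<inter> X = {}} (set w)"
      by (rule joins_mono[OF conn_set_joins _ order_refl]) auto
    then show ?thesis
      using w(2) X unfolding connected_graph_iff remove_vertices_def by simp
  qed
  have "connected_graph (remove_vertices (V, E) X)" if X: "X \<subseteq> V" "card X < 2" for X
  proof (cases "X = {}")
    case True
    then have "V - X \<noteq> {}" using n by auto
    from conn[OF all(1) _ this] all(2) True show ?thesis by simp
  next
    case False
    have "finite X" using X(1) finite_V by (rule finite_subset)
    with False X(2) have "card X = 1" by (metis card_0_eq less_2_cases One_nat_def)
    then obtain x where x: "X = {x}" by (rule card_1_singletonE)
    have "V \<noteq> {x}" using n by auto
    with x X(1) conn[of _ X] del[of x] show ?thesis by auto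
  qed
  with n show ?thesis unfolding vertex_conn_def by simp
qed

lemma hamiltonian_vertex_conn:
  assumes xs: "cycle xs" "set xs = V"
  shows "vertex_conn 2 (V, E)"
proof (rule vertex_conn_2_by_walks)
  show "walk E xs" using xs(1) unfolding cycle_def by simp
  show "3 \<le> card V" using xs distinct_card unfolding cycle_def by metis
  fix x assume "x \<in> V"
  with xs obtain ys where ys: "cycle (x # ys)" "set (x # ys) = V"
    using cycle_rotate by metis
  then have "walk E ys" "set ys = V - {x}" unfolding cycle_def by (auto simp: successively_Cons)
  then show "\<exists>w. walk E w \<and> set w = V - {x}" by blast
qed (rule xs(2))

lemma K23_vertex_conn:
  assumes K: "copy es_K23 [p, q, x, y, z]" and V: "V = {p, q, x, y, z}"
  shows "vertex_conn 2 (V, E)"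
proof (rule vertex_conn_2_by_walks)
  note K = K[unfolded copy_K23_iff]
  show "3 \<le> card V" using K V by simp
  show "walk E [p, x, q, y, p, z]" using K by (simp add: insert_commute)
  show "set [p, x, q, y, p, z] = V" using V by auto
  fix v assume "v \<in> V"
  then have "v \<in> {p, q, x, y, z}" using V by simp
  then consider "v = p" | "v = q" | "v = x" | "v = y" | "v = z" by blast
  then show "\<exists>w. walk E w \<and> set w = V - {v}"
  proof cases
    case 1
    then show ?thesis using K V by (intro exI[of _ "[x, q, y, q, z]"]) (auto simp: insert_commute)
  next
    case 2
    then show ?thesis using K V by (intro exI[of _ "[x, p, y, p, z]"]) (auto simp: insert_commute)
  next
    case 3
    then show ?thesis using K V by (intro exI[of _ "[y, p, z, q]"]) (auto simp: insert_commute)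
  next
    case 4
    then show ?thesis using K V by (intro exI[of _ "[x, p, z, q]"]) (auto simp: insert_commute)
  next
    case 5
    then show ?thesis using K V by (intro exI[of _ "[x, p, y, q]"]) (auto simp: insert_commute)
  qed
qed

lemma copy_spanning: "copy es vs \<Longrightarrow> length vs = card V \<Longrightarrow> set vs = V"
  unfolding copy_def using card_subset_eq[OF finite_V, of "set vs"] by (simp add: distinct_card)

lemma edge_exceptional:
  assumes "copy es vs" "path_table es k m exc" "length vs = k" "circumference_le l" "l < m" "3 \<le> m"
    and sorted: "\<And>i j. (i, j) \<in> set exc \<Longrightarrow> i < j"
    and "i < j" "j < k" "{vs ! i, vs ! j} \<in> E"
  shows "(i, j) \<in> set exc"
proof -
  have "(i, j) \<in> set exc \<or> (j, i) \<in> set exc"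
    using assms(8,9) by (intro extra_edge_exceptional[OF assms(1-6,10)]) simp_all
  with sorted[of j i] \<open>i < j\<close> show ?thesis by auto
qed

lemma iso_F1:
  assumes K: "copy es_F1 vs" "length vs = 5" and l: "circumference_le 3" and n: "card V = 5"
  shows "graph_isomorphic (V, E) F1"
proof (rule iso_copy[OF K(1) copy_spanning[OF K(1)] K(2)])
  show "F1 = ({1..<1 + 5}, (\<lambda>(i, j). {1 + i, 1 + j}) ` set es_F1)"
    by (simp add: F1_def es_F1_def insert_commute numeral_eq_Suc atLeastLessThanSuc_atLeastAtMost[symmetric])
  show "i < j" if "(i, j) \<in> set es_F1" for i j using that unfolding es_F1_def by auto
  show "(i, j) \<in> set es_F1" if "i < j" "j < 5" "{vs ! i, vs ! j} \<in> E" for i j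
    by (rule edge_exceptional[OF K(1) edge_table_F1 K(2) l _ _ _ that]) (auto simp: es_F1_def)
qed (simp add: K n)

lemma iso_F5:
  assumes K: "copy es_F5 vs" "length vs = 7" and l: "circumference_le 3" and n: "card V = 7"
  shows "graph_isomorphic (V, E) F5"
proof (rule iso_copy[OF K(1) copy_spanning[OF K(1)] K(2)])
  show "F5 = ({1..<1 + 7}, (\<lambda>(i, j). {1 + i, 1 + j}) ` set es_F5)"
    by (simp add: F5_def es_F5_def insert_commute numeral_eq_Suc atLeastLessThanSuc_atLeastAtMost[symmetric])
  show "i < j" if "(i, j) \<in> set es_F5" for i j using that unfolding es_F5_def by auto
  show "(i, j) \<in> set es_F5" if "i < j" "j < 7" "{vs ! i, vs ! j} \<in> E" for i j
    by (rule edge_exceptional[OF K(1) edge_table_F5 K(2) l _ _ _ that]) (auto simp: es_F5_def)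
qed (simp add: K n)

lemma F2_spanning:
  assumes K: "copy es_F2 [a, b, c, d, e, f]" and l: "circumference_le 4" and n: "card V = 6"
  shows "good \<or> graph_isomorphic (V, E) F2 \<or> graph_isomorphic (V, E) F3 \<or> graph_isomorphic (V, E) F4"
proof -
  let ?vs = "[a, b, c, d, e, f]"
  have V: "set ?vs = V" "length ?vs = 6" using copy_spanning[OF K] n by simp_all
  have less: "i < j" if "(i, j) \<in> set (es_F2 @ [(0, 2), (1, 3)])" for i j
    using that unfolding es_F2_def by auto
  have extra: "(i, j) \<in> set (es_F2 @ [(0, 2), (1, 3)])"
    if "i < j" "j < 6" "{?vs ! i, ?vs ! j} \<in> E" for i j
    by (rule edge_exceptional[OF K edge_table_F2 V(2) l _ _ less that]) simp_all
  consider "{a, c} \<in> E" "{b, d} \<in> E" | "{a, c} \<notin> E" "{b, d} \<notin> E" | "{a, c} \<in> E" "{b, d} \<notin> E"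
    | "{a, c} \<notin> E" "{b, d} \<in> E" by blast
  then show ?thesis
  proof cases
    case 1
    have good
      by (rule good_model[OF K4_triangle_cover, of "[[d], [a], [b], [c], [e], [f]]"])
        (use K[unfolded copy_F2_iff] 1 in \<open>auto simp: K4_triangle_def insert_commute intro: touch_ends\<close>)
    then show ?thesis by simp
  next
    case 2
    have "graph_isomorphic (V, E) F2"
    proof (rule iso_copy[OF K V])
      show "F2 = ({1..<1 + 6}, (\<lambda>(i, j). {1 + i, 1 + j}) ` set es_F2)"
        by (simp add: F2_def es_F2_def insert_commute numeral_eq_Suc atLeastLessThanSuc_atLeastAtMost[symmetric])
      show "(i, j) \<in> set es_F2" if "i < j" "j < 6" "{?vs ! i, ?vs ! j} \<in> E" for i j
        using extra[OF that] that(3) 2 by auto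
    qed (use less in simp)
    then show ?thesis by simp
  next
    case 3
    have "copy (es_F2 @ [(0, 2)]) ?vs" using K 3 unfolding copy_def by auto
    then have "graph_isomorphic (V, E) F3"
    proof (rule iso_copy[OF _ V])
      show "F3 = ({1..<1 + 6}, (\<lambda>(i, j). {1 + i, 1 + j}) ` set (es_F2 @ [(0, 2)]))"
        by (simp add: F2_def F3_def es_F2_def insert_commute numeral_eq_Suc atLeastLessThanSuc_atLeastAtMost[symmetric])
      show "(i, j) \<in> set (es_F2 @ [(0, 2)])" if "i < j" "j < 6" "{?vs ! i, ?vs ! j} \<in> E" for i j
        using extra[OF that] that(3) 3 by auto
    qed (use less in auto)
    then show ?thesis by simp
  next
    case 4
    have "copy (es_F2 @ [(1, 3)]) ?vs" using K 4 unfolding copy_def by auto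
    then have "graph_isomorphic (V, E) F4"
    proof (rule iso_copy[OF _ V])
      show "F4 = ({1..<1 + 6}, (\<lambda>(i, j). {1 + i, 1 + j}) ` set (es_F2 @ [(1, 3)]))"
        by (simp add: F2_def F4_def es_F2_def insert_commute numeral_eq_Suc atLeastLessThanSuc_atLeastAtMost[symmetric])
      show "(i, j) \<in> set (es_F2 @ [(1, 3)])" if "i < j" "j < 6" "{?vs ! i, ?vs ! j} \<in> E" for i j
        using extra[OF that] that(3) 4 by auto
    qed (use less in auto)
    then show ?thesis by simp
  qed
qed

lemma hamiltonian_cycle_or_good:
  assumes xs: "cycle xs" "set xs = V" and n: "7 \<le> card V"
  shows "good \<or> graph_isomorphic (V, E) (cycle_graph (card V))"
proof (cases good)
  case False
  let ?n = "card V" and ?es = "(0, card V - 1) # map (\<lambda>i. (i, Suc i)) [0..<card V - 1]"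
  have len: "length xs = ?n" and dist: "distinct xs" and w: "walk E xs" and cl: "{last xs, hd xs} \<in> E"
    using xs distinct_card unfolding cycle_def by metis+
  have "xs \<noteq> []" using len n by auto
  then have ends: "hd xs = xs ! 0" "last xs = xs ! (?n - 1)"
    using len by (simp_all add: hd_conv_nth last_conv_nth)
  have step: "{xs ! i, xs ! Suc i} \<in> E" if "Suc i < ?n" for i
    using w that len unfolding successively_conv_nth by simp
  have "copy ?es xs"
    using dist xs(2) len n cl step ends unfolding copy_def by (auto simp: insert_commute)
  then have "graph_isomorphic (V, E) (cycle_graph ?n)"
  proof (rule iso_copy[OF _ xs(2) len, where s = 0])
    show "i < j" if "(i, j) \<in> set ?es" for i j using that n by auto
    show "cycle_graph ?n = ({0..<0 + ?n}, (\<lambda>(i, j). {0 + i, 0 + j}) ` set ?es)"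
    proof -
      have "{{i, Suc i mod ?n} | i. i < ?n} = (\<lambda>(i, j). {i, j}) ` set ?es" (is "?L = ?R")
      proof
        show "?L \<subseteq> ?R"
        proof
          fix e assume "e \<in> ?L"
          then obtain i where i: "e = {i, Suc i mod ?n}" "i < ?n" by blast
          show "e \<in> ?R"
          proof (cases "Suc i = ?n")
            case True
            then have "e = {0, ?n - 1}" using i by auto
            then show ?thesis by simp
          next
            case False
            then have "e = {i, Suc i}" "i < ?n - 1" using i by auto
            then show ?thesis by auto
          qed
        qed
        show "?R \<subseteq> ?L"
        proof
          fix e assume "e \<in> ?R"
          then consider "e = {0, ?n - 1}" | i where "i < ?n - 1" "e = {i, Suc i}" by auto
          then show "e \<in> ?L"
          proof cases
            case 1
            then have "e = {?n - 1, Suc (?n - 1) mod ?n}" "?n - 1 < ?n" using n by auto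
            then show ?thesis by blast
          next
            case 2
            then have "e = {i, Suc i mod ?n}" "i < ?n" by auto
            then show ?thesis by blast
          qed
        qed
      qed
      then show ?thesis unfolding cycle_graph_def by (auto simp: lessThan_atLeast0)
    qed
    fix i j assume ij: "i < j" "j < ?n" and e: "{xs ! i, xs ! j} \<in> E"
    show "(i, j) \<in> set ?es"
    proof (rule ccontr)
      assume no: "(i, j) \<notin> set ?es"
      define A where "A = take (j - Suc i) (drop (Suc i) xs)"
      define D where "D = drop (Suc j) xs @ take i xs"
      have "drop (Suc i) xs = A @ xs ! j # drop (Suc j) xs"
        unfolding A_def using id_take_nth_drop[of "j - Suc i" "drop (Suc i) xs"] ij len by simp
      then have split: "xs = take i xs @ xs ! i # A @ xs ! j # drop (Suc j) xs"
        using id_take_nth_drop[of i xs] ij len by simp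
      have "cycle (take i xs @ xs ! i # A @ xs ! j # drop (Suc j) xs)"
        by (subst split[symmetric]) (rule xs(1))
      from cycle_append_swap[OF this] have "cycle (xs ! i # A @ xs ! j # D)"
        unfolding D_def by simp
      moreover have "length A = j - Suc i" "length D = ?n - Suc j + i"
        unfolding A_def D_def using ij len by simp_all
      moreover have "Suc i \<noteq> j" "i \<noteq> 0 \<or> Suc j \<noteq> ?n" using no ij by auto
      ultimately have "cycle (xs ! i # A @ xs ! j # D)" "A \<noteq> []" "D \<noteq> []" "5 \<le> length A + length D"
        using ij n by auto
      with good_chord e False show False by blast
    qed
  qed
  then show ?thesis by simp
qed simp

lemma hexagon_crossing_chords:
  assumes "cycle [a, b, c, d, e, f]" "{a, c} \<in> E" "{b, d} \<in> E"
  shows good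
proof -
  show ?thesis
    by (rule good_model[OF C6_crossing_chords_cover, of "[[a], [b], [c], [d], [e], [f]]"])
      (use assms cycle_in_V[OF assms(1)]
        in \<open>auto simp: C6_crossing_chords_def cycle_def insert_commute intro: touch_ends\<close>)
qed

lemma hexagon_parallel_chords:
  assumes "cycle [a, b, c, d, e, f]" "{a, c} \<in> E" "{d, f} \<in> E"
  shows good
proof -
  show ?thesis
    by (rule good_model[OF C6_parallel_chords_cover, of "[[a], [b], [c], [d], [e], [f]]"])
      (use assms cycle_in_V[OF assms(1)]
        in \<open>auto simp: C6_parallel_chords_def cycle_def insert_commute intro: touch_ends\<close>)
qed

text \<open>Call the chords within \<open>{a, c, e}\<close> and those within \<open>{b, d, f}\<close> the two kinds of short chords. Two
  chords of different kinds are crossing or parallel, and both configurations save 3.\<close>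

lemma hexagon_chord:
  assumes cyc: "cycle [a, b, c, d, e, f]" and ac: "{a, c} \<in> E" and bad: "\<not> good"
  shows "{b, d} \<notin> E" "{d, f} \<notin> E" "{b, f} \<notin> E"
proof -
  have "cycle [c, b, a, f, e, d]"
    using cycle_append_swap[of "[f, e, d]" "[c, b, a]"] cycle_rev[OF cyc] by simp
  then show "{b, d} \<notin> E" "{d, f} \<notin> E" "{b, f} \<notin> E"
    using hexagon_crossing_chords[OF cyc ac] hexagon_parallel_chords[OF cyc ac] ac bad
      hexagon_crossing_chords[of c b a f e d] by (auto simp: insert_commute)
qed

text \<open>Without the chords on \<open>{a, c, e}\<close> and without long chords, only the hexagon and the triangle
  \<open>b d f\<close> remain.\<close>

lemma hexagon_in_three_sun:
  assumes cyc: "cycle [a, b, c, d, e, f]" and V: "set [a, b, c, d, e, f] = V" and bad: "\<not> good"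
    and no: "{a, c} \<notin> E" "{c, e} \<notin> E" "{a, e} \<notin> E"
  shows "\<exists>H. spanning_subgraph_of H three_sun \<and> graph_isomorphic (V, E) H"
proof -
  have cyc2: "cycle [b, c, d, e, f, a]" "cycle [c, d, e, f, a, b]"
    using cycle_append_swap[of "[a]" "[b, c, d, e, f]"] cycle_append_swap[of "[a, b]" "[c, d, e, f]"] cyc
    by simp_all
  have long: "{a, d} \<notin> E" "{b, e} \<notin> E" "{c, f} \<notin> E"
    using good_long_chord[of a "[b, c]" d "[e, f]"] good_long_chord[of b "[c, d]" e "[f, a]"]
      good_long_chord[of c "[d, e]" f "[a, b]"] cyc cyc2 bad by auto
  show ?thesis
  proof (rule spanning_by_label[of "[a, b, c, d, e, f]" 6 three_sun 1])
    show "distinct [a, b, c, d, e, f]" using cyc unfolding cycle_def by simp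
    show "vertices three_sun = {1..<1 + 6}" unfolding three_sun_def by auto
    fix i j :: nat assume ij: "i < j" "j < 6" and e: "{[a, b, c, d, e, f] ! i, [a, b, c, d, e, f] ! j} \<in> E"
    from ij have "j = 1 \<or> j = 2 \<or> j = 3 \<or> j = 4 \<or> j = 5" by linarith
    moreover from ij have "i = 0 \<or> i = 1 \<or> i = 2 \<or> i = 3 \<or> i = 4" by linarith
    ultimately show "{1 + i, 1 + j} \<in> edges three_sun"
      using ij(1) e no long unfolding three_sun_def
      by (elim disjE) (simp_all add: doubleton_eq_iff)
  qed (use V in simp_all)
qed

lemma hexagon:
  assumes xs: "cycle xs" "set xs = V" and n: "card V = 6" and bad: "\<not> good"
  shows "\<exists>H. spanning_subgraph_of H three_sun \<and> graph_isomorphic (V, E) H"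
proof -
  have "length xs = 6" using xs n distinct_card unfolding cycle_def by metis
  then obtain a b c d e f where abc: "xs = [a, b, c, d, e, f]"
    by (auto simp: numeral_eq_Suc length_Suc_conv)
  note c0 = xs(1)[unfolded abc]
  have c1: "cycle [c, d, e, f, a, b]" "cycle [e, f, a, b, c, d]" "cycle [b, c, d, e, f, a]"
    using cycle_append_swap[of "[a, b]" "[c, d, e, f]"] cycle_append_swap[of "[a, b, c, d]" "[e, f]"]
      cycle_append_swap[of "[a]" "[b, c, d, e, f]"] c0 by simp_all
  consider "{a, c} \<notin> E" "{c, e} \<notin> E" "{a, e} \<notin> E" | "{b, d} \<notin> E" "{d, f} \<notin> E" "{b, f} \<notin> E"
    using hexagon_chord[OF c0 _ bad] hexagon_chord[OF c1(1) _ bad] hexagon_chord[OF c1(2) _ bad]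
    by (metis insert_commute)
  then show ?thesis
  proof cases
    case 1
    with hexagon_in_three_sun[OF c0 _ bad] xs(2) abc show ?thesis by simp
  next
    case 2
    have "set [b, c, d, e, f, a] = V" using xs(2) abc by auto
    with 2 hexagon_in_three_sun[OF c1(3) _ bad] show ?thesis by simp
  qed
qed

end

section \<open>Lower bounds for small graphs\<close>

lemma conn_set_card: "conn_set F W \<Longrightarrow> finite F \<Longrightarrow> card W \<le> card {e \<in> F. e \<subseteq> W} + 1"
proof (induction rule: conn_set.induct)
  case (grow A x y)
  have "{x, y} \<notin> {e \<in> F. e \<subseteq> A}" using grow.hyps(3) by simp
  then have "card (insert {x, y} {e \<in> F. e \<subseteq> A}) = Suc (card {e \<in> F. e \<subseteq> A})"
    using grow.prems by simp
  moreover have "card (insert {x, y} {e \<in> F. e \<subseteq> A}) \<le> card {e \<in> F. e \<subseteq> insert y A}"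
    using grow.hyps(2,4) grow.prems by (intro card_mono) auto
  moreover have "card (insert y A) = Suc (card A)"
    using grow.hyps(3) conn_set_finite[OF grow.hyps(1)] by simp
  ultimately show ?case using grow.IH[OF grow.prems] by linarith
qed simp

lemma conn_set_crosses:
  assumes "conn_set F W" "a \<in> W" "a \<in> X" "b \<in> W" "b \<notin> X"
  obtains u v where "{u, v} \<in> F" "u \<in> W" "u \<in> X" "v \<in> W" "v \<notin> X"
proof -
  obtain u v where "{u, v} \<in> {e \<in> F. e \<subseteq> W}" "u \<in> X" "v \<notin> X"
    by (rule joins_crosses[OF conn_set_joins[OF assms(1)], of a X b]) (use assms in auto)
  with that show ?thesis by auto
qed

text \<open>The component of \<open>S\<close> in a rainbow edge set is a set of at most \<open>k + 1\<close> vertices.\<close>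

lemma few_colours_steiner:
  assumes K: "finite_simple_graph K" and c: "c ` edges K \<subseteq> {..<k}"
    and F: "F \<subseteq> edges K" "inj_on c F" and S: "joins F S" "S \<subseteq> vertices K" "S \<noteq> {}"
  obtains W where "S \<subseteq> W" "W \<subseteq> vertices K" "conn_set F W" "card W \<le> k + 1"
proof -
  obtain s where s: "s \<in> S" using S(3) by blast
  define W where "W = {x. linked F s x}"
  have SW: "S \<subseteq> W" using S(1) s unfolding joins_def W_def by blast
  have WV: "W \<subseteq> vertices K"
    unfolding W_def using component_subset[OF K F(1)] s S(2) by blast
  have finW: "finite W" using WV fsg_finite(1)[OF K] by (rule finite_subset)
  have finF: "finite F" using F(1) fsg_finite(2)[OF K] by (rule finite_subset)
  have "conn_set F W"
  proof (rule conn_setI[OF finW, of s])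
    show "s \<in> W" unfolding W_def by simp
    show "linked {e \<in> F. e \<subseteq> W} s y" if "y \<in> W" for y
      using that linked_in_component[of F s y] unfolding W_def by simp
  qed
  moreover have "card W \<le> k + 1"
  proof -
    have "card W \<le> card {e \<in> F. e \<subseteq> W} + 1" using conn_set_card[OF calculation finF] .
    also have "card {e \<in> F. e \<subseteq> W} \<le> card F" using finF by (intro card_mono) auto
    also have "card F = card (c ` F)" using F(2) by (simp add: card_image)
    also have "\<dots> \<le> card {..<k}" using F(1) c by (intro card_mono) auto
    finally show ?thesis by simp
  qed
  ultimately show ?thesis using that SW WV by blast
qed

text \<open>What a 3-rainbow colouring with \<open>k\<close> colours provides for lower bounds: \<open>F\<close> is a rainbow edge set
  that connects \<open>S\<close>, and \<open>W\<close> is the set of vertices that it reaches.\<close>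

definition steiner_colouring :: "'a ugraph \<Rightarrow> nat \<Rightarrow> ('a set \<Rightarrow> nat) \<Rightarrow> bool" where
  "steiner_colouring K k c \<longleftrightarrow> c ` edges K \<subseteq> {..<k} \<and>
     (\<forall>S\<subseteq>vertices K. card S = 3 \<longrightarrow>
       (\<exists>F W. F \<subseteq> edges K \<and> inj_on c F \<and> S \<subseteq> W \<and> conn_set F W \<and> card W \<le> k + 1))"

lemma colourable_steiner:
  assumes "finite_simple_graph K" "colourable K k"
  obtains c where "steiner_colouring K k c"
proof -
  obtain c :: "'a set \<Rightarrow> nat" where c: "c ` edges K \<subseteq> {..<k}"
    and S: "\<And>S. S \<subseteq> vertices K \<Longrightarrow> card S = 3 \<Longrightarrow> \<exists>F\<subseteq>edges K. inj_on c F \<and> joins F S"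
    using assms(2) unfolding colourable_def by blast
  have "\<exists>F W. F \<subseteq> edges K \<and> inj_on c F \<and> S \<subseteq> W \<and> conn_set F W \<and> card W \<le> k + 1"
    if T: "S \<subseteq> vertices K" "card S = 3" for S
  proof -
    obtain F where F: "F \<subseteq> edges K" "inj_on c F" "joins F S" using S[OF T] by blast
    have "S \<noteq> {}" using T(2) by auto
    obtain W where "S \<subseteq> W" "W \<subseteq> vertices K" "conn_set F W" "card W \<le> k + 1"
      by (rule few_colours_steiner[OF assms(1) c F T(1) \<open>S \<noteq> {}\<close>])
    with F show ?thesis by blast
  qed
  with c that show ?thesis unfolding steiner_colouring_def by blast
qed

lemma steinerE:
  assumes "steiner_colouring K k c" "S \<subseteq> vertices K" "card S = 3"
  obtains F W where "F \<subseteq> edges K" "inj_on c F" "S \<subseteq> W" "conn_set F W" "card W \<le> k + 1"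
  using assms unfolding steiner_colouring_def by blast

lemma fsg_K5_minus_edge: "finite_simple_graph K5_minus_edge"
  and fsg_three_sun: "finite_simple_graph three_sun"
  and fsg_F1: "finite_simple_graph F1"
  and fsg_F3: "finite_simple_graph F3"
  and fsg_F4: "finite_simple_graph F4"
  and fsg_F5: "finite_simple_graph F5"
  by (auto simp: finite_simple_graph_def K5_minus_edge_def remove_edges_def complete_graph_def
      three_sun_def F1_def F2_def F3_def F4_def F5_def)

lemma fsg_complete_graph: "finite_simple_graph (complete_graph n)"
  by (auto simp: finite_simple_graph_def complete_graph_def)

lemma fsg_cycle_graph:
  assumes "2 \<le> n"
  shows "finite_simple_graph (cycle_graph n)"
proof -
  have "card {i, Suc i mod n} = 2" if "i < n" for i
    using that assms by (cases "Suc i = n") auto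
  then show ?thesis using assms by (auto simp: finite_simple_graph_def cycle_graph_def)
qed

lemma not_colourable_1:
  assumes K: "finite_simple_graph K" and n: "3 \<le> card (vertices K)"
  shows "\<not> colourable K 1"
proof
  assume "colourable K 1"
  then obtain c where c: "steiner_colouring K 1 c"
    by (rule colourable_steiner[OF K])
  obtain S where S: "S \<subseteq> vertices K" "card S = 3" using n by (rule obtain_subset_with_card_n)
  obtain F W where "S \<subseteq> W" "conn_set F W" "card W \<le> 1 + 1"
    by (rule steinerE[OF c S])
  with card_mono[of W S] conn_set_finite[of F W] S(2) show False by simp
qed

text \<open>Each of 1, 3 and 5 needs a neighbour in the tree. No vertex is adjacent to all three, so that the
  tree has at least five vertices.\<close>

lemma not_colourable_three_sun: "\<not> colourable three_sun 3"
proof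
  assume "colourable three_sun 3"
  then obtain c where c: "steiner_colouring three_sun 3 c"
    by (rule colourable_steiner[OF fsg_three_sun])
  obtain F W where F: "F \<subseteq> edges three_sun" and W: "{1, 3, 5} \<subseteq> W" "conn_set F W" "card W \<le> 3 + 1"
    by (rule steinerE[OF c, of "{1, 3, 5}"]) (simp_all add: three_sun_def)
  have nbr: "\<exists>v\<in>W. {u, v} \<in> edges three_sun" if u: "u \<in> {1, 3, 5}" for u
  proof -
    obtain b where b: "b \<in> {1, 3, 5}" "b \<noteq> u" using u by force
    obtain x v where "{x, v} \<in> F" "x \<in> {u}" "v \<in> W"
      by (rule conn_set_crosses[OF W(2), of u "{u}" b]) (use W(1) u b in auto)
    with F show ?thesis by auto
  qed
  have "2 \<in> W \<or> 6 \<in> W" "2 \<in> W \<or> 4 \<in> W" "4 \<in> W \<or> 6 \<in> W"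
    using nbr[of 1] nbr[of 3] nbr[of 5] by (auto simp: three_sun_def doubleton_eq_iff)
  then consider "{1, 2, 3, 4, 5} \<subseteq> W" | "{1, 2, 3, 5, 6} \<subseteq> W" | "{1, 3, 4, 5, 6} \<subseteq> W"
    using W(1) by auto
  then have "5 \<le> card W"
  proof cases
    case 1
    from card_mono[OF conn_set_finite[OF W(2)] this] show ?thesis by simp
  next
    case 2
    from card_mono[OF conn_set_finite[OF W(2)] this] show ?thesis by simp
  next
    case 3
    from card_mono[OF conn_set_finite[OF W(2)] this] show ?thesis by simp
  qed
  with W(3) show False by simp
qed

lemma not_colourable_F1: "\<not> colourable F1 2"
proof
  assume "colourable F1 2"
  then obtain c where c: "steiner_colouring F1 2 c"
    by (rule colourable_steiner[OF fsg_F1])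
  obtain F W where F: "F \<subseteq> edges F1" and W: "{1, 2, 4} \<subseteq> W" "conn_set F W" "card W \<le> 2 + 1"
    by (rule steinerE[OF c, of "{1, 2, 4}"]) (simp_all add: F1_def)
  obtain u v where "{u, v} \<in> F" "u \<in> {1, 2}" "v \<in> W" "v \<notin> {1, 2}"
    by (rule conn_set_crosses[OF W(2), of 1 "{1, 2}" 4]) (use W(1) in auto)
  with F have "3 \<in> W" by (auto simp: F1_def doubleton_eq_iff)
  then have "card {1, 2, 3, 4::nat} \<le> card W"
    using W(1) by (intro card_mono[OF conn_set_finite[OF W(2)]]) auto
  with W(3) show False by simp
qed

text \<open>A tree containing 2, 5 and 6 passes through the cut vertex 4 and leaves 2 through 1 or 3, so
  that it has at least five vertices.\<close>

lemma not_colourable_F3: "\<not> colourable F3 3"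
proof
  assume "colourable F3 3"
  then obtain c where c: "steiner_colouring F3 3 c"
    by (rule colourable_steiner[OF fsg_F3])
  obtain F W where F: "F \<subseteq> edges F3" and W: "{2, 5, 6} \<subseteq> W" "conn_set F W" "card W \<le> 3 + 1"
    by (rule steinerE[OF c, of "{2, 5, 6}"]) (simp_all add: F2_def F3_def)
  obtain u v where "{u, v} \<in> F" "u \<in> {5, 6}" "v \<in> W" "v \<notin> {5, 6}"
    by (rule conn_set_crosses[OF W(2), of 5 "{5, 6}" 2]) (use W(1) in auto)
  with F have "4 \<in> W" by (auto simp: F2_def F3_def doubleton_eq_iff)
  obtain u v where "{u, v} \<in> F" "u \<in> {2}" "v \<in> W" "v \<notin> {2}"
    by (rule conn_set_crosses[OF W(2), of 2 "{2}" 5]) (use W(1) in auto)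
  with F have "1 \<in> W \<or> 3 \<in> W" by (auto simp: F2_def F3_def doubleton_eq_iff)
  then obtain w where "w = 1 \<or> w = 3" "w \<in> W" by blast
  with \<open>4 \<in> W\<close> W(1) have "card {2, 4, 5, 6, w} \<le> card W"
    by (intro card_mono[OF conn_set_finite[OF W(2)]]) auto
  with W(3) \<open>w = 1 \<or> w = 3\<close> show False by auto
qed

lemma not_colourable_C5: "\<not> colourable (cycle_graph 5) 2"
proof
  have fsg: "finite_simple_graph (cycle_graph 5)" by (rule fsg_cycle_graph) simp
  assume "colourable (cycle_graph 5) 2"
  then obtain c where c: "steiner_colouring (cycle_graph 5) 2 c"
    by (rule colourable_steiner[OF fsg])
  obtain F W where F: "F \<subseteq> edges (cycle_graph 5)" and W: "{0, 1, 3} \<subseteq> W" "conn_set F W" "card W \<le> 2 + 1"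
    by (rule steinerE[OF c, of "{0, 1, 3}"]) (simp_all add: cycle_graph_def)
  obtain u v where uv: "{u, v} \<in> F" "u \<in> {3}" "v \<in> W" "v \<notin> {3}"
    by (rule conn_set_crosses[OF W(2), of 3 "{3}" 1]) (use W(1) in auto)
  then obtain i where "{3, v} = {i, Suc i mod 5}" "i < 5" using F unfolding cycle_graph_def by auto
  moreover from \<open>i < 5\<close> have "i = 0 \<or> i = 1 \<or> i = 2 \<or> i = 3 \<or> i = 4" by linarith
  ultimately have "v = 2 \<or> v = 4" by (auto simp: doubleton_eq_iff)
  moreover have "card {0, 1, 3, v} \<le> card W"
    using W(1) uv(3) by (intro card_mono[OF conn_set_finite[OF W(2)]]) auto
  ultimately show False using W(3) by auto
qed

text \<open>Rainbow trees in two colours have at most two edges. The triple \<open>{0, 1, x}\<close> forces different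
  colours on \<open>{0, x}\<close> and \<open>{1, x}\<close>, and no triangle is monochromatic. Two of the edges from 0, say to
  \<open>x\<close> and \<open>y\<close>, have the same colour; then \<open>{x, y}\<close> has the other one, and so do \<open>{1, x}\<close> and \<open>{1, y}\<close>.\<close>

lemma not_colourable_K5_minus_edge: "\<not> colourable K5_minus_edge 2"
proof
  let ?E = "edges K5_minus_edge"
  assume "colourable K5_minus_edge 2"
  then obtain c where sc: "steiner_colouring K5_minus_edge 2 c"
    by (rule colourable_steiner[OF fsg_K5_minus_edge])
  then have c: "c ` ?E \<subseteq> {..<2}" unfolding steiner_colouring_def by simp
  have E: "{i, j} \<in> ?E \<longleftrightarrow> i < 5 \<and> j < 5 \<and> i \<noteq> j \<and> {i, j} \<noteq> {0, 1}" for i j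
    unfolding K5_minus_edge_def remove_edges_def complete_graph_def by (auto simp: doubleton_eq_iff)
  have less: "c {i, j} < 2" if "{i, j} \<in> ?E" for i j using c that by blast
  have tree: "\<exists>F\<subseteq>?E. inj_on c F \<and> ({x, y} \<in> F \<or> {x, z} \<in> F) \<and> ({x, y} \<in> F \<or> {y, z} \<in> F) \<and>
      ({x, z} \<in> F \<or> {y, z} \<in> F)"
    if "x < 5" "y < 5" "z < 5" and d: "x \<noteq> y" "x \<noteq> z" "y \<noteq> z" for x y z
  proof -
    have V: "{x, y, z} \<subseteq> vertices K5_minus_edge"
      using that unfolding K5_minus_edge_def remove_edges_def complete_graph_def by simp
    have c3: "card {x, y, z} = 3" using d by simp
    obtain F W where F: "F \<subseteq> ?E" "inj_on c F" and W: "{x, y, z} \<subseteq> W" "conn_set F W" "card W \<le> 2 + 1"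
      by (rule steinerE[OF sc V c3])
    have W_eq: "W = {x, y, z}"
      using card_seteq[OF conn_set_finite[OF W(2)] W(1)] W(3) c3 by simp
    have nbr: "{p, q} \<in> F \<or> {p, r} \<in> F" if pqr: "{p, q, r} = {x, y, z}" "q \<noteq> p" for p q r
    proof -
      obtain u v where uv: "{u, v} \<in> F" "u \<in> {p}" "v \<in> W" "v \<notin> {p}"
        by (rule conn_set_crosses[OF W(2), of p "{p}" q]) (use W_eq pqr in auto)
      then have "v = q \<or> v = r" using W_eq pqr(1) by blast
      with uv show ?thesis by auto
    qed
    show ?thesis
      using F nbr[of x y z] nbr[of y x z] nbr[of z x y] d
      by (intro exI[of _ F]) (auto simp: insert_commute)
  qed
  have star: "c {0, x} \<noteq> c {1, x}" if "x \<in> {2, 3, 4}" for x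
  proof -
    have x: "0 < (5::nat)" "1 < (5::nat)" "x < 5" "0 \<noteq> (1::nat)" "0 \<noteq> x" "1 \<noteq> x" using that by auto
    obtain F where F: "F \<subseteq> ?E" "inj_on c F" "{0, 1} \<in> F \<or> {0, x} \<in> F" "{0, 1} \<in> F \<or> {1, x} \<in> F"
      using tree[OF x] by blast
    moreover have "{0, 1} \<notin> F" using F(1) E[of 0 1] by auto
    ultimately have "{0, x} \<in> F" "{1, x} \<in> F" by auto
    moreover have "{0, x} \<noteq> {1, x}" using that by (auto simp: doubleton_eq_iff)
    ultimately show ?thesis using F(2) by (auto dest: inj_onD)
  qed
  have tri: "\<not> (c {i, x} = c {i, y} \<and> c {i, x} = c {x, y})"
    if xy: "x \<in> {2, 3, 4}" "y \<in> {2, 3, 4}" "x \<noteq> y" and i: "i \<in> {0, 1}" for x y i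
  proof -
    have ixy: "i < 5" "x < 5" "y < 5" "i \<noteq> x" "i \<noteq> y" "x \<noteq> y" using that by auto
    obtain F where F: "F \<subseteq> ?E" "inj_on c F" "{i, x} \<in> F \<or> {i, y} \<in> F" "{i, x} \<in> F \<or> {x, y} \<in> F"
      "{i, y} \<in> F \<or> {x, y} \<in> F"
      using tree[OF ixy] by blast
    moreover have "{i, x} \<noteq> {i, y}" "{i, x} \<noteq> {x, y}" "{i, y} \<noteq> {x, y}"
      using that by (auto simp: doubleton_eq_iff)
    ultimately show ?thesis by (metis inj_onD)
  qed
  have "False" if xy: "x \<in> {2, 3, 4}" "y \<in> {2, 3, 4}" "x \<noteq> y" "c {0, x} = c {0, y}" for x y
  proof -
    have "c {0, x} < 2" "c {0, y} < 2" "c {1, x} < 2" "c {1, y} < 2" "c {x, y} < 2"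
      by (rule less; use xy in \<open>auto simp: E doubleton_eq_iff\<close>)+
    with star[OF xy(1)] star[OF xy(2)] tri[OF xy(1-3), of 0] tri[OF xy(1-3), of 1] xy(4)
    show False by auto
  qed
  from this[of 2 3] this[of 2 4] this[of 3 4]
  have "c {0, 2} \<noteq> c {0, 3}" "c {0, 2} \<noteq> c {0, 4}" "c {0, 3} \<noteq> c {0, 4}" by auto
  moreover have "c {0, 2} < 2" "c {0, 3} < 2" "c {0, 4} < 2"
    by (rule less; auto simp: E doubleton_eq_iff)+
  ultimately show False by linarith
qed


text \<open>The triples \<open>{1, 3, 5}\<close> and \<open>{1, 3, 6}\<close> have only the stars at 4 as trees, which use all colours;
  hence \<open>{4, 5}\<close> and \<open>{4, 6}\<close> have the same colour. Then \<open>{1, 5, 6}\<close> forces the colour of \<open>{3, 4}\<close> on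
  \<open>{5, 6}\<close>, whereas \<open>{3, 5, 6}\<close> forbids it.\<close>

lemma not_colourable_F4: "\<not> colourable F4 3"
proof
  let ?E = "edges F4"
  assume "colourable F4 3"
  then obtain c where sc: "steiner_colouring F4 3 c"
    by (rule colourable_steiner[OF fsg_F4])
  then have c: "c ` ?E \<subseteq> {..<3}" unfolding steiner_colouring_def by simp
  have E: "?E = {{2, 4}, {1, 2}, {2, 3}, {3, 4}, {4, 1}, {4, 5}, {5, 6}, {6, 4}}"
    unfolding F4_def F2_def by simp
  have outer: "c {1, 4} \<noteq> c {3, 4} \<and> c {1, 4} \<noteq> c {4, x} \<and> c {3, 4} \<noteq> c {4, x}" if x: "x \<in> {5, 6}" for x
  proof -
    have S: "{1, 3, x} \<subseteq> vertices F4" "card {1, 3, x} = 3" using x unfolding F4_def F2_def by auto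
    obtain F W where F: "F \<subseteq> ?E" "inj_on c F" and W: "{1, 3, x} \<subseteq> W" "conn_set F W" "card W \<le> 3 + 1"
      by (rule steinerE[OF sc S])
    obtain u v where "{u, v} \<in> F" "u \<in> {5, 6}" "v \<in> W" "v \<notin> {5, 6}"
      by (rule conn_set_crosses[OF W(2), of x "{5, 6}" 1]) (use W(1) x in auto)
    with F(1) have "4 \<in> W" unfolding E by (auto simp: doubleton_eq_iff)
    then have "{1, 3, 4, x} = W"
      using W x by (intro card_seteq[OF conn_set_finite[OF W(2)]]) auto
    note W_eq = this[symmetric]
    have nbr: "{p, 4} \<in> F" if p: "p \<in> {1, 3, x}" for p
    proof -
      obtain u v where uv: "{u, v} \<in> F" "u \<in> {p}" "v \<in> W" "v \<notin> {p}"
        by (rule conn_set_crosses[OF W(2), of p "{p}" 4]) (use W_eq p x in auto)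
      then have "{p, v} \<in> ?E" "v \<in> {1, 3, 4, x}" using F(1) W_eq by auto
      then have "v = 4" using p x unfolding E by (auto simp: doubleton_eq_iff)
      with uv show ?thesis by simp
    qed
    have "{1, 4} \<in> F" "{3, 4} \<in> F" "{4, x} \<in> F" using nbr[of 1] nbr[of 3] nbr[of x] by (auto simp: insert_commute)
    moreover have "{1, 4} \<noteq> {3, 4::nat}" "{1, 4} \<noteq> {4, x}" "{3, 4} \<noteq> {4, x}"
      using x by (auto simp: doubleton_eq_iff)
    ultimately show ?thesis using F(2) by (metis inj_onD)
  qed
  have inner: "c {4, 5} = c {4, 6} \<longrightarrow> c {5, 6} \<noteq> c {p, 4} \<and> c {5, 6} \<noteq> c {4, 5}" if p: "p \<in> {1, 3}" for p
  proof
    assume eq: "c {4, 5} = c {4, 6}"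
    have S: "{p, 5, 6} \<subseteq> vertices F4" "card {p, 5, 6} = 3" using p unfolding F4_def F2_def by auto
    obtain F W where F: "F \<subseteq> ?E" "inj_on c F" and W: "{p, 5, 6} \<subseteq> W" "conn_set F W" "card W \<le> 3 + 1"
      by (rule steinerE[OF sc S])
    obtain u v where uv: "{u, v} \<in> F" "u \<in> {5, 6}" "v \<in> W" "v \<notin> {5, 6}"
      by (rule conn_set_crosses[OF W(2), of 5 "{5, 6}" p]) (use W(1) p in auto)
    with F(1) have "4 \<in> W" "{4, 5} \<in> F \<or> {4, 6} \<in> F" unfolding E by (auto simp: doubleton_eq_iff insert_commute)
    then have "{p, 4, 5, 6} = W"
      using W p by (intro card_seteq[OF conn_set_finite[OF W(2)]]) auto
    note W_eq = this[symmetric]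
    obtain u v where uv: "{u, v} \<in> F" "u \<in> {p}" "v \<in> W" "v \<notin> {p}"
      by (rule conn_set_crosses[OF W(2), of p "{p}" 4]) (use W_eq p in auto)
    then have "{p, v} \<in> ?E" "v \<in> {4, 5, 6}" using F(1) W_eq by auto
    then have "v = 4" using p unfolding E by (auto simp: doubleton_eq_iff)
    with uv have p4: "{p, 4} \<in> F" by simp
    have nbr: "{q, 4} \<in> F \<or> {5, 6} \<in> F" if q: "q \<in> {5, 6}" for q
    proof -
      obtain u v where uv: "{u, v} \<in> F" "u \<in> {q}" "v \<in> W" "v \<notin> {q}"
        by (rule conn_set_crosses[OF W(2), of q "{q}" 4]) (use W_eq q in auto)
      then have "{q, v} \<in> ?E" using F(1) by auto
      then have "{q, v} = {q, 4} \<or> {q, v} = {5, 6}"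
        using q unfolding E by (auto simp: doubleton_eq_iff)
      with uv show ?thesis by auto
    qed
    have "{4, 5} \<notin> F \<or> {4, 6} \<notin> F"
      using inj_onD[OF F(2) eq] by (auto simp: doubleton_eq_iff)
    with nbr[of 5] nbr[of 6] have "{5, 6} \<in> F" by (auto simp: insert_commute)
    moreover have "{5, 6} \<noteq> {p, 4}" "{5, 6} \<noteq> {4, 5::nat}" "{5, 6} \<noteq> {4, 6::nat}"
      using p by (auto simp: doubleton_eq_iff)
    ultimately show "c {5, 6} \<noteq> c {p, 4} \<and> c {5, 6} \<noteq> c {4, 5}"
      using p4 \<open>{4, 5} \<in> F \<or> {4, 6} \<in> F\<close> F(2) eq by (metis inj_onD)
  qed
  have "c e < 3" if "e \<in> ?E" for e using c that by blast
  then have "c {1, 4} < 3" "c {3, 4} < 3" "c {4, 5} < 3" "c {4, 6} < 3" "c {5, 6} < 3"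
    unfolding E by (auto simp: insert_commute)
  with outer[of 5] outer[of 6] inner[of 1] inner[of 3] show False by simp
qed

section \<open>Lower bound for cycles\<close>

text \<open>At least three edges remain when one edge of each colour is set aside. Three of these and the
  representatives of their colours have as many colours as representatives; fill up to six edges.\<close>

lemma six_edges_three_colours:
  fixes k :: "nat \<Rightarrow> nat"
  assumes n: "6 \<le> n" and k: "k ` {..<n} \<subseteq> {..<n - 3}"
  obtains Q where "Q \<subseteq> {..<n}" "card Q = 6" "card (k ` Q) \<le> 3"
proof -
  obtain R where R: "R \<subseteq> {..<n}" "inj_on k R" "k ` {..<n} = k ` R"
    using subset_image_inj[of "k ` {..<n}" k "{..<n}"] by auto
  have finR: "finite R" using R(1) by (rule finite_subset) simp
  have "card R = card (k ` R)" using R(2) by (simp add: card_image)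
  also have "\<dots> \<le> card {..<n - 3}" using k R(3) by (intro card_mono) auto
  finally have "3 \<le> card ({..<n} - R)" using R(1) finR n by (simp add: card_Diff_subset)
  then obtain P where P: "P \<subseteq> {..<n} - R" "card P = 3" by (rule obtain_subset_with_card_n)
  define R' where "R' = {r \<in> R. k r \<in> k ` P}"
  have R'R: "R' \<subseteq> R" unfolding R'_def by blast
  have finP: "finite P" using P(2) by (simp add: card_ge_0_finite)
  have finR': "finite R'" using R'R finR by (rule finite_subset)
  have kR': "k ` R' = k ` P"
  proof -
    have "k ` P \<subseteq> k ` R'"
    proof
      fix y assume y: "y \<in> k ` P"
      then have "y \<in> k ` R" using P(1) R(3) by (metis Diff_subset image_mono subsetD)
      then obtain r where "r \<in> R" "y = k r" by blast
      with y show "y \<in> k ` R'" unfolding R'_def by simp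
    qed
    then show ?thesis unfolding R'_def by blast
  qed
  have "card R' = card (k ` P)" using kR' R(2) R'R by (metis card_image inj_on_subset)
  then have cR': "card R' \<le> 3" using card_image_le[OF finP, of k] P(2) by simp
  have disj: "P \<inter> R' = {}" using P(1) R'R by blast
  have cPR: "card (P \<union> R') = 3 + card R'" using card_Un_disjoint[OF finP finR' disj] P(2) by simp
  have PR: "P \<union> R' \<subseteq> {..<n}" using P(1) R'R R(1) by blast
  then obtain Q where Q: "P \<union> R' \<subseteq> Q" "Q \<subseteq> {..<n}" "card Q = 6"
    using exists_subset_between[of "P \<union> R'" 6 "{..<n}"] cPR cR' n by auto
  let ?A = "Q - (P \<union> R')"
  have finQ: "finite Q" using Q(3) by (simp add: card_ge_0_finite)
  have cA: "card ?A = 3 - card R'"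
    using card_Diff_subset[of "P \<union> R'" Q] finP finR' Q(1,3) cPR by simp
  have "k ` Q = k ` P \<union> k ` ?A" using Q(1) kR' by blast
  then have "card (k ` Q) \<le> card (k ` P) + card (k ` ?A)" by (simp add: card_Un_le)
  also have "\<dots> \<le> card R' + card ?A"
    using card_image_le[of ?A k] finQ \<open>card R' = card (k ` P)\<close> by simp
  also have "\<dots> = 3" using cA cR' by simp
  finally show ?thesis using that Q(2,3) by blast
qed

text \<open>Two missing edges cut the cycle into two arcs, one of which contains all of \<open>W\<close>.\<close>

lemma cycle_graph_missing_edges:
  assumes F: "F \<subseteq> edges (cycle_graph n)" and W: "conn_set F W" "s \<in> W" "t \<in> W"
    and ij: "i < j" "j < n" "{i, Suc i mod n} \<notin> F" "{j, Suc j mod n} \<notin> F"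
    and s: "i < s" "s \<le> j"
  shows "i < t \<and> t \<le> j"
proof (rule ccontr)
  assume "\<not> (i < t \<and> t \<le> j)"
  then obtain u v where uv: "{u, v} \<in> F" "u \<in> {i<..j}" "v \<notin> {i<..j}"
    by (metis conn_set_crosses[OF W(1,2), of "{i<..j}" t] W(3) s greaterThanAtMost_iff)
  then obtain m where m: "{u, v} = {m, Suc m mod n}" "m < n"
    using F unfolding cycle_graph_def by auto
  consider "u = m" "v = Suc m mod n" | "v = m" "u = Suc m mod n"
    using m(1) by (auto simp: doubleton_eq_iff)
  then show False
  proof cases
    case 1
    then have "m = j" using uv(2,3) m(2) ij(2) by (cases "Suc m = n") auto
    with 1 uv(1) ij(4) show False by simp
  next
    case 2
    then have "m = i" using uv(2,3) m(2) by (cases "Suc m = n") auto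
    with 2 uv(1) ij(3) show False by (simp add: insert_commute)
  qed
qed

lemma cycle_graph_edge_inj:
  assumes "3 \<le> n" "i < n" "j < n" "{i, Suc i mod n} = {j, Suc j mod n}"
  shows "i = j"
proof (rule ccontr)
  assume "i \<noteq> j"
  with assms(4) have "i = Suc j mod n" "j = Suc i mod n" by (metis doubleton_eq_iff)+
  moreover have "Suc x mod n = 0 \<and> Suc x = n \<or> Suc x mod n = Suc x" if "x < n" for x
    using that by (cases "Suc x = n") auto
  ultimately have "i = 0 \<and> Suc j = n \<or> i = Suc j" "j = 0 \<and> Suc i = n \<or> j = Suc i"
    using assms(2,3) by metis+
  with assms(1) show False by presburger
qed

text \<open>Number the six edges in cyclic order and take the first ends of every other one as a triple. The
  tree misses edges from at most one of the three arcs between these vertices, so that it contains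
  four of the six edges.\<close>

lemma not_colourable_cycle_graph:
  assumes n: "6 \<le> n"
  shows "\<not> colourable (cycle_graph n) (n - 3)"
proof
  let ?K = "cycle_graph n" and ?e = "\<lambda>i. {i, Suc i mod n}"
  have fsg: "finite_simple_graph ?K" using n by (intro fsg_cycle_graph) simp
  assume "colourable ?K (n - 3)"
  then obtain c where sc: "steiner_colouring ?K (n - 3) c"
    by (rule colourable_steiner[OF fsg])
  have "(\<lambda>i. c (?e i)) ` {..<n} \<subseteq> {..<n - 3}"
    using sc unfolding steiner_colouring_def cycle_graph_def by auto
  then obtain Q where Q: "Q \<subseteq> {..<n}" "card Q = 6" "card ((\<lambda>i. c (?e i)) ` Q) \<le> 3"
    by (rule six_edges_three_colours[OF n])
  have finQ: "finite Q" using Q(2) by (simp add: card_ge_0_finite)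
  define qs where "qs = sorted_list_of_set Q"
  have qs: "set qs = Q" "sorted_wrt (<) qs" "length qs = 6"
    unfolding qs_def using finQ Q(2) by simp_all
  then obtain q0 q1 q2 q3 q4 q5 where q: "qs = [q0, q1, q2, q3, q4, q5]"
    by (auto simp: numeral_eq_Suc length_Suc_conv)
  have less: "q0 < q1" "q1 < q2" "q2 < q3" "q3 < q4" "q4 < q5" "q5 < n"
    using qs Q(1) unfolding q by auto
  have S: "{q0, q2, q4} \<subseteq> vertices ?K" "card {q0, q2, q4} = 3"
    using less unfolding cycle_graph_def by auto
  obtain F W where F: "F \<subseteq> edges ?K" "inj_on c F" and W: "{q0, q2, q4} \<subseteq> W" "conn_set F W"
    by (rule steinerE[OF sc S])
  have W': "q0 \<in> W" "q2 \<in> W" "q4 \<in> W" using W(1) by auto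
  note gap = cycle_graph_missing_edges[OF F(1) W(2)]
  have arcs: "?e i \<in> F \<or> ?e j \<in> F"
    if "q0 \<le> i \<and> i < q2 \<and> q2 \<le> j \<and> j < n \<or> q2 \<le> i \<and> i < q4 \<and> q4 \<le> j \<and> j < n" for i j
    using gap[OF W'(2) W'(1), of i j] gap[OF W'(3) W'(2), of i j] that less by force
  have "\<exists>T. T \<subseteq> Q \<and> card T = 4 \<and> ?e ` T \<subseteq> F"
  proof (cases "?e q0 \<in> F \<and> ?e q1 \<in> F")
    case False
    have rest: "?e j \<in> F" if "q2 \<le> j" "j < n" for j
      using False arcs[of q0 j] arcs[of q1 j] that less by auto
    have "?e q2 \<in> F" "?e q3 \<in> F" "?e q4 \<in> F" "?e q5 \<in> F"
      by (rule rest; use less in linarith)+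
    then have "?e ` {q2, q3, q4, q5} \<subseteq> F" by blast
    moreover have "{q2, q3, q4, q5} \<subseteq> Q" "card {q2, q3, q4, q5} = 4"
      using qs(1) less unfolding q by auto
    ultimately show ?thesis by blast
  next
    case first: True
    show ?thesis
    proof (cases "?e q2 \<in> F \<and> ?e q3 \<in> F")
      case True
      with first have "?e ` {q0, q1, q2, q3} \<subseteq> F" by blast
      moreover have "{q0, q1, q2, q3} \<subseteq> Q" "card {q0, q1, q2, q3} = 4"
        using qs(1) less unfolding q by auto
      ultimately show ?thesis by blast
    next
      case False
      have rest: "?e j \<in> F" if "q4 \<le> j" "j < n" for j
        using False arcs[of q2 j] arcs[of q3 j] that less by auto
      have "?e q4 \<in> F" "?e q5 \<in> F"
        by (rule rest; use less in linarith)+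
      with first have "?e ` {q0, q1, q4, q5} \<subseteq> F" by blast
      moreover have "{q0, q1, q4, q5} \<subseteq> Q" "card {q0, q1, q4, q5} = 4"
        using qs(1) less unfolding q by auto
      ultimately show ?thesis by blast
    qed
  qed
  then obtain T where T: "T \<subseteq> Q" "card T = 4" "?e ` T \<subseteq> F" by blast
  have "inj_on (\<lambda>i. c (?e i)) T"
  proof (rule inj_onI)
    fix i j assume ij: "i \<in> T" "j \<in> T" "c (?e i) = c (?e j)"
    then have eq: "?e i = ?e j" using inj_onD[OF F(2) ij(3)] T(3) by blast
    have "i < n" "j < n" using ij T(1) Q(1) by auto
    from cycle_graph_edge_inj[OF _ this eq] n show "i = j" by simp
  qed
  then have "card ((\<lambda>i. c (?e i)) ` T) = 4" using T(2) by (simp add: card_image)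
  moreover have "card ((\<lambda>i. c (?e i)) ` T) \<le> card ((\<lambda>i. c (?e i)) ` Q)"
    using T(1) finQ by (intro card_mono) auto
  ultimately show False using Q(3) by simp
qed

section \<open>Lower bound for the chain of three triangles\<close>

text \<open>The variables are the colours of the edges of \<open>F5\<close>. If \<open>{1, 3}\<close> and \<open>{2, 3}\<close> as well as \<open>{5, 6}\<close> and
  \<open>{5, 7}\<close> have different colours, the middle triangle would have to show all four colours. If only one
  of these pairs agrees, five different colours occur. If both agree, the third edges of the
  outer triangles have the same colour, which then occurs on \<open>{3, 4}\<close> or \<open>{4, 5}\<close>, and the triples
  \<open>{1, 2, 4}\<close> and \<open>{4, 6, 7}\<close> cannot both be served.\<close>

lemma F5_colour_clash:
  fixes a12 a13 a23 a34 a45 a35 a56 a57 a67 :: nat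
  assumes b: "a12 < 4" "a13 < 4" "a23 < 4" "a34 < 4" "a45 < 4" "a35 < 4" "a56 < 4" "a57 < 4" "a67 < 4"
    and A: "\<And>p q. p \<in> {a13, a23} \<Longrightarrow> q \<in> {a56, a57} \<Longrightarrow>
        distinct [p, q, a34, a45] \<or> distinct [p, q, a34, a35] \<or> distinct [p, q, a45, a35]"
    and B: "\<And>q. q \<in> {a56, a57} \<Longrightarrow>
        distinct [a35, q, a12, a13] \<or> distinct [a35, q, a12, a23] \<or> distinct [a35, q, a13, a23]"
    and B': "\<And>p. p \<in> {a13, a23} \<Longrightarrow>
        distinct [a35, p, a56, a57] \<or> distinct [a35, p, a56, a67] \<or> distinct [a35, p, a57, a67]"
    and C: "distinct [a12, a13, a34] \<or> distinct [a12, a23, a34] \<or> distinct [a13, a23, a34] \<or>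
        distinct [a12, a13, a35, a45] \<or> distinct [a12, a23, a35, a45] \<or> distinct [a13, a23, a35, a45]"
    and C': "distinct [a56, a57, a45] \<or> distinct [a56, a67, a45] \<or> distinct [a57, a67, a45] \<or>
        distinct [a56, a57, a35, a34] \<or> distinct [a56, a67, a35, a34] \<or> distinct [a57, a67, a35, a34]"
  shows False
proof -
  have all: "x \<in> {p, q, r, s}"
    if "distinct [p, q, r, s]" "p < 4" "q < 4" "r < 4" "s < 4" "x < 4" for p q r s x :: nat
  proof -
    have "{p, q, r, s} = {..<4}"
      by (rule card_subset_eq) (use that in auto)
    with that(6) show ?thesis by simp
  qed
  have A_neq: "p \<noteq> q" if "p \<in> {a13, a23}" "q \<in> {a56, a57}" for p q
    using A[OF that] by auto
  have A_all: "x \<in> {a34, a45, a35}"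
    if pq: "p \<in> {a13, a23}" "q \<in> {a56, a57}" and x: "x < 4" "x \<noteq> p" "x \<noteq> q" for p q x
  proof -
    have "p < 4" "q < 4" using pq b by auto
    with A[OF pq] all[of p q a34 a45 x] all[of p q a34 a35 x] all[of p q a45 a35 x] x b
    show ?thesis by auto
  qed
  consider "a13 \<noteq> a23" "a56 \<noteq> a57" | "a13 \<noteq> a23" "a56 = a57" | "a13 = a23" "a56 \<noteq> a57"
    | "a13 = a23" "a56 = a57" by blast
  then show ?thesis
  proof cases
    case 1
    have "distinct [a13, a23, a56, a57]"
      using A_neq[of a13 a56] A_neq[of a13 a57] A_neq[of a23 a56] A_neq[of a23 a57] 1 by simp
    moreover from this have "set [a13, a23, a56, a57] \<subseteq> {a34, a45, a35}"
      using A_all[of a13 a56] A_all[of a23 a57] b by auto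
    then have "card (set [a13, a23, a56, a57]) \<le> card {a34, a45, a35}" by (rule card_mono[rotated]) simp
    moreover have "card {a34, a45, a35} \<le> 3" by (simp add: card_insert_if)
    ultimately show False using distinct_card[of "[a13, a23, a56, a57]"] by simp
  next
    case 2
    with B'[of a13] B'[of a23] A_neq[of a13 a56] A_neq[of a23 a56] all[of a35 a13 a56 a67 a23] b
    show False by auto
  next
    case 3
    with B[of a56] B[of a57] A_neq[of a13 a56] A_neq[of a13 a57] all[of a35 a56 a12 a13 a57] b
    show False by auto
  next
    case 4
    have d: "distinct [a35, a56, a12, a13]" "distinct [a35, a13, a56, a67]"
      using B[of a56] B'[of a13] 4 by auto
    have y: "a67 = a12" using all[OF d(1), of a67] d(2) b by auto
    have "a12 \<in> {a34, a45}" using A_all[of a13 a56 a12] d(1) b by auto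
    then show False
    proof
      assume a34: "a12 = a34"
      then have "distinct [a12, a13, a35, a45]" using C 4 by auto
      then have "a45 = a56" using all[OF d(1), of a45] b by auto
      with C' a34 y 4 show False by auto
    next
      assume "a12 \<in> {a45}"
      then have a45: "a12 = a45" by simp
      then have "distinct [a56, a67, a35, a34]" using C' y 4 by auto
      then have "a34 = a13" using all[OF d(1), of a34] y b by auto
      with C a45 y 4 show False by auto
    qed
  qed
qed

lemma distinct_colours: "inj_on c F \<Longrightarrow> set xs \<subseteq> F \<Longrightarrow> distinct xs \<Longrightarrow> distinct (map c xs)"
  unfolding distinct_map by (meson inj_on_subset)

lemma distinct_colours_two_of_three:
  assumes c: "inj_on c F" and F: "p \<in> F" "q \<in> F" "r \<in> F \<or> s \<in> F" "r \<in> F \<or> t \<in> F" "s \<in> F \<or> t \<in> F"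
    and d: "distinct [p, q, r, s, t]"
  shows "distinct [c p, c q, c r, c s] \<or> distinct [c p, c q, c r, c t] \<or> distinct [c p, c q, c s, c t]"
proof -
  have dist: "distinct [c p, c q, c x, c y]" if "x \<in> F" "y \<in> F" "distinct [p, q, x, y]" for x y
    using distinct_colours[OF c, of "[p, q, x, y]"] F(1,2) that by simp
  consider "r \<in> F \<and> s \<in> F" | "r \<in> F \<and> t \<in> F" | "s \<in> F \<and> t \<in> F" using F by blast
  then show ?thesis
  proof cases
    case 1
    with dist[of r s] d show ?thesis by simp
  next
    case 2
    with dist[of r t] d show ?thesis by simp
  next
    case 3
    with dist[of s t] d show ?thesis by simp
  qed
qed

lemma distinct_colours_two_of_three':
  assumes c: "inj_on c F" and F: "p \<in> F \<or> q \<in> F" "p \<in> F \<or> r \<in> F" "q \<in> F \<or> r \<in> F" "s \<in> F \<or> t \<in> F \<and> u \<in> F"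
    and d: "distinct [p, q, r, s, t, u]"
  shows "distinct [c p, c q, c s] \<or> distinct [c p, c r, c s] \<or> distinct [c q, c r, c s] \<or>
    distinct [c p, c q, c t, c u] \<or> distinct [c p, c r, c t, c u] \<or> distinct [c q, c r, c t, c u]"
proof (cases "s \<in> F")
  case True
  have dist: "distinct [c x, c y, c s]" if "x \<in> F" "y \<in> F" "distinct [x, y, s]" for x y
    using distinct_colours[OF c, of "[x, y, s]"] True that by simp
  consider "p \<in> F \<and> q \<in> F" | "p \<in> F \<and> r \<in> F" | "q \<in> F \<and> r \<in> F" using F by blast
  then show ?thesis
  proof cases
    case 1
    with dist[of p q] d show ?thesis by simp
  next
    case 2
    with dist[of p r] d show ?thesis by simp
  next
    case 3
    with dist[of q r] d show ?thesis by simp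
  qed
next
  case False
  then have "t \<in> F" "u \<in> F" using F by auto
  then have dist: "distinct [c x, c y, c t, c u]" if "x \<in> F" "y \<in> F" "distinct [x, y, t, u]" for x y
    using distinct_colours[OF c, of "[x, y, t, u]"] that by simp
  consider "p \<in> F \<and> q \<in> F" | "p \<in> F \<and> r \<in> F" | "q \<in> F \<and> r \<in> F" using F by blast
  then show ?thesis
  proof cases
    case 1
    with dist[of p q] d show ?thesis by simp
  next
    case 2
    with dist[of p r] d show ?thesis by simp
  next
    case 3
    with dist[of q r] d show ?thesis by simp
  qed
qed

text \<open>Four colours allow at most five vertices in a tree, so that the cut vertices 3 and 5 leave little
  choice for triples meeting both outer triangles.\<close>

lemma not_colourable_F5: "\<not> colourable F5 4"
proof
  let ?E = "edges F5"
  assume "colourable F5 4"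
  then obtain c where sc: "steiner_colouring F5 4 c"
    by (rule colourable_steiner[OF fsg_F5])
  then have c: "c ` ?E \<subseteq> {..<4}" unfolding steiner_colouring_def by simp
  have E: "?E = {{1, 2}, {2, 3}, {1, 3}, {3, 4}, {4, 5}, {3, 5}, {5, 6}, {6, 7}, {5, 7}}"
    unfolding F5_def by (simp add: insert_commute)
  have V: "vertices F5 = {1, 2, 3, 4, 5, 6, 7}"
    unfolding F5_def by auto
  have cross: "\<exists>u v. {u, v} \<in> F \<and> {u, v} \<in> ?E \<and> u \<in> W \<inter> X \<and> v \<in> W - X"
    if "conn_set F W" "F \<subseteq> ?E" "a \<in> W" "a \<in> X" "b \<in> W" "b \<notin> X" for F W X and a b :: nat
    by (rule conn_set_crosses[OF that(1,3-6)]) (use that(2) in blast)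
  have outer: "distinct [c {x, 3}, c {5, y}, c {3, 4}, c {4, 5}] \<or> distinct [c {x, 3}, c {5, y}, c {3, 4}, c {3, 5}] \<or>
      distinct [c {x, 3}, c {5, y}, c {4, 5}, c {3, 5}]"
    if x: "x = 1 \<or> x = 2" and y: "y = 6 \<or> y = 7" for x y
  proof -
    have S: "{x, 4, y} \<subseteq> vertices F5" "card {x, 4, y} = 3" using x y unfolding V by auto
    obtain F W where F: "F \<subseteq> ?E" "inj_on c F" and W: "{x, 4, y} \<subseteq> W" "conn_set F W" "card W \<le> 4 + 1"
      by (rule steinerE[OF sc S])
    have "3 \<in> W" using cross[OF W(2) F(1), of x "{1, 2}" 4] W(1) x
      unfolding E by (auto simp: doubleton_eq_iff)
    moreover have "5 \<in> W" using cross[OF W(2) F(1), of y "{6, 7}" 4] W(1) y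
      unfolding E by (auto simp: doubleton_eq_iff)
    ultimately have "{x, 3, 4, 5, y} = W"
      using W x y by (intro card_seteq[OF conn_set_finite[OF W(2)]]) auto
    note W_eq = this[symmetric]
    have "{x, 3} \<in> F" using cross[OF W(2) F(1), of x "{x}" 4] x y
      unfolding E W_eq by (auto simp: doubleton_eq_iff insert_commute)
    moreover have "{5, y} \<in> F" using cross[OF W(2) F(1), of y "{y}" 4] x y
      unfolding E W_eq by (auto simp: doubleton_eq_iff insert_commute)
    moreover have "{3, 4} \<in> F \<or> {4, 5} \<in> F" using cross[OF W(2) F(1), of 4 "{4}" 3] x y
      unfolding E W_eq by (auto simp: doubleton_eq_iff insert_commute)
    moreover have "{3, 4} \<in> F \<or> {3, 5} \<in> F" using cross[OF W(2) F(1), of 3 "{x, 3}" 4] x y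
      unfolding E W_eq by (auto simp: doubleton_eq_iff insert_commute)
    moreover have "{4, 5} \<in> F \<or> {3, 5} \<in> F" using cross[OF W(2) F(1), of 5 "{5, y}" 4] x y
      unfolding E W_eq by (auto simp: doubleton_eq_iff insert_commute)
    ultimately show ?thesis
      by (intro distinct_colours_two_of_three[OF F(2)]) (use x y in \<open>auto simp: doubleton_eq_iff\<close>)
  qed
  have right: "distinct [c {3, 5}, c {5, y}, c {1, 2}, c {1, 3}] \<or> distinct [c {3, 5}, c {5, y}, c {1, 2}, c {2, 3}] \<or>
      distinct [c {3, 5}, c {5, y}, c {1, 3}, c {2, 3}]"
    if y: "y = 6 \<or> y = 7" for y
  proof -
    have S: "{1, 2, y} \<subseteq> vertices F5" "card {1, 2, y} = 3" using y unfolding V by auto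
    obtain F W where F: "F \<subseteq> ?E" "inj_on c F" and W: "{1, 2, y} \<subseteq> W" "conn_set F W" "card W \<le> 4 + 1"
      by (rule steinerE[OF sc S])
    have "3 \<in> W" using cross[OF W(2) F(1), of 1 "{1, 2}" y] W(1) y
      unfolding E by (auto simp: doubleton_eq_iff)
    moreover have "5 \<in> W" using cross[OF W(2) F(1), of y "{6, 7}" 1] W(1) y
      unfolding E by (auto simp: doubleton_eq_iff)
    ultimately have "{1, 2, 3, 5, y} = W"
      using W y by (intro card_seteq[OF conn_set_finite[OF W(2)]]) auto
    note W_eq = this[symmetric]
    have "{3, 5} \<in> F" using cross[OF W(2) F(1), of 1 "{1, 2, 3}" y] y
      unfolding E W_eq by (auto simp: doubleton_eq_iff insert_commute)
    moreover have "{5, y} \<in> F" using cross[OF W(2) F(1), of y "{y}" 1] y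
      unfolding E W_eq by (auto simp: doubleton_eq_iff insert_commute)
    moreover have "{1, 2} \<in> F \<or> {1, 3} \<in> F" using cross[OF W(2) F(1), of 1 "{1}" 2] y
      unfolding E W_eq by (auto simp: doubleton_eq_iff insert_commute)
    moreover have "{1, 2} \<in> F \<or> {2, 3} \<in> F" using cross[OF W(2) F(1), of 2 "{2}" 1] y
      unfolding E W_eq by (auto simp: doubleton_eq_iff insert_commute)
    moreover have "{1, 3} \<in> F \<or> {2, 3} \<in> F" using cross[OF W(2) F(1), of 1 "{1, 2}" 3] y
      unfolding E W_eq by (auto simp: doubleton_eq_iff insert_commute)
    ultimately show ?thesis
      by (intro distinct_colours_two_of_three[OF F(2)]) (use y in \<open>auto simp: doubleton_eq_iff\<close>)
  qed
  have left: "distinct [c {3, 5}, c {x, 3}, c {5, 6}, c {5, 7}] \<or> distinct [c {3, 5}, c {x, 3}, c {5, 6}, c {6, 7}] \<or>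
      distinct [c {3, 5}, c {x, 3}, c {5, 7}, c {6, 7}]"
    if x: "x = 1 \<or> x = 2" for x
  proof -
    have S: "{6, 7, x} \<subseteq> vertices F5" "card {6, 7, x} = 3" using x unfolding V by auto
    obtain F W where F: "F \<subseteq> ?E" "inj_on c F" and W: "{6, 7, x} \<subseteq> W" "conn_set F W" "card W \<le> 4 + 1"
      by (rule steinerE[OF sc S])
    have "5 \<in> W" using cross[OF W(2) F(1), of 6 "{6, 7}" x] W(1) x
      unfolding E by (auto simp: doubleton_eq_iff)
    moreover have "3 \<in> W" using cross[OF W(2) F(1), of x "{1, 2}" 6] W(1) x
      unfolding E by (auto simp: doubleton_eq_iff)
    ultimately have "{6, 7, 3, 5, x} = W"
      using W x by (intro card_seteq[OF conn_set_finite[OF W(2)]]) auto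
    note W_eq = this[symmetric]
    have "{3, 5} \<in> F" using cross[OF W(2) F(1), of 6 "{5, 6, 7}" x] x
      unfolding E W_eq by (auto simp: doubleton_eq_iff insert_commute)
    moreover have "{x, 3} \<in> F" using cross[OF W(2) F(1), of x "{x}" 6] x
      unfolding E W_eq by (auto simp: doubleton_eq_iff insert_commute)
    moreover have "{5, 6} \<in> F \<or> {6, 7} \<in> F" using cross[OF W(2) F(1), of 6 "{6}" 7] x
      unfolding E W_eq by (auto simp: doubleton_eq_iff insert_commute)
    moreover have "{5, 7} \<in> F \<or> {6, 7} \<in> F" using cross[OF W(2) F(1), of 7 "{7}" 6] x
      unfolding E W_eq by (auto simp: doubleton_eq_iff insert_commute)
    moreover have "{5, 6} \<in> F \<or> {5, 7} \<in> F" using cross[OF W(2) F(1), of 6 "{6, 7}" 5] x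
      unfolding E W_eq by (auto simp: doubleton_eq_iff insert_commute)
    ultimately show ?thesis
      by (intro distinct_colours_two_of_three[OF F(2)]) (use x in \<open>auto simp: doubleton_eq_iff\<close>)
  qed
  have left_middle: "distinct [c {1, 2}, c {1, 3}, c {3, 4}] \<or> distinct [c {1, 2}, c {2, 3}, c {3, 4}] \<or>
      distinct [c {1, 3}, c {2, 3}, c {3, 4}] \<or> distinct [c {1, 2}, c {1, 3}, c {3, 5}, c {4, 5}] \<or>
      distinct [c {1, 2}, c {2, 3}, c {3, 5}, c {4, 5}] \<or> distinct [c {1, 3}, c {2, 3}, c {3, 5}, c {4, 5}]"
  proof -
    have S: "{1, 2, 4} \<subseteq> vertices F5" "card {1, 2, 4::nat} = 3" unfolding V by auto
    obtain F W where F: "F \<subseteq> ?E" "inj_on c F" and W: "{1, 2, 4} \<subseteq> W" "conn_set F W"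
      by (rule steinerE[OF sc S])
    have "{1, 2} \<in> F \<or> {1, 3} \<in> F" using cross[OF W(2) F(1), of 1 "{1}" 2] W(1)
      unfolding E by (auto simp: doubleton_eq_iff insert_commute)
    moreover have "{1, 2} \<in> F \<or> {2, 3} \<in> F" using cross[OF W(2) F(1), of 2 "{2}" 1] W(1)
      unfolding E by (auto simp: doubleton_eq_iff insert_commute)
    moreover have "{1, 3} \<in> F \<or> {2, 3} \<in> F" using cross[OF W(2) F(1), of 1 "{1, 2}" 4] W(1)
      unfolding E by (auto simp: doubleton_eq_iff insert_commute)
    moreover have "{3, 4} \<in> F \<or> {3, 5} \<in> F" using cross[OF W(2) F(1), of 1 "{1, 2, 3}" 4] W(1)
      unfolding E by (auto simp: doubleton_eq_iff insert_commute)
    moreover have "{3, 4} \<in> F \<or> {4, 5} \<in> F" using cross[OF W(2) F(1), of 4 "{4}" 1] W(1)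
      unfolding E by (auto simp: doubleton_eq_iff insert_commute)
    ultimately show ?thesis
      by (intro distinct_colours_two_of_three'[OF F(2)]) (auto simp: doubleton_eq_iff)
  qed
  have right_middle: "distinct [c {5, 6}, c {5, 7}, c {4, 5}] \<or> distinct [c {5, 6}, c {6, 7}, c {4, 5}] \<or>
      distinct [c {5, 7}, c {6, 7}, c {4, 5}] \<or> distinct [c {5, 6}, c {5, 7}, c {3, 5}, c {3, 4}] \<or>
      distinct [c {5, 6}, c {6, 7}, c {3, 5}, c {3, 4}] \<or> distinct [c {5, 7}, c {6, 7}, c {3, 5}, c {3, 4}]"
  proof -
    have S: "{6, 7, 4} \<subseteq> vertices F5" "card {6, 7, 4::nat} = 3" unfolding V by auto
    obtain F W where F: "F \<subseteq> ?E" "inj_on c F" and W: "{6, 7, 4} \<subseteq> W" "conn_set F W"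
      by (rule steinerE[OF sc S])
    have "{5, 6} \<in> F \<or> {6, 7} \<in> F" using cross[OF W(2) F(1), of 6 "{6}" 7] W(1)
      unfolding E by (auto simp: doubleton_eq_iff insert_commute)
    moreover have "{5, 7} \<in> F \<or> {6, 7} \<in> F" using cross[OF W(2) F(1), of 7 "{7}" 6] W(1)
      unfolding E by (auto simp: doubleton_eq_iff insert_commute)
    moreover have "{5, 6} \<in> F \<or> {5, 7} \<in> F" using cross[OF W(2) F(1), of 6 "{6, 7}" 4] W(1)
      unfolding E by (auto simp: doubleton_eq_iff insert_commute)
    moreover have "{4, 5} \<in> F \<or> {3, 5} \<in> F" using cross[OF W(2) F(1), of 6 "{5, 6, 7}" 4] W(1)
      unfolding E by (auto simp: doubleton_eq_iff insert_commute)
    moreover have "{4, 5} \<in> F \<or> {3, 4} \<in> F" using cross[OF W(2) F(1), of 4 "{4}" 6] W(1)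
      unfolding E by (auto simp: doubleton_eq_iff insert_commute)
    ultimately show ?thesis
      by (intro distinct_colours_two_of_three'[OF F(2)]) (auto simp: doubleton_eq_iff)
  qed
  have less: "c e < 4" if "e \<in> ?E" for e using c that by blast
  show False
  proof (rule F5_colour_clash[OF _ _ _ _ _ _ _ _ _ _ _ _ left_middle right_middle])
    show "c {1, 2} < 4" "c {1, 3} < 4" "c {2, 3} < 4" "c {3, 4} < 4" "c {4, 5} < 4" "c {3, 5} < 4"
      "c {5, 6} < 4" "c {5, 7} < 4" "c {6, 7} < 4"
      by (rule less; simp add: E)+
    show "distinct [p, q, c {3, 4}, c {4, 5}] \<or> distinct [p, q, c {3, 4}, c {3, 5}] \<or> distinct [p, q, c {4, 5}, c {3, 5}]"
      if "p \<in> {c {1, 3}, c {2, 3}}" "q \<in> {c {5, 6}, c {5, 7}}" for p q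
      using that outer[of 1 6] outer[of 1 7] outer[of 2 6] outer[of 2 7] by blast
    show "distinct [c {3, 5}, q, c {1, 2}, c {1, 3}] \<or> distinct [c {3, 5}, q, c {1, 2}, c {2, 3}] \<or>
        distinct [c {3, 5}, q, c {1, 3}, c {2, 3}]" if "q \<in> {c {5, 6}, c {5, 7}}" for q
      using that right[of 6] right[of 7] by blast
    show "distinct [c {3, 5}, p, c {5, 6}, c {5, 7}] \<or> distinct [c {3, 5}, p, c {5, 6}, c {6, 7}] \<or>
        distinct [c {3, 5}, p, c {5, 7}, c {6, 7}]" if "p \<in> {c {1, 3}, c {2, 3}}" for p
      using that left[of 1] left[of 2] by blast
  qed
qed

section \<open>The classification\<close>

context bridgeless
begin

lemma saves_two:
  assumes n: "4 \<le> card V"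
  shows "rx3 (V, E) + 2 \<le> card V"
proof -
  obtain xs where xs: "cycle xs" "circumference_le (length xs)" by (rule longest_cycle)
  show ?thesis
  proof (cases "4 \<le> length xs")
    case True
    then have "length xs = Suc (Suc (Suc (Suc (length xs - 4))))" by simp
    then obtain a b c D where D: "xs = a # b # c # D" "D \<noteq> []"
      unfolding length_Suc_conv by auto
    have e: "distinct (a # b # c # D)" "walk E D" "{a, b} \<in> E" "{b, c} \<in> E" "{c, hd D} \<in> E" "{last D, a} \<in> E"
      using xs(1) D unfolding cycle_def by (auto simp: successively_Cons)
    have "rx3 (V, E) + 4 \<le> 2 + card V"
      by (rule model[OF C4_cover, of "[[a], [b], [c], D]"])
        (use e cycle_in_V[OF xs(1)] D in \<open>auto simp: C4_def insert_commute intro: touch_ends\<close>)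
    then show ?thesis by simp
  next
    case False
    then have l: "length xs = 3" using xs(1) unfolding cycle_def by simp
    then have "set xs \<noteq> V" using n by (intro proper_subset) simp
    from triangle_extends[OF xs(1) l _ this] xs(2) l
      obtain a b c d e where "copy es_F1 [a, b, c, d, e]" by auto
    note K = this[unfolded copy_F1_iff]
    have "rx3 (V, E) + 5 \<le> 3 + card V"
      by (rule model[OF triangle_pair_cover, of "[[c], [a], [b], [d], [e]]"])
        (use K in \<open>auto simp: triangle_pair_def insert_commute intro: touch_ends\<close>)
    then show ?thesis by simp
  qed
qed

lemma copy_length: "copy es vs \<Longrightarrow> length vs \<le> card V"
  unfolding copy_def by (metis card_mono distinct_card finite_V)

lemma cycle_length: "cycle xs \<Longrightarrow> length xs \<le> card V"
  using cycle_in_V card_mono[OF finite_V] distinct_card unfolding cycle_def by metis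

lemma cycle_spanning: "cycle xs \<Longrightarrow> length xs = card V \<Longrightarrow> set xs = V"
  using cycle_in_V card_subset_eq[OF finite_V] distinct_card unfolding cycle_def by metis

lemma order_4:
  assumes n: "card V = 4"
  shows "vertex_conn 2 (V, E)" "\<exists>H. spanning_subgraph_of H (complete_graph 4) \<and> graph_isomorphic (V, E) H"
proof -
  obtain xs where xs: "cycle xs" "circumference_le (length xs)" by (rule longest_cycle)
  have "length xs \<noteq> 3"
  proof
    assume l: "length xs = 3"
    then have "set xs \<noteq> V" using n by (intro proper_subset) simp
    from triangle_extends[OF xs(1) l _ this] xs(2) l
      obtain a b c d e where "copy es_F1 [a, b, c, d, e]" by auto
    from copy_length[OF this] n show False by simp
  qed
  then have len: "length xs = 4" using cycle_length[OF xs(1)] xs(1) n unfolding cycle_def by simp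
  then have V: "set xs = V" using cycle_spanning[OF xs(1)] n by simp
  show "vertex_conn 2 (V, E)" by (rule hamiltonian_vertex_conn[OF xs(1) V])
  have "distinct xs" using xs(1) unfolding cycle_def by simp
  then show "\<exists>H. spanning_subgraph_of H (complete_graph 4) \<and> graph_isomorphic (V, E) H"
  proof (rule spanning_by_label[OF _ V len, where s = 0])
    show "vertices (complete_graph 4) = {0..<0 + 4}"
      unfolding complete_graph_def by auto
    fix i j :: nat assume "i < j" "j < 4"
    then have "i < 4" "j < 4" "i \<noteq> j" by simp_all
    then show "{0 + i, 0 + j} \<in> edges (complete_graph 4)"
      unfolding complete_graph_def by auto
  qed
qed

lemma complete_5_good:
  assumes n: "card V = 5" and complete: "\<And>x y. x \<in> V \<Longrightarrow> y \<in> V \<Longrightarrow> x \<noteq> y \<Longrightarrow> {x, y} \<in> E"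
  shows good
proof -
  obtain vs where vs: "set vs = V" "distinct vs" using finite_distinct_list[OF finite_V] by blast
  then have "length vs = 5" using n distinct_card by metis
  then obtain a b c d e where abc: "vs = [a, b, c, d, e]"
    by (auto simp: numeral_eq_Suc length_Suc_conv)
  have edge: "{x, y} \<in> E" if "x \<in> set vs" "y \<in> set vs" "x \<noteq> y" for x y
    using complete vs(1) that by simp
  have adj: "{a, b} \<in> E" "{a, c} \<in> E" "{a, d} \<in> E" "{a, e} \<in> E" "{b, c} \<in> E" "{b, d} \<in> E" "{b, e} \<in> E"
    "{c, d} \<in> E" "{c, e} \<in> E" "{d, e} \<in> E"
    by (rule edge; use vs(2) abc in simp)+
  have V: "distinct [a, b, c, d, e]" "{a, b, c, d, e} \<subseteq> V" using vs abc by auto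
  show ?thesis
    by (rule good_model[OF K5_cover, of "[[a], [b], [c], [d], [e]]"])
      (use adj V in \<open>auto simp: K5_def insert_commute intro: touch_ends\<close>)
qed

text \<open>Being extremal only excludes \<open>K5\<close>. Any two nonadjacent vertices can serve as the missing edge.\<close>

lemma order_5:
  assumes n: "card V = 5" and bad: "\<not> good"
  shows "graph_isomorphic (V, E) F1 \<or> vertex_conn 2 (V, E) \<and>
    (\<exists>H. spanning_subgraph_of H K5_minus_edge \<and> graph_isomorphic (V, E) H)"
proof -
  obtain xs where xs: "cycle xs" "circumference_le (length xs)" by (rule longest_cycle)
  have len: "3 \<le> length xs" "length xs \<le> 5"
    using xs(1) cycle_length[OF xs(1)] n unfolding cycle_def by auto
  show ?thesis
  proof (cases "length xs = 3")
    case True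
    then have "set xs \<noteq> V" using n by (intro proper_subset) simp
    from triangle_extends[OF xs(1) True _ this] xs(2) True
      obtain a b c d e where "copy es_F1 [a, b, c, d, e]" by auto
    from iso_F1[OF this _ _ n] xs(2) True show ?thesis by simp
  next
    case False
    have conn: "vertex_conn 2 (V, E)"
    proof (cases "length xs = 5")
      case True
      with cycle_spanning[OF xs(1)] n hamiltonian_vertex_conn[OF xs(1)] show ?thesis by simp
    next
      case False
      with \<open>length xs \<noteq> 3\<close> len have l: "length xs = 4" by simp
      then have "set xs \<noteq> V" using n by (intro proper_subset) simp
      from square_ear[OF xs(1) l _ this] xs(2) l bad
      consider p q x y z where "copy es_K23 [p, q, x, y, z]" | a b c d e f where "copy es_F2 [a, b, c, d, e, f]"
        by auto
      then show ?thesis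
      proof cases
        case 1
        from copy_spanning[OF this] n have "V = {p, q, x, y, z}" by simp
        from K23_vertex_conn[OF 1 this] show ?thesis .
      next
        case 2
        from copy_length[OF this] n show ?thesis by simp
      qed
    qed
    obtain x y where xy: "x \<in> V" "y \<in> V" "x \<noteq> y" "{x, y} \<notin> E"
      using complete_5_good[OF n] bad by blast
    obtain zs where zs: "set zs = V - {x, y}" "distinct zs"
      using finite_distinct_list[of "V - {x, y}"] finite_V by blast
    let ?vs = "x # y # zs"
    have vs: "distinct ?vs" "set ?vs = V" using zs xy by auto
    then have len: "length ?vs = 5" using n distinct_card by metis
    have "\<exists>H. spanning_subgraph_of H K5_minus_edge \<and> graph_isomorphic (V, E) H"
    proof (rule spanning_by_label[OF vs len, where s = 0])
      show "vertices K5_minus_edge = {0..<0 + 5}"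
        unfolding K5_minus_edge_def remove_edges_def complete_graph_def by auto
      fix i j :: nat assume ij: "i < j" "j < 5" "{?vs ! i, ?vs ! j} \<in> E"
      have "\<not> (i = 0 \<and> j = 1)" using ij(3) xy(4) by auto
      with ij(1) have "{i, j} \<noteq> {0, 1}" by (auto simp: doubleton_eq_iff)
      moreover have "i < 5" "i \<noteq> j" using ij by simp_all
      then have "{i, j} \<in> edges (complete_graph 5)"
        unfolding complete_graph_def using ij(2) by auto
      ultimately show "{0 + i, 0 + j} \<in> edges K5_minus_edge"
        unfolding K5_minus_edge_def remove_edges_def by simp
    qed
    with conn show ?thesis by simp
  qed
qed

lemma order_at_least_6:
  assumes n: "6 \<le> card V" and bad: "\<not> good"
  shows "vertex_conn 2 (V, E) \<and> (graph_isomorphic (V, E) (cycle_graph (card V)) \<or>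
      (\<exists>H. spanning_subgraph_of H three_sun \<and> graph_isomorphic (V, E) H)) \<or>
    graph_isomorphic (V, E) F2 \<or> graph_isomorphic (V, E) F3 \<or> graph_isomorphic (V, E) F4 \<or>
    graph_isomorphic (V, E) F5"
proof -
  obtain xs where xs: "cycle xs" "circumference_le (length xs)" by (rule longest_cycle)
  have "3 \<le> length xs" using xs(1) unfolding cycle_def by simp
  then consider "length xs = 3" | "length xs = 4" | "5 \<le> length xs" by linarith
  then show ?thesis
  proof cases
    case 1
    have l: "circumference_le 3" using xs(2) 1 by simp
    have "set xs \<noteq> V" using n 1 by (intro proper_subset) simp
    from triangle_extends[OF xs(1) 1 l this]
      obtain a b c d e where "copy es_F1 [a, b, c, d, e]" by auto
    from F1_extends[OF this l n] bad obtain a b c d e f g where F5: "copy es_F5 [a, b, c, d, e, f, g]" by auto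
    have "card V = 7"
    proof (rule ccontr)
      assume "card V \<noteq> 7"
      then have "8 \<le> card V" using copy_length[OF F5] by simp
      from F5_good[OF F5 l this] bad show False by simp
    qed
    from iso_F5[OF F5 _ l this] show ?thesis by simp
  next
    case 2
    have l: "circumference_le 4" using xs(2) 2 by simp
    have "set xs \<noteq> V" using n 2 by (intro proper_subset) simp
    with square_ear[OF xs(1) 2 l] K23_good[OF _ l n] bad
    obtain a b c d e f where F2: "copy es_F2 [a, b, c, d, e, f]" by blast
    have "card V = 6"
    proof (rule ccontr)
      assume "card V \<noteq> 6"
      then have "7 \<le> card V" using n by simp
      from F2_good[OF F2 l this] bad show False by simp
    qed
    from F2_spanning[OF F2 l this] bad show ?thesis by blast
  next
    case 3
    have V: "set xs = V"
      using longest_cycle_ear[OF xs 3] bad by blast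
    have conn: "vertex_conn 2 (V, E)" by (rule hamiltonian_vertex_conn[OF xs(1) V])
    show ?thesis
    proof (cases "card V = 6")
      case True
      with hexagon[OF xs(1) V _ bad] conn show ?thesis by blast
    next
      case False
      then have "7 \<le> card V" using n by simp
      from hamiltonian_cycle_or_good[OF xs(1) V this] bad conn show ?thesis by simp
    qed
  qed
qed

end

text \<open>\<open>H\<close> is a spanning subgraph of \<open>K\<close>, so that a colouring of \<open>G\<close> would give one of \<open>K\<close>.\<close>

lemma exceptional_rx3:
  assumes G: "finite_simple_graph G" "connected_graph G" and n: "3 \<le> card (vertices G)"
    and iso: "graph_isomorphic G H" "vertices H = vertices K" "edges H \<subseteq> edges K"
    and K: "finite_simple_graph K" "\<not> colourable K k"
  shows "k < rx3 G"
proof (rule ccontr)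
  assume "\<not> k < rx3 G"
  then have col: "colourable G k" using colourable_mono[OF colourable_rx3[OF G]] by simp
  obtain f where f: "bij_betw f (vertices G) (vertices K)"
    and edge: "\<And>x y. x \<in> vertices G \<Longrightarrow> y \<in> vertices G \<Longrightarrow> {x, y} \<in> edges G \<Longrightarrow> {f x, f y} \<in> edges K"
    using iso unfolding graph_isomorphic_def by (metis subsetD)
  have "edges G \<noteq> {}"
  proof
    assume "edges G = {}"
    then have J: "joins {} (vertices G)" using G(2) unfolding connected_graph_iff by simp
    obtain S where "S \<subseteq> vertices G" "card S = 3" using n by (rule obtain_subset_with_card_n)
    then obtain x y where "x \<in> vertices G" "y \<in> vertices G" "x \<noteq> y" by (auto simp: card_3_iff)
    with joins_crosses[OF J, of x "{x}" y] show False by auto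
  qed
  from colourable_embed[OF G(1) K(1) f edge n this col] K(2) show False by simp
qed

lemma graph_isomorphic_card: "graph_isomorphic G H \<Longrightarrow> card (vertices G) = card (vertices H)"
  unfolding graph_isomorphic_def using bij_betw_same_card by blast

theorem theorem9:
  fixes G :: "'a ugraph" and n :: nat
  assumes "finite_simple_graph G"
    and "edge_conn 2 G"
    and "card (vertices G) = n"
    and "4 \<le> n"
  shows "rx3 G \<le> n - 2 \<and>
    (rx3 G = n - 2 \<longleftrightarrow>
      (vertex_conn 2 G \<and>
        (graph_isomorphic G (cycle_graph n) \<or>
         (\<exists>H. spanning_subgraph_of H three_sun \<and> graph_isomorphic G H) \<or>
         (\<exists>H. spanning_subgraph_of H K5_minus_edge \<and> graph_isomorphic G H) \<or>
         (\<exists>H. spanning_subgraph_of H (complete_graph 4) \<and> graph_isomorphic G H))) \<or>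
      graph_isomorphic G F1 \<or> graph_isomorphic G F2 \<or> graph_isomorphic G F3 \<or>
      graph_isomorphic G F4 \<or> graph_isomorphic G F5)"
    (is "_ \<and> (_ \<longleftrightarrow> ?exceptional)")
proof -
  obtain V E where G: "G = (V, E)" by (cases G)
  interpret bridgeless V E
    using assms(1,2) unfolding G by unfold_locales
  have n: "card V = n" using assms(3) G by simp
  have upper: "rx3 G \<le> n - 2" using saves_two n assms(4) G by simp
  have "?exceptional" if eq: "rx3 G = n - 2"
  proof -
    have bad: "\<not> good" using eq n assms(4) G by simp
    consider "n = 4" | "n = 5" | "6 \<le> n" using assms(4) by linarith
    then show ?thesis
    proof cases
      case 1
      with order_4 n G show ?thesis by simp
    next
      case 2
      with order_5[OF _ bad] n G show ?thesis by auto
    next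
      case 3
      with order_at_least_6[OF _ bad] n G show ?thesis by auto
    qed
  qed
  moreover have "n - 2 \<le> rx3 G" if exc: "?exceptional"
  proof -
    have lower: "k < rx3 G"
      if "graph_isomorphic G H" "vertices H = vertices K" "edges H \<subseteq> edges K" "finite_simple_graph K" "\<not> colourable K k"
      for H K :: "nat ugraph" and k
      by (rule exceptional_rx3[OF assms(1) _ _ that]) (use connected assms(3,4) G in simp_all)
    have spanning: "k < rx3 G \<and> n = card (vertices K)"
      if "\<exists>H. spanning_subgraph_of H K \<and> graph_isomorphic G H" "finite_simple_graph K" "\<not> colourable K k"
      for K :: "nat ugraph" and k
    proof -
      obtain H where H: "spanning_subgraph_of H K" "graph_isomorphic G H" using \<open>\<exists>H. _\<close> by blast
      then have "vertices H = vertices K" "edges H \<subseteq> edges K"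
        unfolding spanning_subgraph_of_def subgraph_of_def by auto
      with lower[OF H(2) _ _ that(2,3)] graph_isomorphic_card[OF H(2)] assms(3) show ?thesis by simp
    qed
    have iso: "k < rx3 G \<and> n = card (vertices K)"
      if "graph_isomorphic G K" "finite_simple_graph K" "\<not> colourable K k" for K :: "nat ugraph" and k
      using lower[OF that(1) refl order_refl that(2,3)] graph_isomorphic_card[OF that(1)] assms(3) by simp
    have card_V: "card (vertices three_sun) = 6" "card (vertices K5_minus_edge) = 5"
      "card (vertices (complete_graph 4)) = 4" "card (vertices F1) = 5" "card (vertices F2) = 6"
      "card (vertices F3) = 6" "card (vertices F4) = 6" "card (vertices F5) = 7"
      unfolding three_sun_def K5_minus_edge_def remove_edges_def complete_graph_def F1_def F2_def F3_def
        F4_def F5_def by simp_all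
    from exc show ?thesis
    proof (elim disjE conjE)
      assume C: "graph_isomorphic G (cycle_graph n)"
      have fsg: "finite_simple_graph (cycle_graph n)" using assms(4) by (intro fsg_cycle_graph) simp
      consider "n = 4" | "n = 5" | "6 \<le> n" using assms(4) by linarith
      then show ?thesis
      proof cases
        case 1
        have "\<not> colourable (cycle_graph n) 1"
          using assms(4) by (intro not_colourable_1[OF fsg]) (simp add: cycle_graph_def)
        with iso[OF C fsg] 1 show ?thesis by fastforce
      next
        case 2
        with iso[OF C fsg, of 2] not_colourable_C5 show ?thesis by simp
      next
        case 3
        from iso[OF C fsg not_colourable_cycle_graph[OF 3]] 3 show ?thesis by linarith
      qed
    next
      assume "\<exists>H. spanning_subgraph_of H three_sun \<and> graph_isomorphic G H"
      from spanning[OF this fsg_three_sun not_colourable_three_sun] card_V show ?thesis by simp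
    next
      assume "\<exists>H. spanning_subgraph_of H K5_minus_edge \<and> graph_isomorphic G H"
      from spanning[OF this fsg_K5_minus_edge not_colourable_K5_minus_edge] card_V show ?thesis by simp
    next
      assume "\<exists>H. spanning_subgraph_of H (complete_graph 4) \<and> graph_isomorphic G H"
      from spanning[OF this fsg_complete_graph not_colourable_1[OF fsg_complete_graph]] card_V
      show ?thesis by simp
    next
      assume "graph_isomorphic G F1"
      from iso[OF this fsg_F1 not_colourable_F1] card_V show ?thesis by simp
    next
      assume "graph_isomorphic G F2"
      moreover have "vertices F2 = vertices F3" "edges F2 \<subseteq> edges F3" unfolding F3_def by auto
      ultimately have "3 < rx3 G" "n = 6"
        using lower[OF _ _ _ fsg_F3 not_colourable_F3, of F2] graph_isomorphic_card[of G F2] assms(3) card_V(5)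
        by auto
      then show ?thesis by simp
    next
      assume "graph_isomorphic G F3"
      from iso[OF this fsg_F3 not_colourable_F3] card_V show ?thesis by simp
    next
      assume "graph_isomorphic G F4"
      from iso[OF this fsg_F4 not_colourable_F4] card_V show ?thesis by simp
    next
      assume "graph_isomorphic G F5"
      from iso[OF this fsg_F5 not_colourable_F5] card_V show ?thesis by simp
    qed
  qed
  ultimately show ?thesis using upper by (metis le_antisym)
qed

end
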